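(* Let $G$ be a finite group, let $M$ be a maximal subgroup of $G$, and let $p$ be a prime. Then $$h^*(G)-h^*(M)\leq 2,\qquad \lambda(G)-\lambda(M)\leq 1\qquad\text{and}\qquad \lambda_p(G)-\lambda_p(M)\leq 1,$$ where $h^*$ denotes the generalized Fitting height, $\lambda_p$ the non-$p$-soluble length, and $\lambda=\lambda_2$ the nonsoluble length.
   Context: All groups are finite. $\mathrm{F}^*(G)$ denotes the generalized Fitting subgroup of $G$. Generalized Fitting height: put $\mathrm{F}^*_{(0)}(G)=1$ and let $\mathrm{F}^*_{(i+1)}(G)$ be the full inverse image in $G$ of $\mathrm{F}^*(G/\mathrm{F}^*_{(i)}(G))$. Then $h^*(G)$ is the least $h\ge 0$ with $\mathrm{F}^*_{(h)}(G)=G$. Non-$p$-soluble length: for a prime $p$, let $1=G_0\leq G_1\leq\dots\leq G_{2h+1}=G$ be a shortest series of normal subgroups of $G$ such that for even $i$ the factor $G_{i+1}/G_i$ is $p$-soluble (possibly trivial) and for odd $i$ the factor $G_{i+1}/G_i$ is a (non-empty) direct product of nonabelian simple groups. Then $\lambda_p(G)=h$. (A group is $p$-soluble if each of its chief factors is a $p$-group or a $p'$-group.) In particular $\lambda_p(G)=0$ if and only if $G$ is $p$-soluble. Nonsoluble length: $\lambda(G)=\lambda_2(G)$. *)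

theory Defs
  imports "HOL-Algebra.Algebra"
begin

text \<open>
  A subgroup \<open>H\<close> of \<open>G\<close>, considered as a group, is \<open>G\<lparr>carrier := H\<rparr>\<close>, and for
  \<open>K\<close> normal in \<open>H\<close> the factor \<open>H/K\<close> is \<open>G\<lparr>carrier := H\<rparr> Mod K\<close>.
  All notions below are intended for finite groups.
\<close>

definition maximal_subgroup :: "'a set \<Rightarrow> ('a, 'b) monoid_scheme \<Rightarrow> bool" where
  "maximal_subgroup M G \<longleftrightarrow>
     subgroup M G \<and> M \<noteq> carrier G \<and>
     (\<forall>H. subgroup H G \<and> M \<subseteq> H \<longrightarrow> H = M \<or> H = carrier G)"

subsection \<open>The generalized Fitting subgroup and the generalized Fitting height\<close>

definition group_center :: "('a, 'b) monoid_scheme \<Rightarrow> 'a set" where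
  "group_center G = {z \<in> carrier G. \<forall>x \<in> carrier G. z \<otimes>\<^bsub>G\<^esub> x = x \<otimes>\<^bsub>G\<^esub> z}"

definition commutator_subgroup :: "('a, 'b) monoid_scheme \<Rightarrow> 'a set \<Rightarrow> 'a set \<Rightarrow> 'a set" where
  "commutator_subgroup G H K =
     generate G {h \<otimes>\<^bsub>G\<^esub> k \<otimes>\<^bsub>G\<^esub> inv\<^bsub>G\<^esub> h \<otimes>\<^bsub>G\<^esub> inv\<^bsub>G\<^esub> k | h k. h \<in> H \<and> k \<in> K}"

primrec lower_central :: "('a, 'b) monoid_scheme \<Rightarrow> nat \<Rightarrow> 'a set" where
  "lower_central G 0 = carrier G"
| "lower_central G (Suc n) = commutator_subgroup G (lower_central G n) (carrier G)"

definition nilpotent_group :: "('a, 'b) monoid_scheme \<Rightarrow> bool" where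
  "nilpotent_group G \<longleftrightarrow> group G \<and> (\<exists>n. lower_central G n = {\<one>\<^bsub>G\<^esub>})"

definition fitting_subgroup :: "('a, 'b) monoid_scheme \<Rightarrow> 'a set" where
  "fitting_subgroup G = generate G (\<Union>{N. N \<lhd> G \<and> nilpotent_group (G\<lparr>carrier := N\<rparr>)})"

inductive subnormal :: "('a, 'b) monoid_scheme \<Rightarrow> 'a set \<Rightarrow> bool" for G where
  whole: "subnormal G (carrier G)"
| step: "\<lbrakk>subnormal G H; K \<lhd> G\<lparr>carrier := H\<rparr>\<rbrakk> \<Longrightarrow> subnormal G K"

definition quasisimple_group :: "('a, 'b) monoid_scheme \<Rightarrow> bool" where
  "quasisimple_group G \<longleftrightarrow>
     group G \<and> derived G (carrier G) = carrier G \<and> simple_group (G Mod group_center G)"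

definition component :: "('a, 'b) monoid_scheme \<Rightarrow> 'a set \<Rightarrow> bool" where
  "component G K \<longleftrightarrow> subnormal G K \<and> quasisimple_group (G\<lparr>carrier := K\<rparr>)"

definition layer :: "('a, 'b) monoid_scheme \<Rightarrow> 'a set" where
  "layer G = generate G (\<Union>{K. component G K})"

definition generalized_fitting_subgroup :: "('a, 'b) monoid_scheme \<Rightarrow> 'a set" where
  "generalized_fitting_subgroup G = fitting_subgroup G <#>\<^bsub>G\<^esub> layer G"

primrec generalized_fitting_series :: "('a, 'b) monoid_scheme \<Rightarrow> nat \<Rightarrow> 'a set" where
  "generalized_fitting_series G 0 = {\<one>\<^bsub>G\<^esub>}"
| "generalized_fitting_series G (Suc i) =
     {x \<in> carrier G. generalized_fitting_series G i #>\<^bsub>G\<^esub> x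
        \<in> generalized_fitting_subgroup (G Mod generalized_fitting_series G i)}"

definition generalized_fitting_height :: "('a, 'b) monoid_scheme \<Rightarrow> nat" where
  "generalized_fitting_height G = (LEAST h. generalized_fitting_series G h = carrier G)"

subsection \<open>The non-p-soluble length\<close>

definition chief_factor :: "('a, 'b) monoid_scheme \<Rightarrow> 'a set \<Rightarrow> 'a set \<Rightarrow> bool" where
  "chief_factor G H K \<longleftrightarrow>
     H \<lhd> G \<and> K \<lhd> G \<and> K \<subset> H \<and> (\<forall>N. N \<lhd> G \<and> K \<subseteq> N \<and> N \<subseteq> H \<longrightarrow> N = K \<or> N = H)"

definition p_soluble :: "nat \<Rightarrow> ('a, 'b) monoid_scheme \<Rightarrow> bool" where
  "p_soluble p G \<longleftrightarrow> group G \<and>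
     (\<forall>H K. chief_factor G H K \<longrightarrow>
        (\<exists>n. order (G\<lparr>carrier := H\<rparr> Mod K) = p ^ n) \<or> \<not> p dvd order (G\<lparr>carrier := H\<rparr> Mod K))"

text \<open>
  The factors \<open>S i\<close> may be taken over the element type of \<open>G\<close> without loss of generality, as
  each of them is isomorphic to a subgroup of \<open>G\<close>.
\<close>

definition product_of_nonabelian_simple_groups :: "('a, 'b) monoid_scheme \<Rightarrow> bool" where
  "product_of_nonabelian_simple_groups G \<longleftrightarrow>
     (\<exists>(n::nat) (S :: nat \<Rightarrow> 'a monoid). 0 < n \<and>
        (\<forall>i<n. simple_group (S i) \<and> \<not> comm_group (S i)) \<and> G \<cong> product_group {..<n} S)"

definition p_length_series :: "nat \<Rightarrow> ('a, 'b) monoid_scheme \<Rightarrow> nat \<Rightarrow> (nat \<Rightarrow> 'a set) \<Rightarrow> bool" where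
  "p_length_series p G h N \<longleftrightarrow>
     N 0 = {\<one>\<^bsub>G\<^esub>} \<and> N (2 * h + 1) = carrier G \<and>
     (\<forall>i \<le> 2 * h + 1. N i \<lhd> G) \<and>
     (\<forall>i \<le> 2 * h. N i \<subseteq> N (Suc i) \<and>
        (even i \<longrightarrow> p_soluble p (G\<lparr>carrier := N (Suc i)\<rparr> Mod N i)) \<and>
        (odd i \<longrightarrow> product_of_nonabelian_simple_groups (G\<lparr>carrier := N (Suc i)\<rparr> Mod N i)))"

definition non_p_soluble_length :: "nat \<Rightarrow> ('a, 'b) monoid_scheme \<Rightarrow> nat" where
  "non_p_soluble_length p G = (LEAST h. \<exists>N. p_length_series p G h N)"

definition nonsoluble_length :: "('a, 'b) monoid_scheme \<Rightarrow> nat" where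
  "nonsoluble_length G = non_p_soluble_length 2 G"

end

theory Submission
  imports Defs
begin

text \<open>
  Write \<open>W\<^sub>0 = 1 \<le> W\<^sub>1 \<le> \<dots>\<close> for the series of \<open>G\<close> whose factors are radicals of the quotients: always
  \<open>F\<^sup>*\<close> for the height, alternately the \<open>p\<close>-soluble radical and \<open>F\<^sup>*\<close> for the length; let \<open>M\<^sub>i\<close> be the
  terms of the corresponding series of \<open>M\<close>. As \<open>F\<^sup>*\<close> contains its centralizer, \<open>W\<^sub>i\<^sub>+\<^sub>2 \<le> M\<close> and
  \<open>M\<^sub>i = W\<^sub>i\<close> force \<open>M\<^sub>i\<^sub>+\<^sub>1 = W\<^sub>i\<^sub>+\<^sub>1\<close>. If \<open>k\<close> is maximal with \<open>W\<^sub>k \<le> M\<close>, the series therefore agree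
  up to \<open>k - 1\<close>. Since \<open>G = M W\<^sub>k\<^sub>+\<^sub>1\<close>, every later quotient of \<open>G\<close> is a quotient of \<open>M\<close>, and
  \<open>M\<^sub>i \<le> W\<^sub>i\<^sub>+\<^sub>2\<close> for \<open>i \<ge> k - 1\<close>: the series of \<open>M\<close> can be at most two terms shorter. For \<open>\<lambda>\<^sub>p\<close> two
  terms count as one step, and \<open>\<lambda>\<^sub>p(G)\<close> is the least \<open>h\<close> with \<open>W\<^sub>2\<^sub>h\<^sub>+\<^sub>1 = G\<close>.
\<close>

subsection \<open>Subgroups, normality and homomorphisms\<close>

text \<open>The obstacle is that M need not be subnormal, so a radical subgroup of M says nothing
  about G directly. The remedy is a commutator: [M(i+1), W(i+2)] is controlled inside the normal
  subgroup W(i+2) of G, where normal radical pieces are subnormal in G and fall into W(i+1). So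
  M(i+1) centralizes W(i+2)/W(i+1); if this factor is F*(G/W(i+1)), it contains its centralizer and
  pulls M(i+1) into W(i+2), where its radical pieces are subnormal in G. The argument looks two
  terms ahead: W(k) <= M yields agreement only up to k - 1, while products with M equal G only from
  k + 1 on, and this gap is the constant 2. In the alternating series W(i+2)/W(i+1) is a p-soluble
  radical for odd i and need not contain its centralizer. There one uses that M/M(i) has no
  nontrivial p-soluble normal subgroup, so that components alone generate F*(M/M(i)). Much of the
  length is spent on closure properties: p-solubility is tested on the chief factors of the group
  itself, so its passage to subgroups, extensions and products needs an argument each time.\<close>

context group
begin

lemma cancel_inv_left [simp]:
  "x \<in> carrier G \<Longrightarrow> y \<in> carrier G \<Longrightarrow> inv x \<otimes> (x \<otimes> y) = y"
  by (simp flip: m_assoc)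

lemma cancel_left_inv [simp]:
  "x \<in> carrier G \<Longrightarrow> y \<in> carrier G \<Longrightarrow> x \<otimes> (inv x \<otimes> y) = y"
  by (simp flip: m_assoc)

lemmas word_simps = m_assoc inv_mult_group

lemma subgroup_restrict_iff:
  assumes "subgroup H G"
  shows "subgroup K (G\<lparr>carrier := H\<rparr>) \<longleftrightarrow> subgroup K G \<and> K \<subseteq> H"
proof
  assume K: "subgroup K (G\<lparr>carrier := H\<rparr>)"
  then show "subgroup K G \<and> K \<subseteq> H"
    using incl_subgroup[OF assms K] subgroup.subset[OF K] by simp
qed (use assms subgroup_incl in blast)

lemma normal_restrict_iff:
  assumes "subgroup H G"
  shows "K \<lhd> G\<lparr>carrier := H\<rparr> \<longleftrightarrow>
    subgroup K G \<and> K \<subseteq> H \<and> (\<forall>h\<in>H. \<forall>k\<in>K. h \<otimes> k \<otimes> inv h \<in> K)"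
proof -
  interpret H: group "G\<lparr>carrier := H\<rparr>"
    using assms subgroup_imp_group by blast
  show ?thesis
    using assms by (auto simp: H.normal_inv_iff subgroup_restrict_iff)
qed

lemma normal_restrict:
  assumes "subgroup H G" "K \<lhd> G" "K \<subseteq> H"
  shows "K \<lhd> G\<lparr>carrier := H\<rparr>"
  using assms by (simp add: normal_restrict_supergroup)

lemma normal_mult_normal:
  assumes "A \<lhd> G" "B \<lhd> G"
  shows "A <#> B \<lhd> G"
proof -
  have sA: "subgroup A G" and sB: "subgroup B G"
    using assms normal_imp_subgroup by auto
  show ?thesis
  proof (rule normal_invI)
    show "subgroup (A <#> B) G"
      using assms sB by (simp add: mult_norm_subgroup)
    fix x h assume x: "x \<in> carrier G" and "h \<in> A <#> B"
    then obtain a b where ab: "a \<in> A" "b \<in> B" "h = a \<otimes> b"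
      by (auto simp: set_mult_def)
    have c: "a \<in> carrier G" "b \<in> carrier G"
      using ab subgroup.mem_carrier[OF sA] subgroup.mem_carrier[OF sB] by auto
    have "x \<otimes> h \<otimes> inv x = (x \<otimes> a \<otimes> inv x) \<otimes> (x \<otimes> b \<otimes> inv x)"
      using x c ab by (simp add: word_simps)
    moreover have "x \<otimes> a \<otimes> inv x \<in> A" "x \<otimes> b \<otimes> inv x \<in> B"
      using x ab by (auto intro!: normal.inv_op_closed2[OF assms(1)] normal.inv_op_closed2[OF assms(2)])
    ultimately show "x \<otimes> h \<otimes> inv x \<in> A <#> B"
      by (auto simp: set_mult_def)
  qed
qed

lemma subset_set_mult_left:
  assumes "subgroup B G" "A \<subseteq> carrier G"
  shows "A \<subseteq> A <#> B"
proof
  fix a assume "a \<in> A"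
  then have "a = a \<otimes> \<one>" "a \<in> A"
    using assms by auto
  then show "a \<in> A <#> B"
    using subgroup.one_closed[OF assms(1)] unfolding set_mult_def by blast
qed

lemma subset_set_mult_right:
  assumes "subgroup A G" "B \<subseteq> carrier G"
  shows "B \<subseteq> A <#> B"
proof
  fix b assume "b \<in> B"
  then have "b = \<one> \<otimes> b" "b \<in> B"
    using assms by auto
  then show "b \<in> A <#> B"
    using subgroup.one_closed[OF assms(1)] unfolding set_mult_def by blast
qed

lemma set_mult_least:
  assumes "subgroup H G" "A \<subseteq> H" "B \<subseteq> H"
  shows "A <#> B \<subseteq> H"
  using assms subgroup.m_closed[OF assms(1)] by (auto simp: set_mult_def)

lemma set_mult_carrier:
  assumes "subgroup H G"
  shows "H <#> carrier G = carrier G"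
  using set_mult_least[OF subgroup_self subgroup.subset[OF assms] subset_refl]
    subset_set_mult_right[OF assms subset_refl] by blast

end

text \<open>Coset maps, conjugations and the natural maps between quotients are all instances, and
  restriction to a subgroup stays inside the locale, so images of radicals are treated once for all
  of them.\<close>

locale surjective_hom = group_hom +
  assumes surj: "h ` carrier G = carrier H"
begin

lemma surjE:
  assumes "y \<in> carrier H"
  obtains x where "x \<in> carrier G" "h x = y"
  using assms unfolding surj[symmetric] by auto

lemma image_normal:
  assumes "N \<lhd> G"
  shows "h ` N \<lhd> H"
proof (rule H.normal_invI)
  show "subgroup (h ` N) H"
    by (rule subgroup_img_is_subgroup[OF normal_imp_subgroup[OF assms]])
  fix y n assume "y \<in> carrier H" "n \<in> h ` N"
  then obtain x m where x: "x \<in> carrier G" "h x = y" and m: "m \<in> N" "h m = n"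
    by (auto elim: surjE)
  have "m \<in> carrier G"
    using m(1) by (rule subgroup.mem_carrier[OF normal_imp_subgroup[OF assms]])
  then have "y \<otimes>\<^bsub>H\<^esub> n \<otimes>\<^bsub>H\<^esub> inv\<^bsub>H\<^esub> y = h (x \<otimes> m \<otimes> inv x)"
    using x m by simp
  moreover have "x \<otimes> m \<otimes> inv x \<in> N"
    by (rule normal.inv_op_closed2[OF assms x(1) m(1)])
  ultimately show "y \<otimes>\<^bsub>H\<^esub> n \<otimes>\<^bsub>H\<^esub> inv\<^bsub>H\<^esub> y \<in> h ` N" by blast
qed

lemma restrict_surjective:
  assumes "subgroup K G"
  shows "surjective_hom (G\<lparr>carrier := K\<rparr>) (H\<lparr>carrier := h ` K\<rparr>) h"
  using induced_group_hom[OF assms]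
  by (simp add: surjective_hom_def surjective_hom_axioms_def)

end

lemma (in group_hom) vimage_subgroup:
  assumes "subgroup L H"
  shows "subgroup {x \<in> carrier G. h x \<in> L} G"
proof (rule G.subgroupI)
  have "\<one> \<in> {x \<in> carrier G. h x \<in> L}"
    using subgroup.one_closed[OF assms] by simp
  then show "{x \<in> carrier G. h x \<in> L} \<noteq> {}" by blast
qed (use subgroup.m_closed[OF assms] subgroup.m_inv_closed[OF assms] in auto)

lemma (in group_hom) vimage_normal:
  assumes "L \<lhd> H"
  shows "{x \<in> carrier G. h x \<in> L} \<lhd> G"
proof (rule G.normal_invI)
  show "subgroup {x \<in> carrier G. h x \<in> L} G"
    using assms vimage_subgroup normal_imp_subgroup by blast
qed (use H.normal_invE(2)[OF assms] in auto)

lemma (in normal) surjective_hom_Mod: "surjective_hom G (G Mod H) (\<lambda>a. H #> a)"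
  unfolding surjective_hom_def surjective_hom_axioms_def group_hom_def group_hom_axioms_def
  using r_coset_hom_Mod factorgroup_is_group is_group by (simp add: carrier_FactGroup)

lemma (in normal) coset_eq_one_iff:
  assumes "x \<in> carrier G"
  shows "H #> x = H \<longleftrightarrow> x \<in> H"
  using assms coset_join1 coset_join2 subgroup_axioms by blast

lemma (in normal) finite_Mod: "finite (carrier G) \<Longrightarrow> finite (carrier (G Mod H))"
  by (simp add: carrier_FactGroup)

text \<open>Multiplication and identity of a quotient do not mention the carrier, so M/R is
  literally the image of \<open>M\<close> inside G/R and no isomorphism has to be carried
  along.\<close>

lemma restrict_Mod_eq:
  "G\<lparr>carrier := M\<rparr> Mod R = (G Mod R)\<lparr>carrier := (\<lambda>x. R #>\<^bsub>G\<^esub> x) ` M\<rparr>"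
  by (auto simp: FactGroup_def RCOSETS_def fun_eq_iff set_mult_def)

lemma (in group) conj_surjective_hom:
  assumes "g \<in> carrier G"
  shows "surjective_hom G G (\<lambda>x. g \<otimes> x \<otimes> inv g)"
proof -
  have "(\<lambda>x. g \<otimes> x \<otimes> inv g) ` carrier G = carrier G"
  proof
    show "carrier G \<subseteq> (\<lambda>x. g \<otimes> x \<otimes> inv g) ` carrier G"
    proof
      fix y assume "y \<in> carrier G"
      then show "y \<in> (\<lambda>x. g \<otimes> x \<otimes> inv g) ` carrier G"
        using assms by (intro image_eqI[of _ _ "inv g \<otimes> y \<otimes> g"]) (auto simp: word_simps)
    qed
  qed (use assms in auto)
  then show ?thesis
    using assms by unfold_locales (auto simp: hom_def word_simps)
qed

subsection \<open>Centralizers of sections\<close>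

text \<open>For normal \<open>S\<close> this is the full preimage in \<open>G\<close> of the
  centralizer of the image of \<open>N\<close> in \<open>G Mod S\<close>; trivial \<open>S\<close>
  gives the ordinary centralizer. Commutators in \<open>G\<close> keep cosets out of the
  calculations.\<close>

definition section_centralizer :: "('a, 'b) monoid_scheme \<Rightarrow> 'a set \<Rightarrow> 'a set \<Rightarrow> 'a set" where
  "section_centralizer G N S =
     {x \<in> carrier G. \<forall>n\<in>N. x \<otimes>\<^bsub>G\<^esub> n \<otimes>\<^bsub>G\<^esub> inv\<^bsub>G\<^esub> x \<otimes>\<^bsub>G\<^esub> inv\<^bsub>G\<^esub> n \<in> S}"

context group
begin

text \<open>Rests on [x^-1, n] = x^-1 [x, n]^-1 x and [xy, n] = x [y, n] x^-1 [x, n]; normality of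
  \<open>S\<close> absorbs the conjugations.\<close>

lemma section_centralizer_subgroup:
  assumes "N \<subseteq> carrier G" "S \<lhd> G"
  shows "subgroup (section_centralizer G N S) G"
proof (rule subgroupI)
  interpret S: normal S G by fact
  show "section_centralizer G N S \<subseteq> carrier G"
    by (auto simp: section_centralizer_def)
  have "\<one> \<in> section_centralizer G N S"
    using assms S.one_closed by (auto simp: section_centralizer_def subset_iff)
  then show "section_centralizer G N S \<noteq> {}" by blast
  fix x assume x: "x \<in> section_centralizer G N S"
  then have xc: "x \<in> carrier G" by (auto simp: section_centralizer_def)
  show "inv x \<in> section_centralizer G N S"
  proof (clarsimp simp: section_centralizer_def xc)
    fix n assume n: "n \<in> N"
    then have nc: "n \<in> carrier G" using assms by blast
    have "inv (x \<otimes> n \<otimes> inv x \<otimes> inv n) \<in> S"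
      using x n by (auto simp: section_centralizer_def)
    then have "inv x \<otimes> inv (x \<otimes> n \<otimes> inv x \<otimes> inv n) \<otimes> x \<in> S"
      using xc S.inv_op_closed1 by blast
    then show "inv x \<otimes> n \<otimes> x \<otimes> inv n \<in> S"
      using xc nc by (simp add: word_simps)
  qed
  fix y assume y: "y \<in> section_centralizer G N S"
  then have yc: "y \<in> carrier G" by (auto simp: section_centralizer_def)
  show "x \<otimes> y \<in> section_centralizer G N S"
  proof (clarsimp simp: section_centralizer_def xc yc)
    fix n assume n: "n \<in> N"
    then have nc: "n \<in> carrier G" using assms by blast
    have "y \<otimes> n \<otimes> inv y \<otimes> inv n \<in> S" and 1: "x \<otimes> n \<otimes> inv x \<otimes> inv n \<in> S"
      using x y n by (auto simp: section_centralizer_def)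
    then have "x \<otimes> (y \<otimes> n \<otimes> inv y \<otimes> inv n) \<otimes> inv x \<in> S"
      using xc S.inv_op_closed2 by blast
    from S.m_closed[OF this 1] show "x \<otimes> y \<otimes> n \<otimes> inv (x \<otimes> y) \<otimes> inv n \<in> S"
      using xc yc nc by (simp add: word_simps)
  qed
qed

lemma section_centralizer_normal:
  assumes "N \<lhd> G" "S \<lhd> G"
  shows "section_centralizer G N S \<lhd> G"
proof (rule normal_invI)
  interpret S: normal S G by fact
  interpret N: normal N G by fact
  show "subgroup (section_centralizer G N S) G"
    using assms N.subset section_centralizer_subgroup by blast
  fix g x assume g: "g \<in> carrier G" and x: "x \<in> section_centralizer G N S"
  then have xc: "x \<in> carrier G" by (auto simp: section_centralizer_def)
  show "g \<otimes> x \<otimes> inv g \<in> section_centralizer G N S"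
  proof (clarsimp simp: section_centralizer_def xc g)
    fix n assume n: "n \<in> N"
    then have nc: "n \<in> carrier G" by simp
    define m where "m = inv g \<otimes> n \<otimes> g"
    have mN: "m \<in> N"
      using n g N.inv_op_closed1 by (simp add: m_def)
    have "x \<otimes> m \<otimes> inv x \<otimes> inv m \<in> S"
      using x mN by (auto simp: section_centralizer_def)
    then have "g \<otimes> (x \<otimes> m \<otimes> inv x \<otimes> inv m) \<otimes> inv g \<in> S"
      using g S.inv_op_closed2 by blast
    then show "g \<otimes> x \<otimes> inv g \<otimes> n \<otimes> inv (g \<otimes> x \<otimes> inv g) \<otimes> inv n \<in> S"
      using xc nc g by (simp add: word_simps m_def)
  qed
qed

text \<open>A commutator is a conjugate of \<open>n\<close> times an inverse of \<open>n\<close>.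
  Asking for this single conjugate makes the lemma usable for subgroups that are normal merely in an
  intermediate group.\<close>

lemma commutator_mem_normal:
  assumes "subgroup N G" "n \<in> N" "x \<in> carrier G" "x \<otimes> n \<otimes> inv x \<in> N"
  shows "x \<otimes> n \<otimes> inv x \<otimes> inv n \<in> N" "n \<otimes> x \<otimes> inv n \<otimes> inv x \<in> N"
proof -
  have c: "n \<in> carrier G"
    using subgroup.mem_carrier[OF assms(1)] assms by blast
  show 1: "x \<otimes> n \<otimes> inv x \<otimes> inv n \<in> N"
    using assms subgroup.m_closed[OF assms(1)] subgroup.m_inv_closed[OF assms(1)] by simp
  have "inv (x \<otimes> n \<otimes> inv x \<otimes> inv n) \<in> N"
    using 1 subgroup.m_inv_closed[OF assms(1)] by blast
  then show "n \<otimes> x \<otimes> inv n \<otimes> inv x \<in> N"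
    using c assms by (simp add: word_simps)
qed

lemma commutator_swap:
  assumes "subgroup S G" "x \<in> carrier G" "y \<in> carrier G" "x \<otimes> y \<otimes> inv x \<otimes> inv y \<in> S"
  shows "y \<otimes> x \<otimes> inv y \<otimes> inv x \<in> S"
proof -
  have "inv (x \<otimes> y \<otimes> inv x \<otimes> inv y) \<in> S"
    using assms subgroup.m_inv_closed[OF assms(1)] by blast
  then show ?thesis
    using assms by (simp add: word_simps)
qed

lemma commutator_one_iff:
  assumes "x \<in> carrier G" "y \<in> carrier G"
  shows "x \<otimes> y \<otimes> inv x \<otimes> inv y = \<one> \<longleftrightarrow> x \<otimes> y = y \<otimes> x"
proof -
  have "x \<otimes> y \<otimes> inv x \<otimes> inv y = (x \<otimes> y) \<otimes> inv (y \<otimes> x)"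
    using assms by (simp add: word_simps)
  also have "\<dots> = \<one> \<longleftrightarrow> x \<otimes> y = y \<otimes> x"
    using assms by (metis inv_closed inv_equality inv_inv m_closed r_inv)
  finally show ?thesis .
qed

lemma section_centralizer_iff_commute:
  assumes "N \<subseteq> carrier G"
  shows "x \<in> section_centralizer G N {\<one>} \<longleftrightarrow> x \<in> carrier G \<and> (\<forall>n\<in>N. x \<otimes> n = n \<otimes> x)"
  using assms by (auto simp: section_centralizer_def commutator_one_iff subset_iff)

lemma group_center_normal: "group_center G \<lhd> G"
proof -
  have "group_center G = section_centralizer G (carrier G) {\<one>}"
    by (auto simp: group_center_def section_centralizer_iff_commute)
  moreover have "carrier G \<lhd> G"
    by (simp add: normal_invI subgroup_self)
  ultimately show ?thesis
    using section_centralizer_normal one_is_normal by simp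
qed

end

subsection \<open>Subnormal subgroups\<close>

lemma (in group) subnormal_imp_subgroup:
  assumes "subnormal G H"
  shows "subgroup H G"
  using assms
proof induction
  case (step H K)
  then show ?case
    using normal_restrict_iff by blast
qed (simp add: subgroup_self)

lemma (in group) normal_imp_subnormal:
  assumes "N \<lhd> G"
  shows "subnormal G N"
  using subnormal.step[OF subnormal.whole, of N G] assms by simp

lemma (in group) subnormal_trans:
  assumes "subnormal G H" "subnormal (G\<lparr>carrier := H\<rparr>) K"
  shows "subnormal G K"
  using assms(2)
proof (induction rule: subnormal.induct)
  case (step L K)
  then show ?case
    using subnormal.step[of G L K] by simp
qed (simp add: assms(1))

text \<open>The whole subnormal chain of \<open>K\<close> is intersected with \<open>N\<close>; each
  term stays normal in its predecessor.\<close>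

lemma (in group) subnormal_inter:
  assumes "subnormal G K" "subgroup N G"
  shows "subnormal (G\<lparr>carrier := N\<rparr>) (K \<inter> N)"
  using assms(1)
proof induction
  case whole
  have "carrier G \<inter> N = carrier (G\<lparr>carrier := N\<rparr>)"
    using assms subgroup.subset by auto
  then show ?case
    using subnormal.whole by metis
next
  case (step H K)
  have sH: "subgroup H G"
    using step subnormal_imp_subgroup by blast
  then have "K \<inter> N \<lhd> G\<lparr>carrier := H \<inter> N\<rparr>"
    using step.hyps assms normal_inter by blast
  then show ?case
    using subnormal.step[OF step.IH, of "K \<inter> N"] by simp
qed

lemma (in group) subnormal_subset:
  assumes "subnormal G K" "subgroup N G" "K \<subseteq> N"
  shows "subnormal (G\<lparr>carrier := N\<rparr>) K"
  using subnormal_inter[OF assms(1,2)] assms(3) by (simp add: Int_absorb2)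

lemma (in surjective_hom) image_subnormal:
  assumes "subnormal G K"
  shows "subnormal H (h ` K)"
  using assms
proof induction
  case whole
  then show ?case
    using subnormal.whole[of H] surj by simp
next
  case (step L K)
  then have "subgroup L G"
    using G.subnormal_imp_subgroup by blast
  then interpret L: surjective_hom "G\<lparr>carrier := L\<rparr>" "H\<lparr>carrier := h ` L\<rparr>" h
    by (rule restrict_surjective)
  show ?case
    using step L.image_normal subnormal.step by blast
qed

lemma maximal_card_exists:
  assumes "P Z" "\<And>W. P W \<Longrightarrow> card W \<le> b"
  obtains Y where "P Y" "\<And>W. P W \<Longrightarrow> card W \<le> card Y"
proof -
  have "\<exists>Y. P Y \<and> (\<forall>W. P W \<longrightarrow> card W \<le> card Y)"
    by (rule ex_has_greatest_nat[of P Z card "Suc b"]) (use assms in \<open>auto simp: less_Suc_eq_le\<close>)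
  then show ?thesis using that by blast
qed

subsection \<open>Nilpotent groups\<close>

context group
begin

lemma carrier_normal: "carrier G \<lhd> G"
  by (simp add: normal_invI subgroup_self)

lemma commutator_conj:
  assumes "g \<in> carrier G" "h \<in> carrier G" "k \<in> carrier G"
  shows "g \<otimes> (h \<otimes> k \<otimes> inv h \<otimes> inv k) \<otimes> inv g =
    (g \<otimes> h \<otimes> inv g) \<otimes> (g \<otimes> k \<otimes> inv g) \<otimes> inv (g \<otimes> h \<otimes> inv g) \<otimes> inv (g \<otimes> k \<otimes> inv g)"
  using assms by (simp add: word_simps)

lemma commutator_subgroup_normal:
  assumes "H \<lhd> G" "K \<lhd> G"
  shows "commutator_subgroup G H K \<lhd> G"
  unfolding commutator_subgroup_def
proof (rule normal_generateI)
  have c: "H \<subseteq> carrier G" "K \<subseteq> carrier G"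
    using assms normal_imp_subgroup subgroup.subset by blast+
  then show "{h \<otimes> k \<otimes> inv h \<otimes> inv k |h k. h \<in> H \<and> k \<in> K} \<subseteq> carrier G"
    by (auto simp: subset_iff)
  fix x g assume "x \<in> {h \<otimes> k \<otimes> inv h \<otimes> inv k |h k. h \<in> H \<and> k \<in> K}" and g: "g \<in> carrier G"
  then obtain h k where hk: "h \<in> H" "k \<in> K" "x = h \<otimes> k \<otimes> inv h \<otimes> inv k"
    by blast
  have "g \<otimes> h \<otimes> inv g \<in> H" "g \<otimes> k \<otimes> inv g \<in> K"
    using hk g by (auto intro: normal.inv_op_closed2[OF assms(1)] normal.inv_op_closed2[OF assms(2)])
  moreover have "g \<otimes> x \<otimes> inv g =
    (g \<otimes> h \<otimes> inv g) \<otimes> (g \<otimes> k \<otimes> inv g) \<otimes> inv (g \<otimes> h \<otimes> inv g) \<otimes> inv (g \<otimes> k \<otimes> inv g)"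
    unfolding hk(3) using hk c g by (intro commutator_conj) auto
  ultimately show "g \<otimes> x \<otimes> inv g \<in> {h \<otimes> k \<otimes> inv h \<otimes> inv k |h k. h \<in> H \<and> k \<in> K}"
    by blast
qed

lemma lower_central_normal: "lower_central G n \<lhd> G"
  by (induction n) (simp_all add: carrier_normal commutator_subgroup_normal)

lemma lower_central_subgroup: "subgroup (lower_central G n) G"
  by (rule normal_imp_subgroup[OF lower_central_normal])

lemma lower_central_commutator:
  assumes "h \<in> lower_central G n" "k \<in> carrier G"
  shows "h \<otimes> k \<otimes> inv h \<otimes> inv k \<in> lower_central G (Suc n)"
  using assms by (auto simp: commutator_subgroup_def intro!: generate.incl)

lemma lower_central_Suc_subset: "lower_central G (Suc n) \<subseteq> lower_central G n"
proof -
  have "h \<otimes> k \<otimes> inv h \<otimes> inv k \<in> lower_central G n"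
    if "h \<in> lower_central G n" "k \<in> carrier G" for h k
    using that by (intro commutator_mem_normal(2) lower_central_subgroup
        normal.inv_op_closed2[OF lower_central_normal])
  then have "{h \<otimes> k \<otimes> inv h \<otimes> inv k |h k. h \<in> lower_central G n \<and> k \<in> carrier G}
      \<subseteq> lower_central G n"
    by blast
  from generate_subgroup_incl[OF this lower_central_subgroup] show ?thesis
    by (simp add: commutator_subgroup_def)
qed

text \<open>The lower central series descends at least as fast as any central chain that starts at
  the whole group. Nilpotency can therefore be shown by exhibiting a convenient chain, which is the
  form of \<open>nilpotentI\<close>.\<close>

lemma lower_central_subset_central_chain:
  assumes "carrier G \<subseteq> c 0" "\<And>i. subgroup (c i) G"
    and "\<And>i h k. h \<in> c i \<Longrightarrow> k \<in> carrier G \<Longrightarrow> h \<otimes> k \<otimes> inv h \<otimes> inv k \<in> c (Suc i)"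
  shows "lower_central G n \<subseteq> c n"
proof (induction n)
  case (Suc n)
  then have "{h \<otimes> k \<otimes> inv h \<otimes> inv k |h k. h \<in> lower_central G n \<and> k \<in> carrier G} \<subseteq> c (Suc n)"
    using assms(3)[of _ n] by blast
  from generate_subgroup_incl[OF this assms(2)] show ?case
    by (simp add: commutator_subgroup_def)
qed (use assms in simp)

lemma nilpotentI:
  assumes "carrier G \<subseteq> c 0" "\<And>i. subgroup (c i) G" "c n = {\<one>}"
    and "\<And>i h k. h \<in> c i \<Longrightarrow> k \<in> carrier G \<Longrightarrow> h \<otimes> k \<otimes> inv h \<otimes> inv k \<in> c (Suc i)"
  shows "nilpotent_group G"
proof -
  have "lower_central G n \<subseteq> {\<one>}"
    using lower_central_subset_central_chain[of c n] assms by metis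
  moreover have "\<one> \<in> lower_central G n"
    using subgroup.one_closed[OF lower_central_subgroup] .
  ultimately show ?thesis
    unfolding nilpotent_group_def using is_group by blast
qed

lemma lower_central_restrict_subset:
  assumes "subgroup H G"
  shows "lower_central (G\<lparr>carrier := H\<rparr>) n \<subseteq> lower_central G n"
proof -
  interpret H: group "G\<lparr>carrier := H\<rparr>"
    using assms by (rule subgroup_imp_group)
  have "lower_central (G\<lparr>carrier := H\<rparr>) n \<subseteq> lower_central G n \<inter> H"
  proof (rule H.lower_central_subset_central_chain[where c = "\<lambda>n. lower_central G n \<inter> H"])
    show "carrier (G\<lparr>carrier := H\<rparr>) \<subseteq> lower_central G 0 \<inter> H"
      using subgroup.subset[OF assms] by simp
    show "subgroup (lower_central G i \<inter> H) (G\<lparr>carrier := H\<rparr>)" for i :: nat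
      by (simp add: subgroup_restrict_iff[OF assms] lower_central_subgroup assms subgroups_Inter_pair)
    fix i :: nat and h k assume hk: "h \<in> lower_central G i \<inter> H" "k \<in> carrier (G\<lparr>carrier := H\<rparr>)"
    then have "h \<otimes> k \<otimes> inv h \<otimes> inv k \<in> lower_central G (Suc i)"
      using subgroup.subset[OF assms] by (intro lower_central_commutator) auto
    moreover have "h \<otimes> k \<otimes> inv h \<otimes> inv k \<in> H"
      using hk subgroup.m_closed[OF assms] subgroup.m_inv_closed[OF assms] by auto
    ultimately show "h \<otimes>\<^bsub>G\<lparr>carrier := H\<rparr>\<^esub> k \<otimes>\<^bsub>G\<lparr>carrier := H\<rparr>\<^esub> inv\<^bsub>G\<lparr>carrier := H\<rparr>\<^esub> h
        \<otimes>\<^bsub>G\<lparr>carrier := H\<rparr>\<^esub> inv\<^bsub>G\<lparr>carrier := H\<rparr>\<^esub> k \<in> lower_central G (Suc i) \<inter> H"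
      using hk assms by simp
  qed
  then show ?thesis by blast
qed

lemma nilpotent_subgroup:
  assumes "nilpotent_group G" "subgroup H G"
  shows "nilpotent_group (G\<lparr>carrier := H\<rparr>)"
proof -
  interpret H: group "G\<lparr>carrier := H\<rparr>"
    using assms(2) by (rule subgroup_imp_group)
  obtain n where "lower_central G n = {\<one>}"
    using assms by (auto simp: nilpotent_group_def)
  then have "lower_central (G\<lparr>carrier := H\<rparr>) n \<subseteq> {\<one>}"
    using lower_central_restrict_subset[OF assms(2)] by blast
  moreover have "\<one> \<in> lower_central (G\<lparr>carrier := H\<rparr>) n"
    using subgroup.one_closed[OF H.lower_central_subgroup] by simp
  ultimately show ?thesis
    unfolding nilpotent_group_def using H.is_group by auto
qed

lemma trivial_nilpotent: "nilpotent_group (G\<lparr>carrier := {\<one>}\<rparr>)"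
  unfolding nilpotent_group_def
  by (auto simp: subgroup_imp_group triv_subgroup intro!: exI[of _ 0])

lemma nilpotent_of_central_commutators:
  assumes "\<And>x y. x \<in> carrier G \<Longrightarrow> y \<in> carrier G \<Longrightarrow> x \<otimes> y \<otimes> inv x \<otimes> inv y \<in> group_center G"
  shows "nilpotent_group G"
\<comment> \<open>The chain is the group, its centre, 1: the class is at most two.\<close>
proof (rule nilpotentI[where n = 2
      and c = "\<lambda>i. if i = 0 then carrier G else if i = 1 then group_center G else {\<one>}"])
  fix i :: nat and h k assume "h \<in> (if i = 0 then carrier G else if i = 1 then group_center G else {\<one>})"
    and "k \<in> carrier G"
  moreover have "h \<otimes> k \<otimes> inv h \<otimes> inv k = \<one>" if "h \<in> group_center G" "k \<in> carrier G"
    using that commutator_one_iff[of h k] by (auto simp: group_center_def)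
  ultimately show "h \<otimes> k \<otimes> inv h \<otimes> inv k \<in>
      (if Suc i = 0 then carrier G else if Suc i = 1 then group_center G else {\<one>})"
    using assms[of h k] one_closed by (auto simp: group_center_def split: if_splits)
qed (auto simp: subgroup_self triv_subgroup normal_imp_subgroup[OF group_center_normal])

end

lemma (in surjective_hom) nilpotent_image:
  assumes "nilpotent_group G"
  shows "nilpotent_group H"
proof -
  obtain n where n: "lower_central G n = {\<one>}"
    using assms by (auto simp: nilpotent_group_def)
  show ?thesis
  proof (rule H.nilpotentI[where n = n and c = "\<lambda>i. h ` lower_central G i"])
    show "subgroup (h ` lower_central G i) H" for i :: nat
      by (rule subgroup_img_is_subgroup[OF G.lower_central_subgroup])
    fix i :: nat and x y assume "x \<in> h ` lower_central G i" "y \<in> carrier H"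
    then obtain a b where a: "a \<in> lower_central G i" "h a = x" and b: "b \<in> carrier G" "h b = y"
      by (auto elim: surjE)
    have "a \<in> carrier G"
      using a(1) subgroup.subset[OF G.lower_central_subgroup] by blast
    then have "x \<otimes>\<^bsub>H\<^esub> y \<otimes>\<^bsub>H\<^esub> inv\<^bsub>H\<^esub> x \<otimes>\<^bsub>H\<^esub> inv\<^bsub>H\<^esub> y = h (a \<otimes> b \<otimes> inv a \<otimes> inv b)"
      using a b by simp
    then show "x \<otimes>\<^bsub>H\<^esub> y \<otimes>\<^bsub>H\<^esub> inv\<^bsub>H\<^esub> x \<otimes>\<^bsub>H\<^esub> inv\<^bsub>H\<^esub> y \<in> h ` lower_central G (Suc i)"
      using G.lower_central_commutator[OF a(1) b(1)] by blast
  qed (use n surj in auto)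
qed

section \<open>Nilpotent normal subgroups, chief factors and Fitting's theorem\<close>

context group
begin

text \<open>The terms are characteristic in \<open>N\<close>. Instead of using automorphisms, the
  proof rewrites each term as a commutator subgroup formed in \<open>G\<close>, which is normal in
  \<open>G\<close> by induction.\<close>

lemma lower_central_normal_in:
  assumes "N \<lhd> G"
  shows "lower_central (G\<lparr>carrier := N\<rparr>) i \<lhd> G"
proof (induction i)
  case (Suc i)
  have sN: "subgroup N G"
    using assms by (rule normal_imp_subgroup)
  interpret N: group "G\<lparr>carrier := N\<rparr>"
    using sN by (rule subgroup_imp_group)
  let ?A = "lower_central (G\<lparr>carrier := N\<rparr>) i"
  have AN: "?A \<subseteq> N"
    using subgroup.subset[OF N.lower_central_subgroup[of i]] by simp
  have eq: "h \<otimes>\<^bsub>G\<lparr>carrier := N\<rparr>\<^esub> k \<otimes>\<^bsub>G\<lparr>carrier := N\<rparr>\<^esub> inv\<^bsub>G\<lparr>carrier := N\<rparr>\<^esub> h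
      \<otimes>\<^bsub>G\<lparr>carrier := N\<rparr>\<^esub> inv\<^bsub>G\<lparr>carrier := N\<rparr>\<^esub> k = h \<otimes> k \<otimes> inv h \<otimes> inv k"
    if "h \<in> ?A" "k \<in> N" for h k
    using that AN sN by (simp add: subset_iff)
  have "{h \<otimes>\<^bsub>G\<lparr>carrier := N\<rparr>\<^esub> k \<otimes>\<^bsub>G\<lparr>carrier := N\<rparr>\<^esub> inv\<^bsub>G\<lparr>carrier := N\<rparr>\<^esub> h
      \<otimes>\<^bsub>G\<lparr>carrier := N\<rparr>\<^esub> inv\<^bsub>G\<lparr>carrier := N\<rparr>\<^esub> k |h k. h \<in> ?A \<and> k \<in> N} =
      {h \<otimes> k \<otimes> inv h \<otimes> inv k |h k. h \<in> ?A \<and> k \<in> N}" (is "?S = ?T")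
    using eq by (intro Collect_cong) (metis (no_types, lifting))
  moreover have "?T \<subseteq> N"
    using AN subgroup.m_closed[OF sN] subgroup.m_inv_closed[OF sN] by auto
  ultimately have "lower_central (G\<lparr>carrier := N\<rparr>) (Suc i) = commutator_subgroup G ?A N"
    using generate_consistent[OF _ sN] by (simp add: commutator_subgroup_def)
  then show ?case
    using commutator_subgroup_normal[OF Suc assms] by simp
qed (use assms in simp)

text \<open>Let \<open>A i\<close> be the lower central series of \<open>N\<close>. By chiefness
  \<open>U\<close> meets \<open>A i <#> Y\<close> in \<open>Y\<close> or in \<open>U\<close>. At an
  \<open>i\<close> with \<open>U\<close> inside \<open>A i <#> Y\<close> but not inside
  \<open>A (Suc i) <#> Y\<close>, the commutators [N, U] lie in \<open>A (Suc i) <#> Y\<close> and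
  in \<open>U\<close>, hence in \<open>Y\<close>. If \<open>U\<close> is not even inside
  \<open>A 0 <#> Y\<close>, they lie in both \<open>N\<close> and \<open>U\<close>, which again
  gives \<open>Y\<close>.\<close>

lemma nilpotent_normal_centralizes_chief_factor:
  assumes N: "N \<lhd> G" and nil: "nilpotent_group (G\<lparr>carrier := N\<rparr>)" and ch: "chief_factor G U Y"
  shows "N \<subseteq> section_centralizer G U Y"
proof -
  define A where "A = lower_central (G\<lparr>carrier := N\<rparr>)"
  have U: "U \<lhd> G" and Y: "Y \<lhd> G" and YX: "Y \<subseteq> U" "U \<noteq> Y"
    and chief: "\<And>N. N \<lhd> G \<Longrightarrow> Y \<subseteq> N \<Longrightarrow> N \<subseteq> U \<Longrightarrow> N = Y \<or> N = U"
    using ch by (auto simp: chief_factor_def)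
  interpret U: normal U G by fact
  interpret Y: normal Y G by fact
  interpret N: normal N G by fact
  interpret GN: group "G\<lparr>carrier := N\<rparr>"
    using N.subgroup_axioms by (rule subgroup_imp_group)
  have A: "A i \<lhd> G" for i
    unfolding A_def using N by (rule lower_central_normal_in)
  have A0: "A 0 = N" by (simp add: A_def)
  have AN: "A i \<subseteq> N" for i
    using subgroup.subset[OF GN.lower_central_subgroup[of i]] by (simp add: A_def)
  obtain n where n: "A n = {\<one>}"
    using nil by (auto simp: nilpotent_group_def A_def)
  have meet: "U \<inter> (A i <#> Y) = Y" if "\<not> U \<subseteq> A i <#> Y" for i
  proof -
    have "U \<inter> (A i <#> Y) \<lhd> G"
      using A U Y normal_mult_normal normal_subgroup_intersect by blast
    moreover have "Y \<subseteq> A i <#> Y"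
      by (rule subset_set_mult_right[OF normal_imp_subgroup[OF A] Y.subset])
    ultimately show ?thesis
      using chief[of "U \<inter> (A i <#> Y)"] YX that by blast
  qed
  have comX: "a \<otimes> x \<otimes> inv a \<otimes> inv x \<in> U" if "a \<in> N" "x \<in> U" for a x
    using that by (intro commutator_mem_normal U.subgroup_axioms U.inv_op_closed2) auto
  have "a \<otimes> x \<otimes> inv a \<otimes> inv x \<in> Y" if a: "a \<in> N" and x: "x \<in> U" for a x
  proof (cases "U \<subseteq> A 0 <#> Y")
    case False
    have "a \<otimes> x \<otimes> inv a \<otimes> inv x \<in> N"
      using a x by (intro commutator_mem_normal N.subgroup_axioms N.inv_op_closed2) auto
    moreover have "N \<subseteq> A 0 <#> Y"
      unfolding A0 by (rule subset_set_mult_left[OF Y.subgroup_axioms N.subset])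
    ultimately show ?thesis
      using meet[OF False] comX[OF a x] by blast
  next
    case True
    \<comment> \<open>\<open>A n\<close> is trivial, so \<open>A n <#> Y\<close> is just
      \<open>Y\<close>; the inclusion of \<open>U\<close> is lost at some step of the
      series.\<close>
    have "\<not> U \<subseteq> A n <#> Y"
      using YX by (auto simp: n set_mult_def)
    moreover have "U \<subseteq> A n <#> Y" if "\<And>i. U \<subseteq> A i <#> Y \<Longrightarrow> U \<subseteq> A (Suc i) <#> Y"
      using True that by (rule nat_induct)
    ultimately obtain i where i: "U \<subseteq> A i <#> Y" "\<not> U \<subseteq> A (Suc i) <#> Y"
      by blast
    obtain b y where b: "b \<in> A i" and y: "y \<in> Y" and xby: "x = b \<otimes> y"
      using i(1) x by (auto simp: set_mult_def)
    have bN: "b \<in> N" using b AN by blast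
    have "b \<otimes> a \<otimes> inv b \<otimes> inv a \<in> A (Suc i)"
      using GN.lower_central_commutator[of b i a] a b bN
      by (simp add: A_def m_inv_consistent[OF N.subgroup_axioms])
    then have 1: "a \<otimes> b \<otimes> inv a \<otimes> inv b \<in> A (Suc i)"
      using commutator_swap[OF normal_imp_subgroup[OF A]] a bN by simp
    have "a \<otimes> y \<otimes> inv a \<otimes> inv y \<in> Y"
      using a y by (intro commutator_mem_normal Y.subgroup_axioms Y.inv_op_closed2) auto
    then have 2: "b \<otimes> (a \<otimes> y \<otimes> inv a \<otimes> inv y) \<otimes> inv b \<in> Y"
      using bN by (intro Y.inv_op_closed2) auto
    \<comment> \<open>With x = by, the commutator [a, x] is [a, b] times a conjugate of [a, y]: the
      first factor descends one central step, the second lies in \<open>Y\<close>.\<close>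
    have "a \<otimes> x \<otimes> inv a \<otimes> inv x =
      (a \<otimes> b \<otimes> inv a \<otimes> inv b) \<otimes> (b \<otimes> (a \<otimes> y \<otimes> inv a \<otimes> inv y) \<otimes> inv b)"
      using a bN y by (simp add: xby word_simps)
    then have "a \<otimes> x \<otimes> inv a \<otimes> inv x \<in> A (Suc i) <#> Y"
      using 1 2 by (auto simp: set_mult_def)
    then show ?thesis
      using meet[OF i(2)] comX[OF a x] by blast
  qed
  then show ?thesis
    by (auto simp: section_centralizer_def)
qed

lemma chief_factor_exists:
  assumes "finite (carrier G)" "U \<lhd> G" "Z \<lhd> G" "Z \<subset> U"
  obtains Y where "chief_factor G U Y" "Z \<subseteq> Y"
proof -
  let ?P = "\<lambda>Y. Y \<lhd> G \<and> Z \<subseteq> Y \<and> Y \<subset> U"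
  have bound: "card Y \<le> card (carrier G)" if "?P Y" for Y
    using that assms(1) subgroup.subset[OF normal_imp_subgroup] by (metis card_mono)
  obtain Y where Y: "?P Y" and max: "\<And>W. ?P W \<Longrightarrow> card W \<le> card Y"
    using maximal_card_exists[of ?P Z, OF _ bound] assms by blast
  have "finite U"
    using assms subgroup.subset[OF normal_imp_subgroup] finite_subset by metis
  then have "W = Y \<or> W = U" if "W \<lhd> G" "Y \<subseteq> W" "W \<subseteq> U" for W
    using max[of W] that Y by (metis card_seteq finite_subset psubsetI subset_trans)
  then have "chief_factor G U Y"
    using Y assms by (auto simp: chief_factor_def)
  then show ?thesis using that Y by blast
qed

text \<open>By finiteness the lower central series becomes stationary at some \<open>U\<close> with
  [U, G] = U. If \<open>U\<close> were nontrivial, a chief factor U/Y would be central, and [U, G]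
  would lie in \<open>Y\<close>, properly below \<open>U\<close>.\<close>

lemma nilpotent_if_centralizes_chief_factors:
  assumes fin: "finite (carrier G)"
    and central: "\<And>U Y. chief_factor G U Y \<Longrightarrow> section_centralizer G U Y = carrier G"
  shows "nilpotent_group G"
proof -
  have "\<exists>n. lower_central G (Suc n) = lower_central G n"
  proof (rule ccontr)
    assume "\<nexists>n. lower_central G (Suc n) = lower_central G n"
    then have strict: "lower_central G (Suc n) \<subset> lower_central G n" for n
      using lower_central_Suc_subset[of n] by blast
    have finl: "finite (lower_central G n)" for n
      using fin subgroup.subset[OF lower_central_subgroup] finite_subset by metis
    have "card (lower_central G n) + n \<le> card (carrier G)" for n
    proof (induction n)
      case (Suc n)
      then show ?case
        using psubset_card_mono[OF finl strict, of n] by linarith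
    qed simp
    from this[of "Suc (card (carrier G))"] show False by simp
  qed
  then obtain n where n: "lower_central G (Suc n) = lower_central G n" by blast
  define U where "U = lower_central G n"
  have "U = {\<one>}"
  proof (rule ccontr)
    assume "U \<noteq> {\<one>}"
    moreover have U: "U \<lhd> G"
      unfolding U_def by (rule lower_central_normal)
    ultimately have "{\<one>} \<subset> U"
      using subgroup.one_closed[OF normal_imp_subgroup] by blast
    then obtain Y where Y: "chief_factor G U Y"
      using chief_factor_exists[OF fin U one_is_normal] by metis
    then have sY: "subgroup Y G" and YX: "Y \<subset> U"
      by (auto simp: chief_factor_def normal_imp_subgroup)
    have "x \<otimes> g \<otimes> inv x \<otimes> inv g \<in> Y" if "x \<in> U" "g \<in> carrier G" for x g
    proof (rule commutator_swap[OF sY])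
      show "x \<in> carrier G"
        using that subgroup.subset[OF normal_imp_subgroup[OF U]] by blast
      show "g \<otimes> x \<otimes> inv g \<otimes> inv x \<in> Y"
        using central[OF Y] that by (auto simp: section_centralizer_def)
    qed (use that in auto)
    then have "commutator_subgroup G U (carrier G) \<subseteq> Y"
      unfolding commutator_subgroup_def by (intro generate_subgroup_incl[OF _ sY]) blast
    then have "lower_central G (Suc n) \<subseteq> Y"
      by (simp add: U_def)
    then show False
      using n YX by (auto simp: U_def)
  qed
  then show ?thesis
    unfolding nilpotent_group_def U_def using is_group by blast
qed

text \<open>Fitting's theorem: \<open>A\<close> and \<open>B\<close> both centralize every chief
  factor of their product, hence so does the product. The ambient \<open>H\<close> is there because
  \<open>radical_class\<close> asks for closure inside every subgroup.\<close>

lemma nilpotent_set_mult: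
  assumes fin: "finite (carrier G)" and sH: "subgroup H G"
    and A: "A \<lhd> G\<lparr>carrier := H\<rparr>" "nilpotent_group (G\<lparr>carrier := A\<rparr>)"
    and B: "B \<lhd> G\<lparr>carrier := H\<rparr>" "nilpotent_group (G\<lparr>carrier := B\<rparr>)"
  shows "nilpotent_group (G\<lparr>carrier := A <#> B\<rparr>)"
proof -
  interpret H: group "G\<lparr>carrier := H\<rparr>"
    using sH by (rule subgroup_imp_group)
  define P where "P = A <#> B"
  have "P \<lhd> G\<lparr>carrier := H\<rparr>"
    using H.normal_mult_normal[OF A(1) B(1)] by (simp add: P_def)
  then have sP: "subgroup P G" and PH: "P \<subseteq> H"
    using normal_restrict_iff[OF sH] by auto
  interpret P: group "G\<lparr>carrier := P\<rparr>"
    using sP by (rule subgroup_imp_group)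
  have sA: "subgroup A G" "A \<subseteq> H" and sB: "subgroup B G" "B \<subseteq> H"
    using A B normal_restrict_iff[OF sH] by auto
  have AP: "A \<subseteq> P" unfolding P_def
    by (rule subset_set_mult_left[OF sB(1) subgroup.subset[OF sA(1)]])
  have BP: "B \<subseteq> P" unfolding P_def
    by (rule subset_set_mult_right[OF sA(1) subgroup.subset[OF sB(1)]])
  have AnP: "A \<lhd> G\<lparr>carrier := P\<rparr>" and BnP: "B \<lhd> G\<lparr>carrier := P\<rparr>"
    using A(1) B(1) AP BP PH normal_restrict_iff[OF sH] normal_restrict_iff[OF sP] by auto
  have "nilpotent_group (G\<lparr>carrier := P\<rparr>)"
  proof (rule P.nilpotent_if_centralizes_chief_factors)
    show "finite (carrier (G\<lparr>carrier := P\<rparr>))"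
      using fin subgroup.subset[OF sP] finite_subset by auto
    fix U Y assume ch: "chief_factor (G\<lparr>carrier := P\<rparr>) U Y"
    let ?C = "section_centralizer (G\<lparr>carrier := P\<rparr>) U Y"
    have "U \<lhd> G\<lparr>carrier := P\<rparr>" "Y \<lhd> G\<lparr>carrier := P\<rparr>"
      using ch by (auto simp: chief_factor_def)
    then have sC: "subgroup ?C (G\<lparr>carrier := P\<rparr>)"
      using P.section_centralizer_normal normal_imp_subgroup by metis
    have "A \<subseteq> ?C" "B \<subseteq> ?C"
      using P.nilpotent_normal_centralizes_chief_factor[OF _ _ ch] AnP BnP A(2) B(2) by auto
    then have "A <#>\<^bsub>G\<lparr>carrier := P\<rparr>\<^esub> B \<subseteq> ?C"
      by (rule P.set_mult_least[OF sC])
    then show "?C = carrier (G\<lparr>carrier := P\<rparr>)"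
      using subgroup.subset[OF sC] by (auto simp: P_def)
  qed
  then show ?thesis by (simp add: P_def)
qed

end

subsection \<open>Radicals\<close>

text \<open>The part of the theory of Fitting classes that yields a largest normal subgroup with
  property \<open>C\<close> and puts all subnormal \<open>C\<close>-subgroups into it.
  \<open>C\<close> speaks about subsets of one fixed group, so that nilpotency, p-solubility and
  conditions on the order can all be substituted.\<close>

locale radical_class = group +
  fixes C :: "'a set \<Rightarrow> bool"
  assumes finite_carrier: "finite (carrier G)"
    and trivial_mem: "C {\<one>}"
    and set_mult_mem: "\<lbrakk>subgroup H G; A \<lhd> G\<lparr>carrier := H\<rparr>; B \<lhd> G\<lparr>carrier := H\<rparr>; C A; C B\<rbrakk>
      \<Longrightarrow> C (A <#> B)"
    and conj_mem: "\<lbrakk>subgroup A G; C A; g \<in> carrier G\<rbrakk> \<Longrightarrow> C ((\<lambda>x. g \<otimes> x \<otimes> inv g) ` A)"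
begin

definition radical :: "'a set \<Rightarrow> 'a set" where
  "radical H = generate G (\<Union>{N. N \<lhd> G\<lparr>carrier := H\<rparr> \<and> C N})"

lemma radical_upper:
  "N \<lhd> G\<lparr>carrier := H\<rparr> \<Longrightarrow> C N \<Longrightarrow> N \<subseteq> radical H"
  unfolding radical_def by (auto intro: generate.incl)

text \<open>A normal \<open>C\<close>-subgroup \<open>R\<close> of largest order absorbs every other
  one \<open>N\<close>, because \<open>N <#> R\<close> is again of this kind and contains
  \<open>R\<close>.\<close>

lemma radical_normal_mem:
  assumes sH: "subgroup H G"
  shows "radical H \<lhd> G\<lparr>carrier := H\<rparr>" "C (radical H)"
proof -
  interpret H: group "G\<lparr>carrier := H\<rparr>"
    using sH by (rule subgroup_imp_group)
  let ?P = "\<lambda>N. N \<lhd> G\<lparr>carrier := H\<rparr> \<and> C N"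
  have bound: "card N \<le> card (carrier G)" if "?P N" for N
    using that finite_carrier normal_restrict_iff[OF sH] subgroup.subset card_mono by metis
  have "?P {\<one>}"
    using H.one_is_normal trivial_mem by simp
  then obtain R where R: "R \<lhd> G\<lparr>carrier := H\<rparr>" "C R"
    and max: "\<And>W. ?P W \<Longrightarrow> card W \<le> card R"
    using maximal_card_exists[of ?P, OF _ bound] by blast
  have sR: "subgroup R G"
    using R(1) normal_restrict_iff[OF sH] by blast
  have "N \<subseteq> R" if N: "?P N" for N
  proof -
    have sN: "subgroup N G"
      using N normal_restrict_iff[OF sH] by blast
    have "?P (N <#> R)"
      using N R set_mult_mem[OF sH] H.normal_mult_normal by auto
    then have "card (N <#> R) \<le> card R" "finite (N <#> R)"
      using max finite_carrier finite_subset sH sN sR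
      by (blast, metis setmult_subset_G subgroup.subset finite_subset)
    moreover have "R \<subseteq> N <#> R"
      by (rule subset_set_mult_right[OF sN subgroup.subset[OF sR]])
    ultimately have "R = N <#> R"
      by (simp add: card_seteq)
    then show ?thesis
      using subset_set_mult_left[OF sR subgroup.subset[OF sN]] by simp
  qed
  then have "radical H = R"
    unfolding radical_def
    by (intro antisym generate_subgroup_incl[OF _ sR]) (use R in \<open>auto intro: generate.incl\<close>)
  then show "radical H \<lhd> G\<lparr>carrier := H\<rparr>" "C (radical H)"
    using R by auto
qed

text \<open>Conjugation by an element of \<open>L\<close> leaves \<open>H\<close> invariant and
  carries its radical to a normal \<open>C\<close>-subgroup of \<open>H\<close>, which the radical
  absorbs. This is what makes radicals increase along subnormal chains.\<close>

lemma radical_normal_in: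
  assumes sL: "subgroup L G" and H: "H \<lhd> G\<lparr>carrier := L\<rparr>"
  shows "radical H \<lhd> G\<lparr>carrier := L\<rparr>"
proof -
  have sH: "subgroup H G" and HL: "H \<subseteq> L" and inv_H: "\<And>l h. l \<in> L \<Longrightarrow> h \<in> H \<Longrightarrow> l \<otimes> h \<otimes> inv l \<in> H"
    using H normal_restrict_iff[OF sL] by auto
  have R: "radical H \<lhd> G\<lparr>carrier := H\<rparr>" "C (radical H)"
    using radical_normal_mem[OF sH] by auto
  then have sR: "subgroup (radical H) G" and RH: "radical H \<subseteq> H"
    using normal_restrict_iff[OF sH] by auto
  have "l \<otimes> r \<otimes> inv l \<in> radical H" if l: "l \<in> L" and r: "r \<in> radical H" for l r
  proof -
    have lG: "l \<in> carrier G"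
      using l subgroup.subset[OF sL] by blast
    let ?c = "\<lambda>x. l \<otimes> x \<otimes> inv l"
    interpret c: surjective_hom G G ?c
      using lG by (rule conj_surjective_hom)
    have "?c ` radical H \<lhd> G\<lparr>carrier := H\<rparr>"
      unfolding normal_restrict_iff[OF sH]
    proof (intro conjI ballI)
      show "subgroup (?c ` radical H) G"
        by (rule c.subgroup_img_is_subgroup[OF sR])
      show "?c ` radical H \<subseteq> H"
        using inv_H l RH by blast
      fix h k assume h: "h \<in> H" and "k \<in> ?c ` radical H"
      then obtain s where s: "s \<in> radical H" "k = ?c s" by blast
      have hG: "h \<in> carrier G" and sG: "s \<in> carrier G"
        using h s sH sR by (auto dest: subgroup.mem_carrier)
      \<comment> \<open>Conjugating by \<open>l\<close> and then by \<open>h\<close> equals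
        conjugating by this \<open>m\<close> and then by \<open>l\<close>.\<close>
      define m where "m = inv l \<otimes> h \<otimes> l"
      have "inv l \<otimes> h \<otimes> inv (inv l) \<in> H"
        using h l by (intro inv_H subgroup.m_inv_closed[OF sL])
      then have mH: "m \<in> H"
        using lG by (simp add: m_def)
      have "m \<otimes> s \<otimes> inv m \<in> radical H"
        using R(1) mH s(1) by (simp add: normal_restrict_iff[OF sH])
      moreover have "h \<otimes> k \<otimes> inv h = ?c (m \<otimes> s \<otimes> inv m)"
        using hG lG sG by (simp add: s(2) m_def word_simps)
      ultimately show "h \<otimes> k \<otimes> inv h \<in> ?c ` radical H" by blast
    qed
    then have "?c ` radical H \<subseteq> radical H"
      using conj_mem[OF sR R(2) lG] by (rule radical_upper)
    then show ?thesis using r by blast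
  qed
  then show ?thesis
    unfolding normal_restrict_iff[OF sL] using sR RH HL by blast
qed

lemma radical_subnormal:
  assumes "subnormal G H"
  shows "radical H \<subseteq> radical (carrier G)"
  using assms
proof induction
  case (step H K)
  have sH: "subgroup H G"
    using step.hyps(1) by (rule subnormal_imp_subgroup)
  then have sK: "subgroup K G"
    using step.hyps(2) normal_restrict_iff by blast
  have "radical K \<subseteq> radical H"
    using radical_normal_in[OF sH step.hyps(2)] radical_normal_mem[OF sK] radical_upper by blast
  then show ?case using step.IH by blast
qed simp

lemma subnormal_subset_radical:
  assumes "subnormal G H" "C H"
  shows "H \<subseteq> radical (carrier G)"
proof -
  have sH: "subgroup H G"
    using assms(1) by (rule subnormal_imp_subgroup)
  have "H \<lhd> G\<lparr>carrier := H\<rparr>"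
    using subgroup_self sH subgroup.m_closed[OF sH] subgroup.m_inv_closed[OF sH]
    by (simp add: normal_restrict_iff[OF sH])
  then show ?thesis
    using radical_upper[OF _ assms(2)] radical_subnormal[OF assms(1)] by blast
qed

end

locale finite_group = group +
  assumes finite_carrier: "finite (carrier G)"
begin

lemma nilpotent_radical_class: "radical_class G (\<lambda>N. nilpotent_group (G\<lparr>carrier := N\<rparr>))"
proof
  show "nilpotent_group (G\<lparr>carrier := (\<lambda>x. g \<otimes> x \<otimes> inv g) ` A\<rparr>)"
    if "subgroup A G" "nilpotent_group (G\<lparr>carrier := A\<rparr>)" "g \<in> carrier G" for A g
    using surjective_hom.nilpotent_image[OF surjective_hom.restrict_surjective
        [OF conj_surjective_hom[OF that(3)] that(1)] that(2)] .
qed (use finite_carrier trivial_nilpotent nilpotent_set_mult in auto)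

lemma fitting_subgroup_eq_radical:
  "fitting_subgroup G = radical_class.radical G (\<lambda>N. nilpotent_group (G\<lparr>carrier := N\<rparr>)) (carrier G)"
  by (simp add: fitting_subgroup_def radical_class.radical_def[OF nilpotent_radical_class])

lemma fitting_normal: "fitting_subgroup G \<lhd> G"
  using radical_class.radical_normal_mem(1)[OF nilpotent_radical_class subgroup_self]
  by (simp add: fitting_subgroup_eq_radical)

lemma fitting_nilpotent: "nilpotent_group (G\<lparr>carrier := fitting_subgroup G\<rparr>)"
  using radical_class.radical_normal_mem(2)[OF nilpotent_radical_class subgroup_self]
  by (simp add: fitting_subgroup_eq_radical)

lemma subnormal_nilpotent_subset_fitting:
  assumes "subnormal G N" "nilpotent_group (G\<lparr>carrier := N\<rparr>)"
  shows "N \<subseteq> fitting_subgroup G"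
  using radical_class.subnormal_subset_radical[OF nilpotent_radical_class assms]
  by (simp add: fitting_subgroup_eq_radical)

end

subsection \<open>Quasisimple groups\<close>

lemma (in group) perfect_subset:
  assumes "subgroup K G" "derived (G\<lparr>carrier := K\<rparr>) K = K" "subgroup S G"
    and "\<And>k l. k \<in> K \<Longrightarrow> l \<in> K \<Longrightarrow> k \<otimes> l \<otimes> inv k \<otimes> inv l \<in> S"
  shows "K \<subseteq> S"
proof -
  have "derived G K = K"
    using derived_consistent[OF _ assms(1), of K] assms(2) by simp
  moreover have "derived G K \<subseteq> S"
    unfolding derived_def by (rule generate_subgroup_incl[OF _ assms(3)]) (use assms(4) in blast)
  ultimately show ?thesis by simp
qed

lemma (in group) commutator_mem_derived:
  assumes "x \<in> K" "y \<in> K"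
  shows "x \<otimes> y \<otimes> inv x \<otimes> inv y \<in> derived G K"
  unfolding derived_def using assms by (intro generate.incl) blast

lemma (in group) center_eq_carrier_imp_derived:
  assumes "\<And>x y. x \<in> carrier G \<Longrightarrow> y \<in> carrier G \<Longrightarrow> x \<otimes> y = y \<otimes> x"
  shows "derived G (carrier G) = {\<one>}"
proof -
  have "derived G (carrier G) \<subseteq> {\<one>}"
    unfolding derived_def
    by (rule generate_subgroup_incl[OF _ triv_subgroup]) (use assms commutator_one_iff in auto)
  then show ?thesis
    unfolding derived_def using generate.one by blast
qed

text \<open>Removes the quotient by the centre from the definition. If \<open>N\<close> covers the
  group modulo the centre, all commutators lie in \<open>N\<close>, and perfectness makes
  \<open>N\<close> everything; otherwise simplicity puts \<open>N\<close> into the centre.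
  Conversely, normal subgroups of the quotient are pulled back, and a perfect nontrivial group is
  not its own centre.\<close>

lemma (in finite_group) quasisimple_iff:
  "quasisimple_group G \<longleftrightarrow> derived G (carrier G) = carrier G \<and> carrier G \<noteq> {\<one>} \<and>
     (\<forall>N. N \<lhd> G \<longrightarrow> N = carrier G \<or> N \<subseteq> group_center G)"
    (is "_ \<longleftrightarrow> ?perf \<and> ?nontriv \<and> ?normal")
proof -
  let ?Z = "group_center G"
  interpret Z: normal ?Z G by (rule group_center_normal)
  interpret q: surjective_hom G "G Mod ?Z" "\<lambda>x. ?Z #> x" by (rule Z.surjective_hom_Mod)
  have "?nontriv \<and> ?normal \<longleftrightarrow> simple_group (G Mod ?Z)" if perf: ?perf
  proof
    assume s: "simple_group (G Mod ?Z)"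
    then interpret s: simple_group "G Mod ?Z" .
    have ?nontriv
    proof
      assume "carrier G = {\<one>}"
      then have "order (G Mod ?Z) = 1"
        by (simp add: order_def carrier_FactGroup)
      then show False using s.order_gt_one by simp
    qed
    moreover have "N = carrier G \<or> N \<subseteq> ?Z" if N: "N \<lhd> G" for N
    proof -
      interpret N: normal N G by fact
      consider "(\<lambda>x. ?Z #> x) ` N = carrier (G Mod ?Z)" | "(\<lambda>x. ?Z #> x) ` N = {\<one>\<^bsub>G Mod ?Z\<^esub>}"
        using s.no_real_normal_subgroup[OF q.image_normal[OF N]] by blast
      then show ?thesis
      proof cases
        case 1
        have dec: "\<exists>n\<in>N. \<exists>z\<in>?Z. g = z \<otimes> n" if g: "g \<in> carrier G" for g
        proof -
          have "?Z #> g \<in> (\<lambda>x. ?Z #> x) ` N"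
            using 1 g q.hom_closed by blast
          then obtain n where "n \<in> N" "?Z #> g = ?Z #> n" by blast
          then have "g \<in> ?Z #> n"
            using rcos_self[OF g Z.subgroup_axioms] by simp
          then show ?thesis
            using \<open>n \<in> N\<close> by (auto simp: r_coset_def)
        qed
        have "x \<otimes> y \<otimes> inv x \<otimes> inv y \<in> N" if x: "x \<in> carrier G" and y: "y \<in> carrier G" for x y
        proof -
          obtain n z where n: "n \<in> N" "z \<in> ?Z" "x = z \<otimes> n" using dec[OF x] by blast
          obtain m w where m: "m \<in> N" "w \<in> ?Z" "y = w \<otimes> m" using dec[OF y] by blast
          have c: "n \<in> carrier G" "m \<in> carrier G" "z \<in> carrier G" "w \<in> carrier G"
            using n m by auto
          have "x \<otimes> y = z \<otimes> w \<otimes> (n \<otimes> m)" "y \<otimes> x = z \<otimes> w \<otimes> (m \<otimes> n)"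
          proof -
            have zc: "z \<otimes> g = g \<otimes> z" "w \<otimes> g = g \<otimes> w" if "g \<in> carrier G" for g
              using n(2) m(2) that unfolding group_center_def by blast+
            show "x \<otimes> y = z \<otimes> w \<otimes> (n \<otimes> m)"
              using c zc(2)[of n] by (simp add: n(3) m(3) m_assoc) (metis m_assoc)
            show "y \<otimes> x = z \<otimes> w \<otimes> (m \<otimes> n)"
              using c zc(1)[of "w \<otimes> m"] by (simp add: n(3) m(3) m_assoc) (metis m_assoc m_closed)
          qed
          \<comment> \<open>The central parts disappear up to conjugation by
            \<open>z \<otimes> w\<close>, which \<open>N\<close> absorbs.\<close>
          then have "x \<otimes> y \<otimes> inv x \<otimes> inv y = (z \<otimes> w) \<otimes> (n \<otimes> m \<otimes> inv (m \<otimes> n)) \<otimes> inv (z \<otimes> w)"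
            using c x y by (metis (no_types, lifting) inv_mult_group m_assoc m_closed inv_closed)
          moreover have "n \<otimes> m \<otimes> inv (m \<otimes> n) \<in> N"
            using n(1) m(1) by simp
          ultimately show ?thesis
            using c N.inv_op_closed2[of "z \<otimes> w"] by simp
        qed
        then have "derived G (carrier G) \<subseteq> N"
          unfolding derived_def by (intro generate_subgroup_incl[OF _ N.subgroup_axioms]) blast
        then show ?thesis using perf N.subset by auto
      next
        case 2
        have "N \<subseteq> ?Z"
        proof
          fix n assume "n \<in> N"
          then show "n \<in> ?Z"
            using 2 Z.coset_eq_one_iff[of n] by auto
        qed
        then show ?thesis ..
      qed
    qed
    ultimately show "?nontriv \<and> ?normal" by blast
  next
    assume nn: "?nontriv \<and> ?normal"
    have "?Z \<noteq> carrier G"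
    proof
      assume "?Z = carrier G"
      then have "derived G (carrier G) = {\<one>}"
        by (intro center_eq_carrier_imp_derived) (unfold group_center_def, blast)
      then show False using perf nn by simp
    qed
    then obtain g where g: "g \<in> carrier G" "g \<notin> ?Z"
      using Z.subset by blast
    show "simple_group (G Mod ?Z)"
    proof (intro simple_group.intro simple_group_axioms.intro)
      show "group (G Mod ?Z)" by (rule Z.factorgroup_is_group)
      have "{?Z, ?Z #> g} \<subseteq> carrier (G Mod ?Z)"
        using g q.hom_closed q.H.one_closed by simp
      moreover have "?Z \<noteq> ?Z #> g"
        using g Z.coset_eq_one_iff by metis
      ultimately have "2 \<le> card (carrier (G Mod ?Z))"
        using card_mono[OF Z.finite_Mod[OF finite_carrier]] by (metis card_2_iff)
      then show "1 < order (G Mod ?Z)" by (simp add: order_def)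
      fix L assume L: "L \<lhd> G Mod ?Z"
      let ?L = "{x \<in> carrier G. ?Z #> x \<in> L}"
      have sL: "L \<subseteq> carrier (G Mod ?Z)"
        using subgroup.subset[OF normal_imp_subgroup[OF L]] .
      have Leq: "L = (\<lambda>x. ?Z #> x) ` ?L"
        using sL by (auto simp: carrier_FactGroup)
      have "?L = carrier G \<or> ?L \<subseteq> ?Z"
        using q.vimage_normal[OF L] nn by blast
      then show "L = carrier (G Mod ?Z) \<or> L = {\<one>\<^bsub>G Mod ?Z\<^esub>}"
      proof
        assume "?L = carrier G"
        then show ?thesis using Leq q.surj by simp
      next
        assume "?L \<subseteq> ?Z"
        then have "L \<subseteq> {?Z}"
          using Leq Z.coset_eq_one_iff by blast
        moreover have "?Z \<in> L"
          using subgroup.one_closed[OF normal_imp_subgroup[OF L]] by simp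
        ultimately show ?thesis by auto
      qed
    qed
  qed
  then show ?thesis
    unfolding quasisimple_group_def using is_group by blast
qed

lemma finite_group_restrict:
  assumes "finite_group G" "subgroup H G"
  shows "finite_group (G\<lparr>carrier := H\<rparr>)"
proof -
  interpret finite_group G by fact
  show ?thesis
    unfolding finite_group_def finite_group_axioms_def
    using assms finite_carrier finite_subset[OF subgroup.subset] subgroup_imp_group by auto
qed

locale finite_surjective_hom = surjective_hom G H h + finite_group G for G (structure) and H (structure) and h
begin

lemma codomain_finite_group: "finite_group H"
  unfolding finite_group_def finite_group_axioms_def
  using H.is_group finite_carrier surj by (metis finite_imageI)

lemma restrict_finite_surjective:
  assumes "subgroup K G"
  shows "finite_surjective_hom (G\<lparr>carrier := K\<rparr>) (H\<lparr>carrier := h ` K\<rparr>) h"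
  using restrict_surjective[OF assms] finite_group_restrict[OF finite_group_axioms assms]
  by (rule finite_surjective_hom.intro)

text \<open>The preimage of a normal subgroup is everything or central, and surjectivity carries
  this alternative over. The trivial image is excluded by hypothesis, being perfect but not
  quasisimple.\<close>

lemma quasisimple_image:
  assumes "quasisimple_group G" "carrier H \<noteq> {\<one>\<^bsub>H\<^esub>}"
  shows "quasisimple_group H"
proof -
  interpret H: finite_group H by (rule codomain_finite_group)
  have G: "derived G (carrier G) = carrier G"
    and norm: "\<And>N. N \<lhd> G \<Longrightarrow> N = carrier G \<or> N \<subseteq> group_center G"
    using assms(1) quasisimple_iff by auto
  have "derived H (carrier H) = carrier H"
    using derived_img[of "carrier G"] G surj by simp
  moreover have "N = carrier H \<or> N \<subseteq> group_center H" if N: "N \<lhd> H" for N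
  proof -
    let ?N = "{x \<in> carrier G. h x \<in> N}"
    have NH: "N \<subseteq> carrier H"
      using subgroup.subset[OF normal_imp_subgroup[OF N]] .
    have "?N = carrier G \<or> ?N \<subseteq> group_center G"
      by (rule norm[OF vimage_normal[OF N]])
    then show ?thesis
    proof
      assume "?N = carrier G"
      then have "carrier H \<subseteq> N" unfolding surj[symmetric] by blast
      then show ?thesis using NH by blast
    next
      assume central: "?N \<subseteq> group_center G"
      have "y \<otimes>\<^bsub>H\<^esub> z = z \<otimes>\<^bsub>H\<^esub> y" if y: "y \<in> N" and z: "z \<in> carrier H" for y z
      proof -
        obtain a where a: "a \<in> carrier G" "h a = y"
          using surjE y NH by blast
        obtain b where b: "b \<in> carrier G" "h b = z"
          using surjE[OF z] .
        have "a \<otimes> b = b \<otimes> a"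
          using a y b central by (auto simp: group_center_def)
        then have "h (a \<otimes> b) = h (b \<otimes> a)" by simp
        then show ?thesis using a b by simp
      qed
      then show ?thesis
        using NH by (auto simp: group_center_def)
    qed
  qed
  ultimately show ?thesis
    using assms(2) H.quasisimple_iff by blast
qed

end

subsection \<open>Components and the layer\<close>

context finite_group
begin

lemma component_subgroup: "component G K \<Longrightarrow> subgroup K G"
  by (simp add: component_def subnormal_imp_subgroup)

lemma component_perfect: "component G K \<Longrightarrow> derived (G\<lparr>carrier := K\<rparr>) K = K"
  by (simp add: component_def quasisimple_group_def)

lemma component_normal_subgroup:
  assumes "component G K" "N \<lhd> G\<lparr>carrier := K\<rparr>" "N \<noteq> K" "n \<in> N" "k \<in> K"
  shows "n \<otimes> k = k \<otimes> n"
proof -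
  interpret K: finite_group "G\<lparr>carrier := K\<rparr>"
    by (rule finite_group_restrict[OF finite_group_axioms component_subgroup[OF assms(1)]])
  have "quasisimple_group (G\<lparr>carrier := K\<rparr>)"
    using assms(1) by (simp add: component_def)
  then have "N \<subseteq> group_center (G\<lparr>carrier := K\<rparr>)"
    using K.quasisimple_iff assms(2,3) by auto
  then show ?thesis
    using assms(4,5) by (auto simp: group_center_def)
qed

lemma component_nontrivial: "component G K \<Longrightarrow> K \<noteq> {\<one>}"
proof -
  assume K: "component G K"
  interpret K: finite_group "G\<lparr>carrier := K\<rparr>"
    by (rule finite_group_restrict[OF finite_group_axioms component_subgroup[OF K]])
  show ?thesis
    using K K.quasisimple_iff by (auto simp: component_def)
qed

text \<open>
  The three subgroups lemma in the form needed to climb a subnormal chain: \<open>[K, N \<inter> H]\<close> lies in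
  \<open>N \<inter> H'\<close>, which \<open>K\<close> centralizes, so perfectness of \<open>K\<close> yields \<open>[K, N \<inter> H] = 1\<close>.
\<close>
lemma perfect_centralizes_step:
  assumes sK: "subgroup K G" and perf: "derived (G\<lparr>carrier := K\<rparr>) K = K"
    and N: "N \<lhd> G" and sH: "subgroup H G" and H': "H' \<lhd> G\<lparr>carrier := H\<rparr>" and KH': "K \<subseteq> H'"
    and cent: "\<And>k n. k \<in> K \<Longrightarrow> n \<in> N \<inter> H' \<Longrightarrow> k \<otimes> n = n \<otimes> k"
    and k: "k \<in> K" and a: "a \<in> N \<inter> H"
  shows "k \<otimes> a = a \<otimes> k"
proof -
  interpret N: normal N G by fact
  have sH': "subgroup H' G" and H'H: "H' \<subseteq> H"
    and H'inv: "\<And>h x. h \<in> H \<Longrightarrow> x \<in> H' \<Longrightarrow> h \<otimes> x \<otimes> inv h \<in> H'"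
    using H' normal_restrict_iff[OF sH] by auto
  have aG: "a \<in> carrier G" using a by auto
  have KG: "K \<subseteq> carrier G" using subgroup.subset[OF sK] .
  \<comment> \<open>\<open>\<phi> k\<close> is the commutator [k, a]. Its values lie in
    \<open>N \<inter> H'\<close>, which \<open>K\<close> centralizes; this makes
    \<open>\<phi>\<close> an antihomomorphism (\<open>mult\<close>) with commuting values
    (\<open>comm\<close>), so it takes the same value at kl and lk. Hence commutators of elements of
    \<open>K\<close> commute with \<open>a\<close>.\<close>
  define \<phi> where "\<phi> k = k \<otimes> a \<otimes> inv k \<otimes> inv a" for k
  have \<phi>: "\<phi> k \<in> N \<inter> H'" if k: "k \<in> K" for k
  proof -
    have "\<phi> k \<in> N"
      unfolding \<phi>_def using a k KG
      by (intro commutator_mem_normal N.subgroup_axioms N.inv_op_closed2) auto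
    moreover have "\<phi> k \<in> H'"
      unfolding \<phi>_def using a k KH' aG by (intro commutator_mem_normal sH' H'inv) auto
    ultimately show ?thesis by blast
  qed
  have comm: "\<phi> k \<otimes> \<phi> l = \<phi> l \<otimes> \<phi> k" if k: "k \<in> K" and l: "l \<in> K" for k l
  proof -
    have kG: "k \<in> carrier G" using k KG by blast
    define b where "b = \<phi> l"
    have b: "b \<in> N \<inter> H'" using \<phi>[OF l] by (simp add: b_def)
    then have bG: "b \<in> carrier G" by auto
    \<comment> \<open>Like \<open>b\<close>, this conjugate lies in \<open>N \<inter> H'\<close> and
      so commutes with \<open>K\<close>. Moving \<open>b\<close> through [k, a] turns it into
      \<open>c\<close> at the first \<open>a\<close> and back into \<open>b\<close> at the
      second.\<close>
    define c where "c = inv a \<otimes> b \<otimes> a"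
    have "inv a \<otimes> b \<otimes> inv (inv a) \<in> H'"
      using a b by (intro H'inv subgroup.m_inv_closed[OF sH]) auto
    moreover have "c \<in> N"
      unfolding c_def using b aG by (intro N.inv_op_closed1) auto
    ultimately have c: "c \<in> N \<inter> H'" using aG by (simp add: c_def)
    then have cG: "c \<in> carrier G" by auto
    have kb: "k \<otimes> b = b \<otimes> k" by (rule cent[OF k b])
    have kc: "inv k \<otimes> c = c \<otimes> inv k"
      using cent[OF _ c] k subgroup.m_inv_closed[OF sK] by blast
    have bc: "inv a \<otimes> b = c \<otimes> inv a"
      using aG bG by (simp add: c_def m_assoc)
    have ca: "a \<otimes> c = b \<otimes> a"
      using aG bG by (simp add: c_def m_assoc)
    have "\<phi> k \<otimes> b = k \<otimes> a \<otimes> inv k \<otimes> (inv a \<otimes> b)"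
      using kG aG bG by (simp add: \<phi>_def m_assoc)
    also have "\<dots> = k \<otimes> a \<otimes> (inv k \<otimes> c) \<otimes> inv a"
      unfolding bc using kG aG cG by (simp add: m_assoc)
    also have "\<dots> = k \<otimes> (a \<otimes> c) \<otimes> inv k \<otimes> inv a"
      unfolding kc using kG aG cG by (simp add: m_assoc)
    also have "\<dots> = (k \<otimes> b) \<otimes> a \<otimes> inv k \<otimes> inv a"
      unfolding ca using kG aG bG by (simp add: m_assoc)
    also have "\<dots> = b \<otimes> \<phi> k"
      unfolding kb using kG aG bG by (simp add: \<phi>_def m_assoc)
    finally show ?thesis by (simp add: b_def)
  qed
  have mult: "\<phi> (k \<otimes> l) = \<phi> l \<otimes> \<phi> k" if k: "k \<in> K" and l: "l \<in> K" for k l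
  proof -
    have kG: "k \<in> carrier G" and lG: "l \<in> carrier G" using k l KG by auto
    have "\<phi> (k \<otimes> l) = (k \<otimes> \<phi> l) \<otimes> inv k \<otimes> \<phi> k"
      using kG lG aG by (simp add: \<phi>_def word_simps)
    also have "\<dots> = (\<phi> l \<otimes> k) \<otimes> inv k \<otimes> \<phi> k"
      using cent[OF k \<phi>[OF l]] by simp
    also have "\<dots> = \<phi> l \<otimes> \<phi> k"
      using kG lG aG by (simp add: \<phi>_def m_assoc)
    finally show ?thesis .
  qed
  let ?S = "section_centralizer G {a} {\<one>}"
  have "k \<otimes> l \<otimes> inv k \<otimes> inv l \<in> ?S" if "k \<in> K" "l \<in> K" for k l
  proof -
    define k' l' where "k' = inv k" and "l' = inv l"
    have k': "k' \<in> K" "l' \<in> K"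
      using that subgroup.m_inv_closed[OF sK] by (auto simp: k'_def l'_def)
    have G: "k \<in> carrier G" "l \<in> carrier G" using that KG by auto
    then have k'G: "k' \<in> carrier G" "l' \<in> carrier G" by (auto simp: k'_def l'_def)
    have "\<phi> (l' \<otimes> k') = \<phi> (k' \<otimes> l')"
      using mult comm k' by metis
    then have eq: "l' \<otimes> k' \<otimes> a \<otimes> inv (l' \<otimes> k') = k' \<otimes> l' \<otimes> a \<otimes> inv (k' \<otimes> l')"
      using k'G aG by (simp add: \<phi>_def)
    have "k \<otimes> l \<otimes> inv k \<otimes> inv l \<otimes> a = k \<otimes> l \<otimes> (k' \<otimes> l' \<otimes> a \<otimes> inv (k' \<otimes> l')) \<otimes> k' \<otimes> l'"
      using G aG by (simp add: k'_def l'_def word_simps)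
    also have "\<dots> = a \<otimes> (k \<otimes> l \<otimes> inv k \<otimes> inv l)"
      unfolding eq[symmetric] using G aG by (simp add: k'_def l'_def word_simps)
    finally show ?thesis
      using G aG by (simp add: section_centralizer_iff_commute)
  qed
  then have "K \<subseteq> ?S"
    using aG by (intro perfect_subset[OF sK perf] section_centralizer_subgroup one_is_normal) auto
  then show ?thesis
    using k aG by (auto simp: section_centralizer_iff_commute)
qed

text \<open>If \<open>K\<close> is not inside \<open>N\<close>, then \<open>N \<inter> K\<close> is
  a proper normal subgroup of \<open>K\<close>, hence central in it. That \<open>K\<close>
  centralizes \<open>N \<inter> H\<close> is then lifted from H = K up to H = G along the subnormal
  chain.\<close>

lemma component_normal_cases:
  assumes K: "component G K" and N: "N \<lhd> G"
  shows "K \<subseteq> N \<or> (\<forall>k\<in>K. \<forall>n\<in>N. k \<otimes> n = n \<otimes> k)"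
proof (cases "K \<subseteq> N")
  case False
  have sK: "subgroup K G" and perf: "derived (G\<lparr>carrier := K\<rparr>) K = K"
    using K component_subgroup component_perfect by auto
  have NK: "N \<inter> K \<lhd> G\<lparr>carrier := K\<rparr>"
    using normal_Int_subgroup[OF sK N] .
  have base: "k \<otimes> n = n \<otimes> k" if "k \<in> K" "n \<in> N \<inter> K" for k n
    using component_normal_subgroup[OF K NK _ that(2,1), symmetric] False by blast
  \<comment> \<open>The induction descends from the whole group, so the statement to be lifted
    occurs as a premise on \<open>H\<close>; each step hands it from \<open>H'\<close> to the larger
    \<open>H\<close>.\<close>
  have "k \<otimes> n = n \<otimes> k" if "subnormal G H" "K \<subseteq> H"
    "\<And>k n. k \<in> K \<Longrightarrow> n \<in> N \<inter> H \<Longrightarrow> k \<otimes> n = n \<otimes> k" "k \<in> K" "n \<in> N" for H k n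
    using that
  proof (induction arbitrary: k n)
    case whole
    then show ?case
      using subgroup.subset[OF normal_imp_subgroup[OF N]] by blast
  next
    case (step H H')
    have sH: "subgroup H G"
      using step.hyps(1) by (rule subnormal_imp_subgroup)
    have "K \<subseteq> H"
      using step.prems(1) step.hyps(2) normal_restrict_iff[OF sH] by blast
    moreover have "k \<otimes> n = n \<otimes> k" if "k \<in> K" "n \<in> N \<inter> H" for k n
      using perfect_centralizes_step[OF sK perf N sH step.hyps(2) step.prems(1) step.prems(2) that]
      by blast
    ultimately show ?case
      using step.IH step.prems(3,4) by blast
  qed
  then have "\<forall>k\<in>K. \<forall>n\<in>N. k \<otimes> n = n \<otimes> k"
    using K base unfolding component_def by blast
  then show ?thesis ..
qed simp

lemma component_restrict:
  assumes "component G K" "subgroup N G" "K \<subseteq> N"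
  shows "component (G\<lparr>carrier := N\<rparr>) K"
  using assms subnormal_subset by (auto simp: component_def)

lemma component_of_subnormal:
  assumes "subnormal G H" "component (G\<lparr>carrier := H\<rparr>) K"
  shows "component G K"
  using assms subnormal_trans by (auto simp: component_def)

text \<open>The chain of \<open>U\<close> is followed downwards. While \<open>K\<close> lies in the
  current term it is a component of that term, and the normal case applies inside it; once
  \<open>K\<close> centralizes a term, it centralizes everything below.\<close>

lemma component_subnormal_cases:
  assumes K: "component G K" and U: "subnormal G U"
  shows "K \<subseteq> U \<or> (\<forall>k\<in>K. \<forall>u\<in>U. k \<otimes> u = u \<otimes> k)"
  using U
proof induction
  case whole
  then show ?case
    using subgroup.subset[OF component_subgroup[OF K]] by blast
next
  case (step H U)
  have sH: "subgroup H G"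
    using step.hyps(1) by (rule subnormal_imp_subgroup)
  interpret H: finite_group "G\<lparr>carrier := H\<rparr>"
    by (rule finite_group_restrict[OF finite_group_axioms sH])
  have "U \<subseteq> H"
    using step.hyps(2) normal_restrict_iff[OF sH] by blast
  then show ?case
    using step.IH H.component_normal_cases[OF component_restrict[OF K sH] step.hyps(2)] by auto
qed

end

context finite_surjective_hom
begin

lemma component_image:
  assumes "component G K"
  shows "component H (h ` K) \<or> h ` K = {\<one>\<^bsub>H\<^esub>}"
proof -
  interpret K: finite_surjective_hom "G\<lparr>carrier := K\<rparr>" "H\<lparr>carrier := h ` K\<rparr>" h
    by (rule restrict_finite_surjective[OF component_subgroup[OF assms]])
  show ?thesis
    using assms image_subnormal K.quasisimple_image by (auto simp: component_def)
qed

end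

context finite_group
begin

lemma components_in_carrier: "\<Union>{K. component G K} \<subseteq> carrier G"
  using subgroup.subset[OF component_subgroup] by blast

lemma component_subset_layer: "component G K \<Longrightarrow> K \<subseteq> layer G"
  unfolding layer_def by (auto intro: generate.incl)

lemma layer_subset:
  assumes "subgroup S G" "\<And>K. component G K \<Longrightarrow> K \<subseteq> S"
  shows "layer G \<subseteq> S"
  unfolding layer_def by (rule generate_subgroup_incl[OF _ assms(1)]) (use assms(2) in blast)

lemma layer_normal: "layer G \<lhd> G"
  unfolding layer_def
proof (rule normal_generateI[OF components_in_carrier])
  fix x g assume "x \<in> \<Union>{K. component G K}" and g: "g \<in> carrier G"
  then obtain K where K: "component G K" "x \<in> K" by blast
  interpret c: finite_surjective_hom G G "\<lambda>x. g \<otimes> x \<otimes> inv g"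
    using conj_surjective_hom[OF g] finite_group_axioms by (rule finite_surjective_hom.intro)
  \<comment> \<open>The image lemma also allows a trivial image. In that branch the conjugate of
    \<open>x\<close> is \<open>\<one>\<close>, which lies in \<open>K\<close> and so in the
    union.\<close>
  have "\<one> \<in> K"
    using subgroup.one_closed[OF component_subgroup[OF K(1)]] .
  moreover have "g \<otimes> x \<otimes> inv g \<in> (\<lambda>x. g \<otimes> x \<otimes> inv g) ` K"
    using K(2) by blast
  ultimately show "g \<otimes> x \<otimes> inv g \<in> \<Union>{K. component G K}"
    using c.component_image[OF K(1)] K(1) by (metis CollectI UnionI singletonD)
qed

subsection \<open>The generalized Fitting subgroup\<close>

abbreviation Fs where "Fs \<equiv> generalized_fitting_subgroup G"

lemma Fs_normal: "Fs \<lhd> G"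
  unfolding generalized_fitting_subgroup_def
  by (rule normal_mult_normal[OF fitting_normal layer_normal])

lemma Fs_subgroup: "subgroup Fs G"
  by (rule normal_imp_subgroup[OF Fs_normal])

lemma fitting_subset_Fs: "fitting_subgroup G \<subseteq> Fs"
  unfolding generalized_fitting_subgroup_def
  by (rule subset_set_mult_left[OF normal_imp_subgroup[OF layer_normal]
        subgroup.subset[OF normal_imp_subgroup[OF fitting_normal]]])

lemma layer_subset_Fs: "layer G \<subseteq> Fs"
  unfolding generalized_fitting_subgroup_def
  by (rule subset_set_mult_right[OF normal_imp_subgroup[OF fitting_normal]
        subgroup.subset[OF normal_imp_subgroup[OF layer_normal]]])

lemma component_subset_Fs: "component G K \<Longrightarrow> K \<subseteq> Fs"
  using component_subset_layer layer_subset_Fs by blast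

lemma subnormal_nilpotent_subset_Fs:
  "subnormal G N \<Longrightarrow> nilpotent_group (G\<lparr>carrier := N\<rparr>) \<Longrightarrow> N \<subseteq> Fs"
  using subnormal_nilpotent_subset_fitting fitting_subset_Fs by blast

lemma Fs_subset:
  assumes "subgroup S G" "fitting_subgroup G \<subseteq> S" "\<And>K. component G K \<Longrightarrow> K \<subseteq> S"
  shows "Fs \<subseteq> S"
  unfolding generalized_fitting_subgroup_def
  by (rule set_mult_least[OF assms(1,2) layer_subset[OF assms(1,3)]])

text \<open>
  A subnormal subgroup of \<open>C = C\<^sub>G(F\<^sup>*(G))\<close> that is minimal subject to not lying in \<open>F\<^sup>*(G)\<close> is
  either perfect, and then a component, or nilpotent of class at most two.
\<close>
theorem centralizer_Fs_subset: "section_centralizer G Fs {\<one>} \<subseteq> Fs"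
proof (rule ccontr)
  let ?C = "section_centralizer G Fs {\<one>}"
  let ?P = "\<lambda>K. subnormal G K \<and> K \<subseteq> ?C \<and> \<not> K \<subseteq> Fs"
  assume "\<not> ?C \<subseteq> Fs"
  then have "?P ?C"
    using normal_imp_subnormal[OF section_centralizer_normal[OF Fs_normal one_is_normal]] by blast
  then obtain K where "?P K" and min: "\<And>L. ?P L \<Longrightarrow> card K \<le> card L"
    using ex_has_least_nat[of ?P ?C card] by blast
  then have sn: "subnormal G K" and KC: "K \<subseteq> ?C" and nle: "\<not> K \<subseteq> Fs" by auto
  have sK: "subgroup K G" using sn by (rule subnormal_imp_subgroup)
  interpret K: finite_group "G\<lparr>carrier := K\<rparr>"
    by (rule finite_group_restrict[OF finite_group_axioms sK])
  have normal_below: "N \<subseteq> group_center (G\<lparr>carrier := K\<rparr>)"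
    if N: "N \<lhd> G\<lparr>carrier := K\<rparr>" "N \<noteq> K" for N
  proof -
    have NK: "N \<subset> K"
      using N normal_restrict_iff[OF sK] by blast
    then have "card N < card K"
      using K.finite_carrier psubset_card_mono by auto
    moreover have "subnormal G N"
      using sn N(1) by (rule subnormal.step)
    ultimately have NF: "N \<subseteq> Fs"
      using min[of N] NK KC by auto
    have "n \<otimes> k = k \<otimes> n" if "n \<in> N" "k \<in> K" for n k
      using that NF KC subgroup.subset[OF Fs_subgroup]
      by (auto simp: section_centralizer_iff_commute subset_iff)
    then show ?thesis
      using NK by (auto simp: group_center_def)
  qed
  let ?D = "derived (G\<lparr>carrier := K\<rparr>) K"
  have D: "?D \<lhd> G\<lparr>carrier := K\<rparr>"
    using K.derived_is_normal[OF K.carrier_normal] by simp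
  have "K \<subseteq> Fs"
  proof (cases "?D = K")
    case True
    have "K \<noteq> {\<one>}"
      using nle subgroup.one_closed[OF Fs_subgroup] by blast
    then have "quasisimple_group (G\<lparr>carrier := K\<rparr>)"
      using True normal_below K.quasisimple_iff by auto
    then show ?thesis
      using sn component_subset_Fs by (simp add: component_def)
  next
    case False
    have "nilpotent_group (G\<lparr>carrier := K\<rparr>)"
      using K.commutator_mem_derived[of _ K] normal_below[OF D False]
      by (intro K.nilpotent_of_central_commutators) auto
    then show ?thesis
      by (rule subnormal_nilpotent_subset_Fs[OF sn])
  qed
  then show False using nle by blast
qed

lemma Fs_nontrivial:
  assumes "Fs = {\<one>}"
  shows "carrier G = {\<one>}"
proof -
  have "carrier G \<subseteq> section_centralizer G Fs {\<one>}"
    by (auto simp: assms section_centralizer_def)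
  then show ?thesis
    using centralizer_Fs_subset assms by auto
qed

text \<open>The Fitting subgroup of \<open>M\<close> meets \<open>N\<close> in a nilpotent normal
  subgroup of \<open>N\<close>; it is subnormal in \<open>G\<close>, hence inside \<open>Fs\<close>,
  and contains the commutators with \<open>N\<close>. A component of \<open>M\<close> either lies in
  \<open>N\<close>, and is then a component of \<open>G\<close>, or centralizes
  \<open>N\<close>.\<close>

lemma Fs_commutator_subset:
  assumes sM: "subgroup M G" and N: "N \<lhd> G" and NM: "N \<subseteq> M"
  shows "generalized_fitting_subgroup (G\<lparr>carrier := M\<rparr>) \<subseteq> section_centralizer G N Fs"
proof -
  interpret M: finite_group "G\<lparr>carrier := M\<rparr>"
    by (rule finite_group_restrict[OF finite_group_axioms sM])
  interpret N: normal N G by fact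
  have NnM: "N \<lhd> G\<lparr>carrier := M\<rparr>"
    by (rule normal_restrict[OF sM N NM])
  have MG: "M \<subseteq> carrier G" using subgroup.subset[OF sM] .
  let ?C = "section_centralizer G N Fs"
  have sC: "subgroup ?C G"
    by (rule section_centralizer_subgroup[OF N.subset Fs_normal])
  have "M.Fs \<subseteq> ?C \<inter> M"
  proof (rule M.Fs_subset)
    show "subgroup (?C \<inter> M) (G\<lparr>carrier := M\<rparr>)"
      by (simp add: subgroup_restrict_iff[OF sM] sC sM subgroups_Inter_pair)
    let ?F = "fitting_subgroup (G\<lparr>carrier := M\<rparr>)"
    have F: "?F \<lhd> G\<lparr>carrier := M\<rparr>" by (rule M.fitting_normal)
    then have sF: "subgroup ?F G" and FM: "?F \<subseteq> M"
      and Finv: "\<And>m x. m \<in> M \<Longrightarrow> x \<in> ?F \<Longrightarrow> m \<otimes> x \<otimes> inv m \<in> ?F"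
      using normal_restrict_iff[OF sM] by auto
    have sFN: "subgroup (?F \<inter> N) G"
      using sF N.subgroup_axioms subgroups_Inter_pair by blast
    have "?F \<inter> N \<lhd> G\<lparr>carrier := N\<rparr>"
      unfolding normal_restrict_iff[OF N.subgroup_axioms] using sFN Finv NM by auto
    then have sn: "subnormal G (?F \<inter> N)"
      by (rule subnormal.step[OF normal_imp_subnormal[OF N]])
    have "subgroup (?F \<inter> N) (G\<lparr>carrier := ?F\<rparr>)"
      using sFN by (simp add: subgroup_restrict_iff[OF sF])
    then have "nilpotent_group (G\<lparr>carrier := ?F \<inter> N\<rparr>)"
      using group.nilpotent_subgroup[OF subgroup_imp_group[OF sF]] M.fitting_nilpotent by fastforce
    then have FNF: "?F \<inter> N \<subseteq> Fs"
      by (rule subnormal_nilpotent_subset_Fs[OF sn])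
    show "?F \<subseteq> ?C \<inter> M"
    proof
      fix x assume x: "x \<in> ?F"
      have "x \<otimes> n \<otimes> inv x \<otimes> inv n \<in> Fs" if n: "n \<in> N" for n
      proof -
        have xG: "x \<in> carrier G" and nM: "n \<in> M"
          using x FM MG n NM by auto
        have "x \<otimes> n \<otimes> inv x \<otimes> inv n \<in> N"
          using xG n by (intro commutator_mem_normal N.subgroup_axioms N.inv_op_closed2)
        moreover have "x \<otimes> n \<otimes> inv x \<otimes> inv n \<in> ?F"
          using x nM n by (intro commutator_mem_normal sF Finv) auto
        ultimately show ?thesis using FNF by blast
      qed
      then show "x \<in> ?C \<inter> M"
        using x FM MG by (auto simp: section_centralizer_def)
    qed
    fix K assume K: "component (G\<lparr>carrier := M\<rparr>) K"
    then have sK: "subgroup K G" and KM: "K \<subseteq> M"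
      using M.component_subgroup subgroup_restrict_iff[OF sM] by auto
    have "K \<subseteq> N \<or> (\<forall>k\<in>K. \<forall>n\<in>N. k \<otimes> n = n \<otimes> k)"
      using M.component_normal_cases[OF K NnM] by simp
    then show "K \<subseteq> ?C \<inter> M"
    proof
      assume KN: "K \<subseteq> N"
      have "component (G\<lparr>carrier := N\<rparr>) K"
        using M.component_restrict[OF K _ KN] NnM normal_imp_subgroup by fastforce
      then have "component G K"
        by (rule component_of_subnormal[OF normal_imp_subnormal[OF N]])
      then have KF: "K \<subseteq> Fs" by (rule component_subset_Fs)
      have "k \<otimes> n \<otimes> inv k \<otimes> inv n \<in> Fs" if "k \<in> K" "n \<in> N" for k n
        using that KF by (intro commutator_mem_normal Fs_subgroup normal.inv_op_closed2[OF Fs_normal]) auto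
      then show ?thesis
        using KM MG by (auto simp: section_centralizer_def)
    next
      assume "\<forall>k\<in>K. \<forall>n\<in>N. k \<otimes> n = n \<otimes> k"
      then have "k \<otimes> n \<otimes> inv k \<otimes> inv n = \<one>" if "k \<in> K" "n \<in> N" for k n
        using that KM MG commutator_one_iff[of k n] by auto
      then show ?thesis
        using KM MG subgroup.one_closed[OF Fs_subgroup] by (auto simp: section_centralizer_def)
    qed
  qed
  then show ?thesis by blast
qed

text \<open>Whatever is subnormal in \<open>M\<close> and contained in \<open>N\<close> is subnormal
  in \<open>N\<close> and therefore in \<open>G\<close>. This applies to the Fitting subgroup and to
  the components of \<open>M\<close>.\<close>

lemma Fs_restrict_subset:
  assumes sM: "subgroup M G" and N: "N \<lhd> G" and NM: "N \<subseteq> M"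
    and FN: "generalized_fitting_subgroup (G\<lparr>carrier := M\<rparr>) \<subseteq> N"
  shows "generalized_fitting_subgroup (G\<lparr>carrier := M\<rparr>) \<subseteq> Fs"
proof -
  interpret M: finite_group "G\<lparr>carrier := M\<rparr>"
    by (rule finite_group_restrict[OF finite_group_axioms sM])
  have sN: "subgroup N G" using N by (rule normal_imp_subgroup)
  have NM': "subgroup N (G\<lparr>carrier := M\<rparr>)"
    using sN NM by (simp add: subgroup_restrict_iff[OF sM])
  have snN: "subnormal G N" using N by (rule normal_imp_subnormal)
  have sn: "subnormal G K" if "subnormal (G\<lparr>carrier := M\<rparr>) K" "K \<subseteq> N" for K
    using subnormal_trans[OF snN] M.subnormal_subset[OF that(1) NM' that(2)] by simp
  have "M.Fs \<subseteq> Fs \<inter> M"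
  proof (rule M.Fs_subset)
    show "subgroup (Fs \<inter> M) (G\<lparr>carrier := M\<rparr>)"
      by (simp add: subgroup_restrict_iff[OF sM] Fs_subgroup sM subgroups_Inter_pair)
    let ?F = "fitting_subgroup (G\<lparr>carrier := M\<rparr>)"
    have "?F \<subseteq> Fs"
      using M.fitting_nilpotent M.fitting_subset_Fs FN
      by (intro subnormal_nilpotent_subset_Fs sn M.normal_imp_subnormal M.fitting_normal) auto
    moreover have "?F \<subseteq> M"
      using subgroup.subset[OF normal_imp_subgroup[OF M.fitting_normal]] by simp
    ultimately show "?F \<subseteq> Fs \<inter> M" by blast
    fix K assume K: "component (G\<lparr>carrier := M\<rparr>) K"
    then have "K \<subseteq> N" using M.component_subset_Fs FN by blast
    then have "component G K"
      using sn K by (auto simp: component_def)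
    moreover have "K \<subseteq> M"
      using subgroup.subset[OF M.component_subgroup[OF K]] by simp
    ultimately show "K \<subseteq> Fs \<inter> M" using component_subset_Fs by blast
  qed
  then show ?thesis by blast
qed

lemma Fs_subset_restrict:
  assumes sM: "subgroup M G" and FM: "Fs \<subseteq> M"
  shows "Fs \<subseteq> generalized_fitting_subgroup (G\<lparr>carrier := M\<rparr>)"
proof -
  interpret M: finite_group "G\<lparr>carrier := M\<rparr>"
    by (rule finite_group_restrict[OF finite_group_axioms sM])
  show ?thesis
  proof (rule Fs_subset)
    show "subgroup M.Fs G"
      using M.Fs_subgroup by (simp add: subgroup_restrict_iff[OF sM])
    have "fitting_subgroup G \<lhd> G\<lparr>carrier := M\<rparr>"
      using fitting_subset_Fs FM by (intro normal_restrict[OF sM fitting_normal]) auto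
    then show "fitting_subgroup G \<subseteq> M.Fs"
      using fitting_nilpotent by (intro M.subnormal_nilpotent_subset_Fs M.normal_imp_subnormal) auto
    fix K assume K: "component G K"
    then have "component (G\<lparr>carrier := M\<rparr>) K"
      using component_subset_Fs FM by (intro component_restrict[OF _ sM]) auto
    then show "K \<subseteq> M.Fs" by (rule M.component_subset_Fs)
  qed
qed

end

context finite_surjective_hom
begin

lemma Fs_image: "h ` Fs \<subseteq> generalized_fitting_subgroup H"
proof -
  interpret H: finite_group H by (rule codomain_finite_group)
  let ?S = "{x \<in> carrier G. h x \<in> H.Fs}"
  have "Fs \<subseteq> ?S"
  proof (rule Fs_subset)
    show "subgroup ?S G" by (rule vimage_subgroup[OF H.Fs_subgroup])
    let ?F = "fitting_subgroup G"
    have sF: "subgroup ?F G" by (rule normal_imp_subgroup[OF fitting_normal])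
    have "nilpotent_group (H\<lparr>carrier := h ` ?F\<rparr>)"
      by (rule surjective_hom.nilpotent_image[OF restrict_surjective[OF sF] fitting_nilpotent])
    then have "h ` ?F \<subseteq> H.Fs"
      by (intro H.subnormal_nilpotent_subset_Fs H.normal_imp_subnormal image_normal fitting_normal)
    then show "?F \<subseteq> ?S"
      using subgroup.subset[OF sF] by blast
    fix K assume K: "component G K"
    then have "h ` K \<subseteq> H.Fs"
      using component_image[OF K] H.component_subset_Fs[of "h ` K"] subgroup.one_closed[OF H.Fs_subgroup]
      by (elim disjE) simp_all
    then show "K \<subseteq> ?S"
      using subgroup.subset[OF component_subgroup[OF K]] by blast
  qed
  then show ?thesis by blast
qed

end

subsection \<open>Indices of normal subgroups\<close>

lemma index_eqI: "i * k = n \<Longrightarrow> 0 < k \<Longrightarrow> n div k = i" for i k n :: nat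
  by auto

context finite_surjective_hom
begin

lemma card_image_kernel: "card (carrier H) * card (kernel G H h) = card (carrier G)"
proof -
  have "G Mod kernel G H h \<cong> H"
    using FactGroup_iso_set[OF surj] by (rule is_isoI)
  then have "card (carrier H) = card (rcosets (kernel G H h))"
    using iso_same_card by (fastforce simp: FactGroup_def)
  then show ?thesis
    using G.lagrange[OF subgroup_kernel] by (simp add: order_def)
qed

lemma card_image_subgroup:
  assumes "subgroup L G"
  shows "card (h ` L) * card (L \<inter> kernel G H h) = card L"
proof -
  interpret L: finite_surjective_hom "G\<lparr>carrier := L\<rparr>" "H\<lparr>carrier := h ` L\<rparr>" h
    by (rule restrict_finite_surjective[OF assms])
  have "kernel (G\<lparr>carrier := L\<rparr>) (H\<lparr>carrier := h ` L\<rparr>) h = L \<inter> kernel G H h"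
    using subgroup.subset[OF assms] by (auto simp: kernel_def)
  then show ?thesis
    using L.card_image_kernel by simp
qed

end

lemma (in normal) kernel_coset_map: "kernel G (G Mod H) (\<lambda>x. H #> x) = H"
  using coset_eq_one_iff subset by (auto simp: kernel_def)

context finite_group
begin

lemma finite_subgroup: "subgroup H G \<Longrightarrow> finite H"
  using finite_carrier finite_subset subgroup.subset by metis

lemma card_subgroup_pos: "subgroup H G \<Longrightarrow> 0 < card H"
  using finite_subgroup card_gt_0_iff subgroup_nonempty by metis

lemma coset_map_hom:
  assumes "K \<lhd> G"
  shows "finite_surjective_hom G (G Mod K) (\<lambda>x. K #> x)"
  using normal.surjective_hom_Mod[OF assms] finite_group_axioms by (rule finite_surjective_hom.intro)

text \<open>\<open>A\<close> and \<open>B <#> A\<close> have the same image modulo \<open>B\<close>,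
  with kernels \<open>A \<inter> B\<close> and \<open>B\<close>. The multiplicative form avoids
  truncated division.\<close>

lemma card_set_mult:
  assumes A: "subgroup A G" and B: "B \<lhd> G"
  shows "card (B <#> A) * card (A \<inter> B) = card A * card B"
proof -
  interpret B: normal B G by fact
  interpret q: finite_surjective_hom G "G Mod B" "\<lambda>x. B #> x"
    by (rule coset_map_hom[OF B])
  let ?q = "\<lambda>x. B #> x" and ?S = "B <#> A"
  have S: "subgroup ?S G"
    using B A by (rule mult_norm_subgroup)
  have AG: "A \<subseteq> carrier G" using subgroup.subset[OF A] .
  have "?q ` ?S = ?q ` A"
  proof
    show "?q ` ?S \<subseteq> ?q ` A"
    proof
      fix y assume "y \<in> ?q ` ?S"
      then obtain b a where ba: "b \<in> B" "a \<in> A" "y = ?q (b \<otimes> a)"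
        by (auto simp: set_mult_def)
      then have "y = (B #> b) #> a"
        using AG B.subset by (subst coset_mult_assoc) auto
      then show "y \<in> ?q ` A"
        using ba B.coset_eq_one_iff[of b] by auto
    qed
    show "?q ` A \<subseteq> ?q ` ?S"
      using subset_set_mult_right[OF B.subgroup_axioms AG] by blast
  qed
  moreover have "?S \<inter> B = B"
    using subset_set_mult_left[OF A B.subset] by blast
  ultimately have "card (?q ` A) * card B = card ?S"
    using q.card_image_subgroup[OF S] by (simp add: B.kernel_coset_map)
  moreover have "card (?q ` A) * card (A \<inter> B) = card A"
    using q.card_image_subgroup[OF A] by (simp add: B.kernel_coset_map)
  ultimately show ?thesis
    by (metis mult.assoc mult.commute)
qed

lemma card_subgroup_dvd:
  assumes "subgroup H G" "subgroup K G" "K \<subseteq> H"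
  shows "card K dvd card H"
proof -
  interpret H: group "G\<lparr>carrier := H\<rparr>"
    using assms(1) by (rule subgroup_imp_group)
  have "subgroup K (G\<lparr>carrier := H\<rparr>)"
    using assms by (simp add: subgroup_restrict_iff)
  from H.lagrange[OF this] have "card H = card (rcosets\<^bsub>G\<lparr>carrier := H\<rparr>\<^esub> K) * card K"
    by (simp add: order_def)
  then show ?thesis by simp
qed

lemma order_restrict_Mod:
  assumes "subgroup H G" "K \<lhd> G\<lparr>carrier := H\<rparr>"
  shows "order (G\<lparr>carrier := H\<rparr> Mod K) = card H div card K"
proof -
  interpret H: finite_group "G\<lparr>carrier := H\<rparr>"
    by (rule finite_group_restrict[OF finite_group_axioms assms(1)])
  have sK: "subgroup K (G\<lparr>carrier := H\<rparr>)"
    using assms(2) by (rule normal_imp_subgroup)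
  have "order (G\<lparr>carrier := H\<rparr> Mod K) * card K = card H"
    using H.lagrange[OF sK] by (simp add: order_def FactGroup_def)
  from index_eqI[OF this H.card_subgroup_pos[OF sK]] show ?thesis by simp
qed

end

subsection \<open>p-soluble groups\<close>

text \<open>The condition on the order of a chief factor as a property of numbers. For prime
  \<open>p\<close> it passes to divisors, so it can be transported between factors whose orders
  divide each other.\<close>

definition p_power_or_coprime :: "nat \<Rightarrow> nat \<Rightarrow> bool" where
  "p_power_or_coprime p n \<longleftrightarrow> (\<exists>k. n = p ^ k) \<or> \<not> p dvd n"

lemma p_power_or_coprime_dvd:
  assumes "Factorial_Ring.prime p" "p_power_or_coprime p n" "m dvd n"
  shows "p_power_or_coprime p m"
  using assms divides_primepow_nat[of p m] unfolding p_power_or_coprime_def by (meson dvd_trans)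

context finite_group
begin

lemma chief_factor_index:
  assumes "chief_factor G U V"
  shows "order (G\<lparr>carrier := U\<rparr> Mod V) = card U div card V"
proof -
  have "subgroup U G" "V \<lhd> G" "V \<subseteq> U"
    using assms by (auto simp: chief_factor_def normal_imp_subgroup)
  then show ?thesis
    using order_restrict_Mod normal_restrict by metis
qed

lemma p_soluble_iff:
  "p_soluble p G \<longleftrightarrow> (\<forall>U V. chief_factor G U V \<longrightarrow> p_power_or_coprime p (card U div card V))"
  unfolding p_soluble_def p_power_or_coprime_def using is_group chief_factor_index by auto

lemma chief_factor_index_mult:
  assumes "chief_factor G U V"
  shows "card U = (card U div card V) * card V"
proof -
  have "card V dvd card U"
    using assms by (intro card_subgroup_dvd) (auto simp: chief_factor_def normal_imp_subgroup)
  then show ?thesis by simp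
qed

lemma trivial_p_soluble: "p_soluble p (G\<lparr>carrier := {\<one>}\<rparr>)"
proof -
  interpret one: finite_group "G\<lparr>carrier := {\<one>}\<rparr>"
    by (rule finite_group_restrict[OF finite_group_axioms triv_subgroup])
  have "\<not> chief_factor (G\<lparr>carrier := {\<one>}\<rparr>) U V" for U V
  proof
    assume ch: "chief_factor (G\<lparr>carrier := {\<one>}\<rparr>) U V"
    then have "V \<subset> U" "\<one> \<in> V" "U \<subseteq> {\<one>}"
      using subgroup.one_closed[OF normal_imp_subgroup] subgroup.subset[OF normal_imp_subgroup]
      by (fastforce simp: chief_factor_def)+
    then show False by blast
  qed
  then show ?thesis
    by (simp add: one.p_soluble_iff)
qed

text \<open>
  If \<open>A/B\<close> is a chief factor of \<open>G\<close> with \<open>A\<close> minimal subject to \<open>U \<inter> A \<notsubseteq> V\<close>, then \<open>|U : V|\<close>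
  divides \<open>|A : B|\<close>.
\<close>
lemma p_soluble_subgroup:
  assumes p: "Factorial_Ring.prime p" and sol: "p_soluble p G" and sK: "subgroup K G"
  shows "p_soluble p (G\<lparr>carrier := K\<rparr>)"
proof -
  interpret K: finite_group "G\<lparr>carrier := K\<rparr>"
    by (rule finite_group_restrict[OF finite_group_axioms sK])
  show ?thesis
    unfolding K.p_soluble_iff
  proof (intro allI impI)
    fix U V assume ch: "chief_factor (G\<lparr>carrier := K\<rparr>) U V"
    then have U: "U \<lhd> G\<lparr>carrier := K\<rparr>" and V: "V \<lhd> G\<lparr>carrier := K\<rparr>" and VU: "V \<subset> U"
      and chief: "\<And>N. N \<lhd> G\<lparr>carrier := K\<rparr> \<Longrightarrow> V \<subseteq> N \<Longrightarrow> N \<subseteq> U \<Longrightarrow> N = V \<or> N = U"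
      by (auto simp: chief_factor_def)
    have sU: "subgroup U G" and UK: "U \<subseteq> K" and sV: "subgroup V G"
      using U V normal_restrict_iff[OF sK] by auto
    have UG: "U \<subseteq> carrier G" using subgroup.subset[OF sU] .
    let ?P = "\<lambda>A. A \<lhd> G \<and> \<not> U \<inter> A \<subseteq> V"
    have "?P (carrier G)"
      using carrier_normal UG VU by blast
    then obtain A where A: "A \<lhd> G" and UA: "\<not> U \<inter> A \<subseteq> V"
      and min: "\<And>B. ?P B \<Longrightarrow> card A \<le> card B"
      using ex_has_least_nat[of ?P "carrier G" card] by blast
    have sA: "subgroup A G" using A by (rule normal_imp_subgroup)
    have "A \<noteq> {\<one>}"
      using UA subgroup.one_closed[OF sV] by blast
    then have "{\<one>} \<subset> A"
      using subgroup.one_closed[OF sA] by blast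
    then obtain B where AB: "chief_factor G A B"
      using chief_factor_exists[OF finite_carrier A one_is_normal] by metis
    then have B: "B \<lhd> G" and BA: "B \<subset> A" by (auto simp: chief_factor_def)
    have sB: "subgroup B G" using B by (rule normal_imp_subgroup)
    have "card B < card A"
      using finite_subgroup[OF sA] BA by (rule psubset_card_mono)
    then have UB: "U \<inter> B \<subseteq> V" using min[of B] B by auto
    have sUA: "subgroup (U \<inter> A) G" using sU sA by (rule subgroups_Inter_pair)
    have sVA: "subgroup (V \<inter> A) G" using sV sA by (rule subgroups_Inter_pair)
    have sUB: "subgroup (U \<inter> B) G" using sU sB by (rule subgroups_Inter_pair)
    have "U \<inter> A \<lhd> G\<lparr>carrier := K\<rparr>"
    proof -
      have "A \<inter> K \<lhd> G\<lparr>carrier := K\<rparr>" by (rule normal_Int_subgroup[OF sK A])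
      then have "U \<inter> (A \<inter> K) \<lhd> G\<lparr>carrier := K\<rparr>" by (rule K.normal_subgroup_intersect[OF U])
      moreover have "U \<inter> (A \<inter> K) = U \<inter> A" using UK by blast
      ultimately show ?thesis by simp
    qed
    then have "V <#> (U \<inter> A) \<lhd> G\<lparr>carrier := K\<rparr>"
      using K.normal_mult_normal[OF V] by simp
    moreover have "V \<subseteq> V <#> (U \<inter> A)"
      by (rule subset_set_mult_left[OF sUA subgroup.subset[OF sV]])
    moreover have "V <#> (U \<inter> A) \<subseteq> U"
      using VU by (intro set_mult_least[OF sU]) auto
    moreover have "V <#> (U \<inter> A) \<noteq> V"
      using subset_set_mult_right[OF sV subgroup.subset[OF sUA]] UA by blast
    ultimately have Ueq: "V <#> (U \<inter> A) = U"
      using chief by blast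
    have "subgroup (U \<inter> A) (G\<lparr>carrier := K\<rparr>)"
      using sUA UK by (auto simp: subgroup_restrict_iff[OF sK])
    then have "card (V <#> (U \<inter> A)) * card (U \<inter> A \<inter> V) = card (U \<inter> A) * card V"
      using K.card_set_mult[OF _ V] by simp
    moreover have "U \<inter> A \<inter> V = V \<inter> A" using VU by blast
    ultimately have 1: "card U * card (V \<inter> A) = card (U \<inter> A) * card V"
      using Ueq by simp
    have "card (B <#> (U \<inter> A)) * card (U \<inter> A \<inter> B) = card (U \<inter> A) * card B"
      by (rule card_set_mult[OF sUA B])
    moreover have "U \<inter> A \<inter> B = U \<inter> B" using BA by blast
    ultimately have 2: "card (B <#> (U \<inter> A)) * card (U \<inter> B) = card (U \<inter> A) * card B"
      by simp
    have "B <#> (U \<inter> A) \<subseteq> A"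
      using BA by (intro set_mult_least[OF sA]) auto
    then have "card (B <#> (U \<inter> A)) dvd card A"
      by (rule card_subgroup_dvd[OF sA mult_norm_subgroup[OF B sUA]])
    then obtain d where d: "card A = card (B <#> (U \<inter> A)) * d" ..
    have "U \<inter> B \<subseteq> V \<inter> A" using UB BA by blast
    then have "card (U \<inter> B) dvd card (V \<inter> A)"
      by (rule card_subgroup_dvd[OF sVA sUB])
    then obtain c where c: "card (V \<inter> A) = card (U \<inter> B) * c" ..
    \<comment> \<open>\<open>i * c\<close> is the index of \<open>U \<inter> B\<close> in
      \<open>U \<inter> A\<close>, which is also that of \<open>B\<close> in
      \<open>B <#> (U \<inter> A)\<close>; multiplying by \<open>d\<close> completes it to the index
      \<open>j\<close> of \<open>B\<close> in \<open>A\<close>.\<close>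
    define i where "i = card U div card V"
    define j where "j = card A div card B"
    have i: "card U = i * card V"
      unfolding i_def by (rule K.chief_factor_index_mult[OF ch])
    have j: "card A = j * card B"
      unfolding j_def by (rule chief_factor_index_mult[OF AB])
    have pos: "0 < card V" "0 < card B" "0 < card (U \<inter> B)"
      using card_subgroup_pos sV sB sUB by auto
    have "i * card (V \<inter> A) = card (U \<inter> A)"
      using 1 pos by (simp add: i)
    then have "(i * c * d) * (card B * card (U \<inter> B)) = card (U \<inter> A) * card B * d"
      by (simp add: c algebra_simps)
    also have "\<dots> = card (B <#> (U \<inter> A)) * card (U \<inter> B) * d"
      by (simp only: 2)
    also have "\<dots> = card A * card (U \<inter> B)"
      by (simp add: d)
    also have "\<dots> = j * (card B * card (U \<inter> B))"
      by (simp add: j)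
    finally have "i * c * d = j" using pos by simp
    then have "i dvd j" by (metis dvd_triv_left mult.assoc)
    moreover have "p_power_or_coprime p j"
      using sol AB p_soluble_iff by (simp add: j_def)
    ultimately show "p_power_or_coprime p (card U div card V)"
      using p_power_or_coprime_dvd[OF p] by (simp add: i_def)
  qed
qed

text \<open>Chief factors U/V of a nilpotent group are central. If \<open>p\<close> divides the
  order of U/V, the preimage of a Sylow p-subgroup contains \<open>V\<close> and with it [G, U]; so
  it is normal in \<open>G\<close>, and chiefness makes it all of \<open>U\<close>.\<close>

lemma nilpotent_imp_p_soluble:
  assumes p: "Factorial_Ring.prime p" and nil: "nilpotent_group G"
  shows "p_soluble p G"
  unfolding p_soluble_iff
proof (intro allI impI)
  fix U V assume ch: "chief_factor G U V"
  then have U: "U \<lhd> G" and V: "V \<lhd> G" and VU: "V \<subset> U"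
    and chief: "\<And>N. N \<lhd> G \<Longrightarrow> V \<subseteq> N \<Longrightarrow> N \<subseteq> U \<Longrightarrow> N = V \<or> N = U"
    by (auto simp: chief_factor_def)
  interpret V: normal V G by fact
  interpret U: normal U G by fact
  define i where "i = card U div card V"
  show "p_power_or_coprime p (card U div card V)"
  proof (cases "p dvd i")
    case True
    interpret U: finite_group "G\<lparr>carrier := U\<rparr>"
      by (rule finite_group_restrict[OF finite_group_axioms U.subgroup_axioms])
    have VnU: "V \<lhd> G\<lparr>carrier := U\<rparr>"
      using VU by (intro normal_restrict U.subgroup_axioms V) auto
    interpret VU: normal V "G\<lparr>carrier := U\<rparr>" by (rule VnU)
    interpret q: finite_surjective_hom "G\<lparr>carrier := U\<rparr>" "G\<lparr>carrier := U\<rparr> Mod V" "\<lambda>x. V #>\<^bsub>G\<lparr>carrier := U\<rparr>\<^esub> x"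
      by (rule U.coset_map_hom[OF VnU])
    have ord: "order (G\<lparr>carrier := U\<rparr> Mod V) = i"
      unfolding i_def by (rule order_restrict_Mod[OF U.subgroup_axioms VnU])
    have "i \<noteq> 0"
      using chief_factor_index_mult[OF ch] card_subgroup_pos[OF U.subgroup_axioms]
      unfolding i_def by (metis mult_0 less_irrefl)
    then obtain a m where am: "i = p ^ a * m" "\<not> p dvd m"
      using p by (metis multiplicity_decompose' not_prime_unit)
    \<comment> \<open>As \<open>p\<close> divides \<open>i\<close>, the Sylow subgroup is
      nontrivial; this later rules out that its preimage is only \<open>V\<close>.\<close>
    have a: "a \<noteq> 0" using True am by (metis mult_1 power_0)
    obtain L where L: "subgroup L (G\<lparr>carrier := U\<rparr> Mod V)" and cL: "card L = p ^ a"
      using sylow_thm[OF p q.H.is_group, of a m] am(1) ord VU.finite_Mod U.finite_carrier by auto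
    let ?L = "{x \<in> U. V #> x \<in> L}"
    have "subgroup ?L (G\<lparr>carrier := U\<rparr>)"
      using q.vimage_subgroup[OF L] by simp
    then have sL: "subgroup ?L G"
      using subgroup_restrict_iff[OF U.subgroup_axioms] by blast
    have VL: "V \<subseteq> ?L"
      using VU V.rcos_const[OF is_group] subgroup.one_closed[OF L] by auto
    have "?L \<lhd> G"
    proof (rule normal_invI[OF sL])
      fix g l assume g: "g \<in> carrier G" and l: "l \<in> ?L"
      have "carrier G \<subseteq> section_centralizer G U V"
        using nil by (intro nilpotent_normal_centralizes_chief_factor[OF carrier_normal _ ch]) simp
      then have "g \<otimes> l \<otimes> inv g \<otimes> inv l \<in> ?L"
        using g l VL by (auto simp: section_centralizer_def)
      then have "(g \<otimes> l \<otimes> inv g \<otimes> inv l) \<otimes> l \<in> ?L"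
        using l subgroup.m_closed[OF sL] by blast
      then show "g \<otimes> l \<otimes> inv g \<in> ?L"
        using g l by (simp add: m_assoc)
    qed
    then have "?L = V \<or> ?L = U"
      using chief VL by blast
    moreover have "(\<lambda>x. V #> x) ` ?L = L"
      using subgroup.subset[OF L] by (auto simp: carrier_FactGroup)
    ultimately have "L = (\<lambda>x. V #> x) ` V \<or> L = (\<lambda>x. V #> x) ` U"
      by metis
    then show ?thesis
    proof
      assume "L = (\<lambda>x. V #> x) ` V"
      then have "L \<subseteq> {V}" using V.rcos_const[OF is_group] by auto
      then have "card L \<le> 1" using card_mono[of "{V}" L] by simp
      moreover have "1 < p ^ a" using a prime_gt_1_nat[OF p] by (intro one_less_power) auto
      ultimately show ?thesis using cL by simp
    next
      assume "L = (\<lambda>x. V #> x) ` U"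
      then have "card L = i"
        using ord by (simp add: order_def carrier_FactGroup)
      then have "i = p ^ a" using cL by simp
      then show ?thesis unfolding p_power_or_coprime_def i_def by blast
    qed
  qed (simp add: i_def p_power_or_coprime_def)
qed

end

context finite_surjective_hom
begin

text \<open>Correspondence theorem: a normal subgroup above the preimage of \<open>V\<close>
  contains the kernel and is recovered from its image.\<close>

lemma chief_factor_vimage:
  assumes "chief_factor H U V"
  shows "chief_factor G {x \<in> carrier G. h x \<in> U} {x \<in> carrier G. h x \<in> V}" (is "chief_factor G ?U ?V")
proof -
  have U: "U \<lhd> H" and V: "V \<lhd> H" and VU: "V \<subset> U"
    and chief: "\<And>N. N \<lhd> H \<Longrightarrow> V \<subseteq> N \<Longrightarrow> N \<subseteq> U \<Longrightarrow> N = V \<or> N = U"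
    using assms by (auto simp: chief_factor_def)
  have sub: "U \<subseteq> carrier H" "V \<subseteq> carrier H"
    using U V subgroup.subset[OF normal_imp_subgroup] by auto
  have im: "h ` {x \<in> carrier G. h x \<in> W} = W" if "W \<subseteq> carrier H" for W
    using that unfolding surj[symmetric] by blast
  have "N = ?V \<or> N = ?U" if N: "N \<lhd> G" "?V \<subseteq> N" "N \<subseteq> ?U" for N
  proof -
    have sN: "subgroup N G" using N(1) by (rule normal_imp_subgroup)
    have pull: "{x \<in> carrier G. h x \<in> h ` N} \<subseteq> N"
    proof clarsimp
      fix x n assume x: "x \<in> carrier G" and n: "n \<in> N" "h x = h n"
      have nG: "n \<in> carrier G" using n subgroup.mem_carrier[OF sN] by blast
      have "h (x \<otimes> inv n) = \<one>\<^bsub>H\<^esub>" using x n nG by simp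
      then have "x \<otimes> inv n \<in> N"
        using N(2) x nG subgroup.one_closed[OF normal_imp_subgroup[OF V]] by auto
      then have "x \<otimes> inv n \<otimes> n \<in> N"
        using n subgroup.m_closed[OF sN] by blast
      then show "x \<in> N" using x nG by (simp add: G.m_assoc)
    qed
    have "h ` N = V \<or> h ` N = U"
    proof (rule chief[OF image_normal[OF N(1)]])
      show "V \<subseteq> h ` N" using im[OF sub(2)] N(2) by blast
      show "h ` N \<subseteq> U" using N(3) by blast
    qed
    then show ?thesis using pull N by blast
  qed
  moreover have "?V \<subset> ?U"
  proof -
    have "?V \<noteq> ?U" using im[OF sub(1)] im[OF sub(2)] VU by (metis less_irrefl)
    then show ?thesis using VU by blast
  qed
  ultimately show ?thesis
    using vimage_normal[OF U] vimage_normal[OF V] by (auto simp: chief_factor_def)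
qed

lemma card_vimage:
  assumes "subgroup L H"
  shows "card {x \<in> carrier G. h x \<in> L} = card L * card (kernel G H h)"
proof -
  let ?L = "{x \<in> carrier G. h x \<in> L}"
  have "h ` ?L = L"
    using subgroup.subset[OF assms] unfolding surj[symmetric] by blast
  moreover have "?L \<inter> kernel G H h = kernel G H h"
    using subgroup.one_closed[OF assms] by (auto simp: kernel_def)
  ultimately show ?thesis
    using card_image_subgroup[OF vimage_subgroup[OF assms]] by simp
qed

lemma p_soluble_image:
  assumes "p_soluble p G"
  shows "p_soluble p H"
proof -
  interpret H: finite_group H by (rule codomain_finite_group)
  show ?thesis
    unfolding H.p_soluble_iff
  proof (intro allI impI)
    fix U V assume ch: "chief_factor H U V"
    then have "subgroup U H" "subgroup V H"
      by (auto simp: chief_factor_def normal_imp_subgroup)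
    then have "card {x \<in> carrier G. h x \<in> U} div card {x \<in> carrier G. h x \<in> V} = card U div card V"
      using card_vimage card_subgroup_pos[OF subgroup_kernel] by simp
    moreover have "p_power_or_coprime p (card {x \<in> carrier G. h x \<in> U} div card {x \<in> carrier G. h x \<in> V})"
      using assms chief_factor_vimage[OF ch] unfolding p_soluble_iff by blast
    ultimately show "p_power_or_coprime p (card U div card V)" by simp
  qed
qed

end

section \<open>Normal subgroups, extensions and products of p-soluble groups\<close>

context finite_group
begin

text \<open>The order of a product of two subgroups divides the product of their orders. The
  intended properties are being a power of p and being prime to p, whose radicals are the largest
  normal p-subgroup and the largest normal p'-subgroup.\<close>

lemma radical_class_order:
  assumes one: "\<pi> 1" and closed: "\<And>a b c :: nat. \<pi> a \<Longrightarrow> \<pi> b \<Longrightarrow> c dvd a * b \<Longrightarrow> \<pi> c"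
  shows "radical_class G (\<lambda>L. \<pi> (card L))"
proof
  show "finite (carrier G)" by (rule finite_carrier)
  show "\<pi> (card {\<one>})" using one by simp
  fix H A B assume sH: "subgroup H G" and A: "A \<lhd> G\<lparr>carrier := H\<rparr>" and B: "B \<lhd> G\<lparr>carrier := H\<rparr>"
    and \<pi>: "\<pi> (card A)" "\<pi> (card B)"
  interpret H: finite_group "G\<lparr>carrier := H\<rparr>"
    by (rule finite_group_restrict[OF finite_group_axioms sH])
  have "card (A <#> B) * card (B \<inter> A) = card B * card A"
    using H.card_set_mult[OF normal_imp_subgroup[OF B] A] by simp
  then have "card (A <#> B) dvd card B * card A"
    by (metis dvd_triv_left)
  then show "\<pi> (card (A <#> B))"
    using closed \<pi> by blast
next
  fix A g assume A: "subgroup A G" "\<pi> (card A)" and g: "g \<in> carrier G"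
  have "inj_on (\<lambda>x. g \<otimes> x \<otimes> inv g) A"
    using g subgroup.subset[OF A(1)] by (auto simp: inj_on_def subset_iff)
  then show "\<pi> (card ((\<lambda>x. g \<otimes> x \<otimes> inv g) ` A))"
    using A by (simp add: card_image)
qed

text \<open>
  A minimal \<open>K\<close>-invariant section \<open>W/V\<close> of \<open>U/V\<close> is a \<open>p\<close>-group or a \<open>p'\<close>-group; its conjugates
  generate \<open>U/V\<close>, so \<open>U/V\<close> coincides with its largest normal \<open>p\<close>- or \<open>p'\<close>-subgroup.
\<close>
lemma chief_factor_below_p_soluble:
  assumes p: "Factorial_Ring.prime p" and K: "K \<lhd> G" and sol: "p_soluble p (G\<lparr>carrier := K\<rparr>)"
    and ch: "chief_factor G U V" and UK: "U \<subseteq> K"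
  shows "p_power_or_coprime p (card U div card V)"
proof -
  have U: "U \<lhd> G" and V: "V \<lhd> G" and VU: "V \<subset> U"
    and chief: "\<And>N. N \<lhd> G \<Longrightarrow> V \<subseteq> N \<Longrightarrow> N \<subseteq> U \<Longrightarrow> N = V \<or> N = U"
    using ch by (auto simp: chief_factor_def)
  have sU: "subgroup U G" and sV: "subgroup V G" and sK: "subgroup K G"
    using U V K by (auto simp: normal_imp_subgroup)
  interpret V: normal V G by fact
  interpret K: finite_group "G\<lparr>carrier := K\<rparr>"
    by (rule finite_group_restrict[OF finite_group_axioms sK])
  have UnK: "U \<lhd> G\<lparr>carrier := K\<rparr>" and VnK: "V \<lhd> G\<lparr>carrier := K\<rparr>"
    using UK VU normal_restrict[OF sK U] normal_restrict[OF sK V] by auto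
  let ?P = "\<lambda>W. W \<lhd> G\<lparr>carrier := K\<rparr> \<and> V \<subset> W \<and> W \<subseteq> U"
  have "?P U" using UnK VU by blast
  then obtain W where W: "W \<lhd> G\<lparr>carrier := K\<rparr>" "V \<subset> W" "W \<subseteq> U"
    and min: "\<And>N. ?P N \<Longrightarrow> card W \<le> card N"
    using ex_has_least_nat[of ?P U card] by blast
  have sW: "subgroup W G" using W(1) normal_restrict_iff[OF sK] by blast
  have "N = V \<or> N = W" if "N \<lhd> G\<lparr>carrier := K\<rparr>" "V \<subseteq> N" "N \<subseteq> W" for N
    using min[of N] that W finite_subgroup[OF sW] by (metis card_seteq psubsetI subset_trans)
  then have chW: "chief_factor (G\<lparr>carrier := K\<rparr>) W V"
    using W VnK by (auto simp: chief_factor_def)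
  define w where "w = card W div card V"
  have ppw: "p_power_or_coprime p w"
    using sol chW K.p_soluble_iff by (simp add: w_def)
  interpret q: finite_surjective_hom G "G Mod V" "\<lambda>x. V #> x"
    by (rule coset_map_hom[OF V])
  interpret Q: finite_group "G Mod V" by (rule q.codomain_finite_group)
  have index: "card ((\<lambda>x. V #> x) ` L) = card L div card V" if "subgroup L G" "V \<subseteq> L" for L
  proof -
    have "card ((\<lambda>x. V #> x) ` L) * card V = card L"
      using q.card_image_subgroup[OF that(1)] that(2) by (simp add: V.kernel_coset_map Int_absorb1)
    from index_eqI[OF this card_subgroup_pos[OF sV]] show ?thesis by simp
  qed
  \<comment> \<open>\<open>\<pi>\<close> is left open because the case of p-powers and the case of
    numbers prime to \<open>p\<close> run identically.\<close>
  have main: "\<pi> (card U div card V)"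
    if one: "\<pi> 1" and closed: "\<And>a b c :: nat. \<pi> a \<Longrightarrow> \<pi> b \<Longrightarrow> c dvd a * b \<Longrightarrow> \<pi> c" and w: "\<pi> w" for \<pi>
  proof -
    interpret R: radical_class "G Mod V" "\<lambda>L. \<pi> (card L)"
      using one closed by (rule Q.radical_class_order)
    let ?U = "(\<lambda>x. V #> x) ` U" and ?W = "(\<lambda>x. V #> x) ` W"
    have UQ: "?U \<lhd> G Mod V" by (rule q.image_normal[OF U])
    have sUQ: "subgroup ?U (G Mod V)" using UQ by (rule normal_imp_subgroup)
    have "W \<lhd> G\<lparr>carrier := U\<rparr>"
      using W(1,3) UK by (auto simp: normal_restrict_iff[OF sK] normal_restrict_iff[OF sU])
    then have "?W \<lhd> (G Mod V)\<lparr>carrier := ?U\<rparr>"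
      using surjective_hom.image_normal[OF q.restrict_surjective[OF sU]] by simp
    moreover have "\<pi> (card ?W)"
      using index[OF sW] W w by (simp add: w_def)
    ultimately have WR: "?W \<subseteq> R.radical ?U" by (rule R.radical_upper)
    let ?R = "R.radical ?U"
    \<comment> \<open>The radical of U/V is normal in G/V because U/V is. It contains the nontrivial
      W/V, so chiefness makes it all of U/V.\<close>
    have R: "?R \<lhd> G Mod V"
      using R.radical_normal_in[OF q.H.subgroup_self, of ?U] UQ by simp
    have RU: "?R \<subseteq> ?U"
      using R.radical_normal_mem(1)[OF sUQ] q.H.normal_restrict_iff[OF sUQ] by blast
    let ?N = "{x \<in> carrier G. V #> x \<in> ?R}"
    have mem_iff: "V #> x \<in> (\<lambda>x. V #> x) ` U \<longleftrightarrow> x \<in> U" if x: "x \<in> carrier G" for x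
    proof
      assume "V #> x \<in> (\<lambda>x. V #> x) ` U"
      then obtain u where u: "u \<in> U" "V #> x = V #> u" by blast
      then have "x \<in> V #> u" using rcos_self[OF x sV] by simp
      then show "x \<in> U"
        using u(1) VU subgroup.m_closed[OF sU] by (auto simp: r_coset_def)
    qed blast
    have "?N = V \<or> ?N = U"
    proof (rule chief[OF q.vimage_normal[OF R]])
      show "V \<subseteq> ?N"
        using V.rcos_const[OF is_group] V.subset subgroup.one_closed[OF normal_imp_subgroup[OF R]]
        by auto
      show "?N \<subseteq> U" using RU mem_iff by blast
    qed
    moreover have "W \<subseteq> ?N"
      using WR subgroup.subset[OF sW] by blast
    ultimately have "?N = U" using W by blast
    then have "?R = ?U" using RU by blast
    then have "\<pi> (card ?U)"
      using R.radical_normal_mem(2)[OF sUQ] by metis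
    then show ?thesis using index[OF sU] VU by simp
  qed
  show ?thesis
  proof (cases "p dvd w")
    case True
    then have w: "\<exists>k. w = p ^ k" using ppw by (simp add: p_power_or_coprime_def)
    have "\<exists>k. card U div card V = p ^ k"
    proof (rule main[of "\<lambda>n. \<exists>k. n = p ^ k"])
      show "\<exists>k. 1 = p ^ k" by (metis power_0)
      fix a b c :: nat assume "\<exists>k. a = p ^ k" "\<exists>k. b = p ^ k" and c: "c dvd a * b"
      then obtain k l where "a * b = p ^ (k + l)" by (auto simp: power_add)
      then show "\<exists>k. c = p ^ k" using c divides_primepow_nat[OF p] by auto
    qed (rule w)
    then show ?thesis by (simp add: p_power_or_coprime_def)
  next
    case False
    have "\<not> p dvd card U div card V"
    proof (rule main[of "\<lambda>n. \<not> p dvd n"])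
      show "\<not> p dvd 1" using p by (simp add: prime_nat_iff)
      fix a b c :: nat assume "\<not> p dvd a" "\<not> p dvd b" "c dvd a * b"
      then show "\<not> p dvd c" using p by (meson dvd_trans prime_dvd_multD)
    qed (rule False)
    then show ?thesis by (simp add: p_power_or_coprime_def)
  qed
qed

end

context finite_surjective_hom
begin

text \<open>Let K be the kernel and U/V a chief factor. If \<open>U \<inter> K\<close> lies in
  \<open>V\<close>, then \<open>h\<close> identifies U/V with a chief factor of \<open>H\<close>.
  Otherwise \<open>U\<close> is the product of \<open>V\<close> and \<open>U \<inter> K\<close>, and
  U/V has the order of the chief factor of \<open>G\<close> between \<open>V \<inter> K\<close> and
  \<open>U \<inter> K\<close>, which lies below K.\<close>

lemma p_soluble_extension:
  assumes p: "Factorial_Ring.prime p"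
    and sol: "p_soluble p (G\<lparr>carrier := kernel G H h\<rparr>)" "p_soluble p H"
  shows "p_soluble p G"
  unfolding p_soluble_iff
proof (intro allI impI)
  fix U V assume ch: "chief_factor G U V"
  then have U: "U \<lhd> G" and V: "V \<lhd> G" and VU: "V \<subset> U"
    and chief: "\<And>N. N \<lhd> G \<Longrightarrow> V \<subseteq> N \<Longrightarrow> N \<subseteq> U \<Longrightarrow> N = V \<or> N = U"
    by (auto simp: chief_factor_def)
  have sU: "subgroup U G" and sV: "subgroup V G"
    using U V by (auto simp: normal_imp_subgroup)
  interpret H: finite_group H by (rule codomain_finite_group)
  define K where "K = kernel G H h"
  have K: "K \<lhd> G" unfolding K_def by (rule normal_kernel)
  have sK: "subgroup K G" using K by (rule normal_imp_subgroup)
  have UG: "U \<subseteq> carrier G" and VG: "V \<subseteq> carrier G"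
    using subgroup.subset sU sV by auto
  have quot: "inv v \<otimes> u \<in> K" if "u \<in> carrier G" "v \<in> carrier G" "h u = h v" for u v
    using that by (simp add: K_def kernel_def)
  show "p_power_or_coprime p (card U div card V)"
  proof (cases "U \<inter> K \<subseteq> V")
    case True
    \<comment> \<open>Since \<open>U\<close> meets the kernel inside \<open>V\<close>, a subgroup
      between \<open>V\<close> and \<open>U\<close> is recovered from its image.\<close>
    have pull: "u \<in> L" if L: "subgroup L G" "V \<subseteq> L" "L \<subseteq> U" and u: "u \<in> U" "h u \<in> h ` L" for u L
    proof -
      obtain l where l: "l \<in> L" "h u = h l" using u by blast
      have G: "u \<in> carrier G" "l \<in> carrier G" using u l L UG by auto
      have "inv l \<otimes> u \<in> K" using quot G l by blast
      moreover have "inv l \<otimes> u \<in> U"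
        using u(1) l(1) L(3) subgroup.m_closed[OF sU] subgroup.m_inv_closed[OF sU] by blast
      ultimately have "inv l \<otimes> u \<in> L" using True L by blast
      then have "l \<otimes> (inv l \<otimes> u) \<in> L" using l subgroup.m_closed[OF L(1)] by blast
      then show ?thesis using G by simp
    qed
    have "chief_factor H (h ` U) (h ` V)"
      unfolding chief_factor_def
    proof (intro conjI allI impI image_normal U V)
      have "h ` V \<noteq> h ` U"
      proof
        assume eq: "h ` V = h ` U"
        have "U \<subseteq> V" using pull[OF sV] VU eq by blast
        then show False using VU by blast
      qed
      then show "h ` V \<subset> h ` U" using VU by blast
      fix N assume N: "N \<lhd> H \<and> h ` V \<subseteq> N \<and> N \<subseteq> h ` U"
      let ?N = "{x \<in> carrier G. h x \<in> N} \<inter> U"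
      have "?N \<lhd> G" using N U vimage_normal G.normal_subgroup_intersect by blast
      moreover have "V \<subseteq> ?N" using N VU VG by blast
      ultimately have "?N = V \<or> ?N = U" using chief by blast
      moreover have "h ` ?N = N" using N UG by blast
      ultimately obtain N' where "N' = V \<or> N' = U" "N = h ` N'" by blast
      then show "N = h ` V \<or> N = h ` U" by blast
    qed
    then have "p_power_or_coprime p (card (h ` U) div card (h ` V))"
      using sol(2) H.p_soluble_iff by blast
    moreover have "card (h ` U) * card (U \<inter> K) = card U" "card (h ` V) * card (V \<inter> K) = card V"
      unfolding K_def using card_image_subgroup sU sV by auto
    moreover have "V \<inter> K = U \<inter> K" using True VU by blast
    moreover have "0 < card (U \<inter> K)"
      by (rule card_subgroup_pos[OF G.subgroups_Inter_pair[OF sU sK]])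
    ultimately show ?thesis by (metis div_mult_mult2 less_numeral_extra(3))
  next
    case False
    let ?U = "U \<inter> K" and ?V = "V \<inter> K"
    have U1: "?U \<lhd> G" and V1: "?V \<lhd> G"
      using U V K G.normal_subgroup_intersect by auto
    have join: "V <#> W = U \<or> W \<subseteq> V" if W: "W \<lhd> G" "W \<subseteq> U" for W
    proof -
      have sW: "subgroup W G" using W(1) by (rule normal_imp_subgroup)
      have "V <#> W = V \<or> V <#> W = U"
      proof (rule chief[OF G.normal_mult_normal[OF V W(1)]])
        show "V \<subseteq> V <#> W" by (rule G.subset_set_mult_left[OF sW VG])
        show "V <#> W \<subseteq> U" using VU W by (intro G.set_mult_least[OF sU]) auto
      qed
      moreover have "W \<subseteq> V <#> W"
        by (rule G.subset_set_mult_right[OF sV subgroup.subset[OF sW]])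
      ultimately show ?thesis by blast
    qed
    then have Ueq: "V <#> ?U = U" using U1 False by blast
    have sU1: "subgroup ?U G" using U1 by (rule normal_imp_subgroup)
    have "?U \<inter> V = ?V" using VU by blast
    then have cards: "card U * card ?V = card ?U * card V"
      using card_set_mult[OF sU1 V] Ueq by simp
    have ch1: "chief_factor G ?U ?V"
      unfolding chief_factor_def
    proof (intro conjI allI impI U1 V1)
      show "?V \<subset> ?U" using False VU by blast
      fix W assume W: "W \<lhd> G \<and> ?V \<subseteq> W \<and> W \<subseteq> ?U"
      then have sW: "subgroup W G" by (simp add: normal_imp_subgroup)
      have "V <#> W = U \<or> W \<subseteq> V" using join W by blast
      then show "W = ?V \<or> W = ?U"
      proof
        assume eq: "V <#> W = U"
        \<comment> \<open>Dedekind's argument: in u = vw the factor v lies in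
          \<open>V \<inter> K\<close>, which is contained in \<open>W\<close>.\<close>
        have "?U \<subseteq> W"
        proof
          fix u assume u: "u \<in> ?U"
          then obtain v w where vw: "v \<in> V" "w \<in> W" "u = v \<otimes> w"
            using eq by (auto simp: set_mult_def)
          have G: "v \<in> carrier G" "w \<in> carrier G"
            using vw VG subgroup.subset[OF sW] by auto
          have "u \<otimes> inv w \<in> K"
            using u vw W subgroup.m_closed[OF sK] subgroup.m_inv_closed[OF sK] by blast
          then have "v \<in> K" using vw G by (simp add: G.m_assoc)
          then show "u \<in> W"
            using vw W subgroup.m_closed[OF sW] by blast
        qed
        then show ?thesis using W by blast
      qed (use W in blast)
    qed
    have "p_power_or_coprime p (card ?U div card ?V)"
      using sol(1) by (intro chief_factor_below_p_soluble[OF p K _ ch1]) (auto simp: K_def)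
    moreover have "card U div card V = card ?U div card ?V"
    proof -
      have "card U = (card U div card V) * card V" by (rule chief_factor_index_mult[OF ch])
      then have "(card U div card V) * card ?V * card V = card ?U * card V"
        using cards by (metis mult.assoc mult.commute)
      then have "(card U div card V) * card ?V = card ?U"
        using card_subgroup_pos[OF sV] by simp
      from index_eqI[OF this card_subgroup_pos[OF normal_imp_subgroup[OF V1]]] show ?thesis by simp
    qed
    ultimately show ?thesis by simp
  qed
qed

end

context finite_group
begin

text \<open>The product modulo \<open>A\<close> is an image of \<open>B\<close>, so the product is
  an extension of one p-soluble group by another.\<close>

lemma p_soluble_set_mult:
  assumes p: "Factorial_Ring.prime p" and sH: "subgroup H G"
    and A: "A \<lhd> G\<lparr>carrier := H\<rparr>" "p_soluble p (G\<lparr>carrier := A\<rparr>)"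
    and B: "B \<lhd> G\<lparr>carrier := H\<rparr>" "p_soluble p (G\<lparr>carrier := B\<rparr>)"
  shows "p_soluble p (G\<lparr>carrier := A <#> B\<rparr>)"
proof -
  interpret H: finite_group "G\<lparr>carrier := H\<rparr>"
    by (rule finite_group_restrict[OF finite_group_axioms sH])
  define P where "P = A <#> B"
  have "P \<lhd> G\<lparr>carrier := H\<rparr>"
    using H.normal_mult_normal[OF A(1) B(1)] by (simp add: P_def)
  then have sP: "subgroup P G" and PH: "P \<subseteq> H"
    using normal_restrict_iff[OF sH] by auto
  interpret P: finite_group "G\<lparr>carrier := P\<rparr>"
    by (rule finite_group_restrict[OF finite_group_axioms sP])
  have sA: "subgroup A G" and sB: "subgroup B G"
    using A B normal_restrict_iff[OF sH] by auto
  have AG: "A \<subseteq> carrier G" and BG: "B \<subseteq> carrier G"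
    using subgroup.subset sA sB by auto
  have AP: "A \<subseteq> P" unfolding P_def by (rule subset_set_mult_left[OF sB AG])
  have BP: "B \<subseteq> P" unfolding P_def by (rule subset_set_mult_right[OF sA BG])
  have AnP: "A \<lhd> G\<lparr>carrier := P\<rparr>"
    using A(1) AP PH by (auto simp: normal_restrict_iff[OF sH] normal_restrict_iff[OF sP])
  interpret A: normal A "G\<lparr>carrier := P\<rparr>" by (rule AnP)
  let ?q = "\<lambda>x. A #>\<^bsub>G\<lparr>carrier := P\<rparr>\<^esub> x"
  interpret q: finite_surjective_hom "G\<lparr>carrier := P\<rparr>" "G\<lparr>carrier := P\<rparr> Mod A" ?q
    by (rule P.coset_map_hom[OF AnP])
  have sBP: "subgroup B (G\<lparr>carrier := P\<rparr>)"
    using sB BP by (simp add: subgroup_restrict_iff[OF sP])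
  have "?q ` B = carrier (G\<lparr>carrier := P\<rparr> Mod A)"
  proof
    show "?q ` B \<subseteq> carrier (G\<lparr>carrier := P\<rparr> Mod A)"
      using q.hom_closed BP by auto
    show "carrier (G\<lparr>carrier := P\<rparr> Mod A) \<subseteq> ?q ` B"
    proof
      fix y assume "y \<in> carrier (G\<lparr>carrier := P\<rparr> Mod A)"
      then obtain a b where ab: "a \<in> A" "b \<in> B" "y = A #> (a \<otimes> b)"
        by (auto simp: carrier_FactGroup P_def set_mult_def)
      then have "y = (A #> a) #> b"
        using AG BG by (subst coset_mult_assoc) auto
      moreover have "A #> a = A"
        using ab(1) AG by (intro coset_join2 sA) auto
      ultimately show "y \<in> ?q ` B" using ab by auto
    qed
  qed
  then have "p_soluble p (G\<lparr>carrier := P\<rparr> Mod A)"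
    using finite_surjective_hom.p_soluble_image[OF q.restrict_finite_surjective[OF sBP], of p] B(2) by simp
  moreover have "kernel (G\<lparr>carrier := P\<rparr>) (G\<lparr>carrier := P\<rparr> Mod A) ?q = A"
    by (rule A.kernel_coset_map)
  ultimately have "p_soluble p (G\<lparr>carrier := P\<rparr>)"
    using q.p_soluble_extension[OF p] A(2) by simp
  then show ?thesis by (simp add: P_def)
qed

end

section \<open>The p-soluble radical\<close>

definition p_radical :: "nat \<Rightarrow> ('a, 'b) monoid_scheme \<Rightarrow> 'a set" where
  "p_radical p G = generate G (\<Union>{N. N \<lhd> G \<and> p_soluble p (G\<lparr>carrier := N\<rparr>)})"

context finite_group
begin

context
  fixes p :: nat
  assumes p: "Factorial_Ring.prime p"
begin

lemma p_soluble_radical_class: "radical_class G (\<lambda>N. p_soluble p (G\<lparr>carrier := N\<rparr>))"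
proof
  show "p_soluble p (G\<lparr>carrier := (\<lambda>x. g \<otimes> x \<otimes> inv g) ` A\<rparr>)"
    if "subgroup A G" "p_soluble p (G\<lparr>carrier := A\<rparr>)" "g \<in> carrier G" for A g
  proof -
    interpret c: finite_surjective_hom G G "\<lambda>x. g \<otimes> x \<otimes> inv g"
      using conj_surjective_hom[OF that(3)] finite_group_axioms by (rule finite_surjective_hom.intro)
    show ?thesis
      by (rule finite_surjective_hom.p_soluble_image[OF c.restrict_finite_surjective[OF that(1)] that(2)])
  qed
qed (use finite_carrier trivial_p_soluble p_soluble_set_mult[OF p] in auto)

lemma p_radical_eq_radical:
  "p_radical p G = radical_class.radical G (\<lambda>N. p_soluble p (G\<lparr>carrier := N\<rparr>)) (carrier G)"
  by (simp add: p_radical_def radical_class.radical_def[OF p_soluble_radical_class])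

lemma p_radical_normal: "p_radical p G \<lhd> G"
  using radical_class.radical_normal_mem(1)[OF p_soluble_radical_class subgroup_self]
  by (simp add: p_radical_eq_radical)

lemma p_radical_p_soluble: "p_soluble p (G\<lparr>carrier := p_radical p G\<rparr>)"
  using radical_class.radical_normal_mem(2)[OF p_soluble_radical_class subgroup_self]
  by (simp add: p_radical_eq_radical)

lemma subnormal_p_soluble_subset_p_radical:
  assumes "subnormal G N" "p_soluble p (G\<lparr>carrier := N\<rparr>)"
  shows "N \<subseteq> p_radical p G"
  using radical_class.subnormal_subset_radical[OF p_soluble_radical_class assms]
  by (simp add: p_radical_eq_radical)

lemma fitting_subset_p_radical: "fitting_subgroup G \<subseteq> p_radical p G"
proof -
  interpret F: finite_group "G\<lparr>carrier := fitting_subgroup G\<rparr>"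
    by (rule finite_group_restrict[OF finite_group_axioms normal_imp_subgroup[OF fitting_normal]])
  show ?thesis
    by (intro subnormal_p_soluble_subset_p_radical normal_imp_subnormal fitting_normal
        F.nilpotent_imp_p_soluble[OF p] fitting_nilpotent)
qed

text \<open>The intersection of \<open>N\<close> with the radical of \<open>M\<close> is p-soluble
  and normal in \<open>N\<close>, hence subnormal in \<open>G\<close>; it contains the commutators
  of the two.\<close>

lemma p_radical_commutator_subset:
  assumes sM: "subgroup M G" and N: "N \<lhd> G" and NM: "N \<subseteq> M"
  shows "p_radical p (G\<lparr>carrier := M\<rparr>) \<inter> N \<subseteq> p_radical p G"
    and "p_radical p (G\<lparr>carrier := M\<rparr>) \<subseteq> section_centralizer G N (p_radical p G)"
proof -
  interpret M: finite_group "G\<lparr>carrier := M\<rparr>"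
    by (rule finite_group_restrict[OF finite_group_axioms sM])
  interpret N: normal N G by fact
  let ?R = "p_radical p (G\<lparr>carrier := M\<rparr>)"
  have R: "?R \<lhd> G\<lparr>carrier := M\<rparr>"
    using M.p_radical_normal[OF p] .
  then have sR: "subgroup ?R G" and RM: "?R \<subseteq> M"
    and Rinv: "\<And>m x. m \<in> M \<Longrightarrow> x \<in> ?R \<Longrightarrow> m \<otimes> x \<otimes> inv m \<in> ?R"
    using normal_restrict_iff[OF sM] by auto
  interpret R: finite_group "G\<lparr>carrier := ?R\<rparr>"
    by (rule finite_group_restrict[OF finite_group_axioms sR])
  have sRN: "subgroup (?R \<inter> N) G"
    using sR N.subgroup_axioms subgroups_Inter_pair by blast
  have "?R \<inter> N \<lhd> G\<lparr>carrier := N\<rparr>"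
    unfolding normal_restrict_iff[OF N.subgroup_axioms] using sRN Rinv NM by auto
  then have sn: "subnormal G (?R \<inter> N)"
    by (rule subnormal.step[OF normal_imp_subnormal[OF N]])
  have "subgroup (?R \<inter> N) (G\<lparr>carrier := ?R\<rparr>)"
    using sRN by (simp add: subgroup_restrict_iff[OF sR])
  then have "p_soluble p (G\<lparr>carrier := ?R \<inter> N\<rparr>)"
    using R.p_soluble_subgroup[OF p] M.p_radical_p_soluble[OF p] by fastforce
  then show sub: "?R \<inter> N \<subseteq> p_radical p G"
    by (rule subnormal_p_soluble_subset_p_radical[OF sn])
  show "?R \<subseteq> section_centralizer G N (p_radical p G)"
  proof
    fix x assume x: "x \<in> ?R"
    then have xG: "x \<in> carrier G" using subgroup.subset[OF sR] by blast
    have "x \<otimes> n \<otimes> inv x \<otimes> inv n \<in> p_radical p G" if n: "n \<in> N" for n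
    proof -
      have "x \<otimes> n \<otimes> inv x \<otimes> inv n \<in> N"
        using xG n by (intro commutator_mem_normal N.subgroup_axioms N.inv_op_closed2)
      moreover have "x \<otimes> n \<otimes> inv x \<otimes> inv n \<in> ?R"
        using x NM n by (intro commutator_mem_normal sR Rinv) auto
      ultimately show ?thesis using sub by blast
    qed
    then show "x \<in> section_centralizer G N (p_radical p G)"
      using xG by (auto simp: section_centralizer_def)
  qed
qed

lemma p_radical_subset_restrict:
  assumes sM: "subgroup M G" and RM: "p_radical p G \<subseteq> M"
  shows "p_radical p G \<subseteq> p_radical p (G\<lparr>carrier := M\<rparr>)"
proof -
  interpret M: finite_group "G\<lparr>carrier := M\<rparr>"
    by (rule finite_group_restrict[OF finite_group_axioms sM])
  show ?thesis
    using p_radical_p_soluble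
    by (intro M.subnormal_p_soluble_subset_p_radical[OF p] M.normal_imp_subnormal
        normal_restrict[OF sM p_radical_normal RM]) auto
qed

text \<open>When \<open>M\<close> has no \<open>p\<close>-soluble normal subgroup, \<open>F\<^sup>*(M)\<close> is generated by components.\<close>
lemma Fs_restrict_eq:
  assumes sM: "subgroup M G" and FM: "Fs \<subseteq> M" and R: "p_radical p (G\<lparr>carrier := M\<rparr>) = {\<one>}"
  shows "generalized_fitting_subgroup (G\<lparr>carrier := M\<rparr>) = Fs"
proof
  interpret M: finite_group "G\<lparr>carrier := M\<rparr>"
    by (rule finite_group_restrict[OF finite_group_axioms sM])
  show "Fs \<subseteq> M.Fs" by (rule Fs_subset_restrict[OF sM FM])
  show "M.Fs \<subseteq> Fs"
  proof (rule M.Fs_subset)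
    show "subgroup Fs (G\<lparr>carrier := M\<rparr>)"
      using FM Fs_subgroup by (simp add: subgroup_restrict_iff[OF sM])
    show "fitting_subgroup (G\<lparr>carrier := M\<rparr>) \<subseteq> Fs"
      using M.fitting_subset_p_radical[OF p] R subgroup.one_closed[OF Fs_subgroup] by auto
    fix K assume K: "component (G\<lparr>carrier := M\<rparr>) K"
    have KM: "K \<subseteq> M" using subgroup.subset[OF M.component_subgroup[OF K]] by simp
    \<comment> \<open>The second alternative is harmless: a component centralizing \<open>Fs\<close>
      lies in \<open>Fs\<close>, because \<open>Fs\<close> contains its centralizer.\<close>
    have "K \<subseteq> Fs \<or> (\<forall>k\<in>K. \<forall>n\<in>Fs. k \<otimes> n = n \<otimes> k)"
      using M.component_normal_cases[OF K normal_restrict[OF sM Fs_normal FM]] by simp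
    then show "K \<subseteq> Fs"
    proof
      assume "\<forall>k\<in>K. \<forall>n\<in>Fs. k \<otimes> n = n \<otimes> k"
      then have "K \<subseteq> section_centralizer G Fs {\<one>}"
        using KM subgroup.subset[OF sM] section_centralizer_iff_commute[OF subgroup.subset[OF Fs_subgroup]]
        by blast
      then show ?thesis using centralizer_Fs_subset by blast
    qed
  qed
qed

end

end

context finite_surjective_hom
begin

lemma p_radical_image:
  assumes p: "Factorial_Ring.prime p"
  shows "h ` p_radical p G \<subseteq> p_radical p H"
proof -
  interpret H: finite_group H by (rule codomain_finite_group)
  let ?R = "p_radical p G"
  have "p_soluble p (H\<lparr>carrier := h ` ?R\<rparr>)"
    by (rule finite_surjective_hom.p_soluble_image[OF restrict_finite_surjective[OF
            normal_imp_subgroup[OF p_radical_normal[OF p]]] p_radical_p_soluble[OF p]])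
  then show ?thesis
    by (intro H.subnormal_p_soluble_subset_p_radical[OF p] H.normal_imp_subnormal image_normal
        p_radical_normal[OF p])
qed

text \<open>The preimage of the radical of \<open>H\<close> is an extension of one p-soluble group
  by another and normal in \<open>G\<close>, so it lies in the kernel already.\<close>

lemma p_radical_quotient_trivial:
  assumes p: "Factorial_Ring.prime p" and ker: "kernel G H h = p_radical p G"
  shows "p_radical p H = {\<one>\<^bsub>H\<^esub>}"
proof -
  interpret H: finite_group H by (rule codomain_finite_group)
  let ?R = "p_radical p H" and ?L = "{x \<in> carrier G. h x \<in> p_radical p H}"
  have R: "?R \<lhd> H" by (rule H.p_radical_normal[OF p])
  have sR: "subgroup ?R H" using R by (rule normal_imp_subgroup)
  have L: "?L \<lhd> G" by (rule vimage_normal[OF R])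
  have sL: "subgroup ?L G" using L by (rule normal_imp_subgroup)
  interpret L: finite_surjective_hom "G\<lparr>carrier := ?L\<rparr>" "H\<lparr>carrier := h ` ?L\<rparr>" h
    by (rule restrict_finite_surjective[OF sL])
  have imL: "h ` ?L = ?R"
    using subgroup.subset[OF sR] unfolding surj[symmetric] by blast
  have "kernel (G\<lparr>carrier := ?L\<rparr>) (H\<lparr>carrier := h ` ?L\<rparr>) h = kernel G H h"
    using subgroup.one_closed[OF sR] by (auto simp: kernel_def)
  then have "p_soluble p (G\<lparr>carrier := ?L\<rparr>)"
    using L.p_soluble_extension[OF p] p_radical_p_soluble[OF p] H.p_radical_p_soluble[OF p]
    by (simp add: ker imL)
  then have "?L \<subseteq> kernel G H h"
    unfolding ker by (rule subnormal_p_soluble_subset_p_radical[OF p G.normal_imp_subnormal[OF L]])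
  then have "h ` ?L \<subseteq> {\<one>\<^bsub>H\<^esub>}"
    by (auto simp: kernel_def)
  then have "?R \<subseteq> {\<one>\<^bsub>H\<^esub>}"
    by (simp only: imL)
  then show ?thesis
    using subgroup.one_closed[OF sR] by blast
qed

end

lemma finite_surjective_homI:
  assumes "finite_group G" "group H" "h \<in> hom G H" "h ` carrier G = carrier H"
  shows "finite_surjective_hom G H h"
  using assms by (simp add: finite_surjective_hom_def surjective_hom_def surjective_hom_axioms_def
      group_hom_def group_hom_axioms_def finite_group_def)

subsection \<open>Direct products of nonabelian simple groups\<close>

lemma simple_imp_quasisimple:
  assumes "simple_group S" "\<not> comm_group S"
  shows "quasisimple_group S"
proof -
  interpret S: simple_group S by fact
  have "finite (carrier S)"
    using S.order_gt_one by (metis S.order_gt_0_iff_finite less_trans zero_less_one)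
  then interpret S: finite_group S by unfold_locales
  have normal: "N = carrier S \<or> N = {\<one>\<^bsub>S\<^esub>}" if "N \<lhd> S" for N
    using S.no_real_normal_subgroup[OF that] .
  have "derived S (carrier S) \<noteq> {\<one>\<^bsub>S\<^esub>}"
  proof
    assume d: "derived S (carrier S) = {\<one>\<^bsub>S\<^esub>}"
    have "x \<otimes>\<^bsub>S\<^esub> y = y \<otimes>\<^bsub>S\<^esub> x" if "x \<in> carrier S" "y \<in> carrier S" for x y
      using S.commutator_mem_derived[OF that] d S.commutator_one_iff[OF that] by simp
    then have "comm_group S" by (rule S.group_comm_groupI)
    then show False using assms(2) by simp
  qed
  then have "derived S (carrier S) = carrier S"
    using normal S.derived_is_normal[OF S.carrier_normal] by blast
  moreover have "\<one>\<^bsub>S\<^esub> \<in> group_center S"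
    by (rule subgroup.one_closed[OF normal_imp_subgroup[OF S.group_center_normal]])
  ultimately show ?thesis
    using S.quasisimple_iff normal S.simple_not_triv by blast
qed

text \<open>Each coordinate subgroup is normal and, as an image of a nonabelian simple group,
  quasisimple, so it is a component; the coordinate subgroups generate the product.\<close>

lemma product_group_layer:
  fixes S :: "nat \<Rightarrow> ('a, 'b) monoid_scheme"
  assumes S: "\<And>i. i < n \<Longrightarrow> simple_group (S i)" "\<And>i. i < n \<Longrightarrow> \<not> comm_group (S i)"
    and fin: "finite (carrier (product_group {..<n} S))"
  shows "carrier (product_group {..<n} S) \<subseteq> layer (product_group {..<n} S)"
proof -
  define P where "P = product_group {..<n} S"
  have grp: "group (S i)" if "i < n" for i
    using S(1)[OF that] by (simp add: simple_group_def)
  have "group P" unfolding P_def by (rule product_group) (use grp in auto)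
  then interpret P: finite_group P
    using fin by (simp add: finite_group_def finite_group_axioms_def P_def)
  have carP: "carrier P = (\<Pi>\<^sub>E i\<in>{..<n}. carrier (S i))" by (simp add: P_def)
  have multP: "f \<otimes>\<^bsub>P\<^esub> g = (\<lambda>i\<in>{..<n}. f i \<otimes>\<^bsub>S i\<^esub> g i)" for f g by (simp add: P_def)
  have invP: "inv\<^bsub>P\<^esub> f = (\<lambda>i\<in>{..<n}. inv\<^bsub>S i\<^esub> f i)" if "f \<in> carrier P" for f
    unfolding P_def using that grp by (intro inv_product_group) (auto simp: carP)
  have oneP: "\<one>\<^bsub>P\<^esub> = (\<lambda>i\<in>{..<n}. \<one>\<^bsub>S i\<^esub>)" by (simp add: P_def)
  define sing where "sing i x = (\<lambda>j\<in>{..<n}. if j = i then x else \<one>\<^bsub>S j\<^esub>)" for i x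
  have one_mem: "\<one>\<^bsub>S j\<^esub> \<in> carrier (S j)" if "j < n" for j
    using grp[OF that] by (simp add: group.is_monoid monoid.one_closed)
  have sing_mem: "sing i x \<in> carrier P" if "i < n" "x \<in> carrier (S i)" for i x
    using that one_mem by (auto simp: carP sing_def)
  have sing_layer: "sing i x \<in> layer P" if i: "i < n" and x: "x \<in> carrier (S i)" for i x
  proof -
    interpret Si: group "S i" by (rule grp[OF i])
    have hom: "sing i \<in> hom (S i) P"
    proof (rule homI)
      fix x y assume "x \<in> carrier (S i)" "y \<in> carrier (S i)"
      then show "sing i (x \<otimes>\<^bsub>S i\<^esub> y) = sing i x \<otimes>\<^bsub>P\<^esub> sing i y"
        using grp by (auto simp: sing_def multP group.is_monoid monoid.l_one one_mem intro!: restrict_ext)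
    qed (rule sing_mem[OF i])
    then interpret s: group_hom "S i" P "sing i"
      by unfold_locales
    define F where "F = sing i ` carrier (S i)"
    have sF: "subgroup F P" unfolding F_def by (rule s.img_is_subgroup)
    have F: "F \<lhd> P"
    proof (rule P.normal_invI[OF sF])
      fix f g assume f: "f \<in> carrier P" and "g \<in> F"
      then obtain x where x: "x \<in> carrier (S i)" "g = sing i x" by (auto simp: F_def)
      have fi: "f j \<in> carrier (S j)" if "j < n" for j using f that by (auto simp: carP)
      have "f j \<otimes>\<^bsub>S j\<^esub> \<one>\<^bsub>S j\<^esub> \<otimes>\<^bsub>S j\<^esub> inv\<^bsub>S j\<^esub> f j = \<one>\<^bsub>S j\<^esub>" if "j < n" for j
      proof -
        interpret Sj: group "S j" by (rule grp[OF that])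
        show ?thesis using fi[OF that] by simp
      qed
      then have "f \<otimes>\<^bsub>P\<^esub> g \<otimes>\<^bsub>P\<^esub> inv\<^bsub>P\<^esub> f = sing i (f i \<otimes>\<^bsub>S i\<^esub> x \<otimes>\<^bsub>S i\<^esub> inv\<^bsub>S i\<^esub> f i)"
        using f i by (auto simp: multP invP x(2) sing_def intro!: restrict_ext)
      moreover have "f i \<otimes>\<^bsub>S i\<^esub> x \<otimes>\<^bsub>S i\<^esub> inv\<^bsub>S i\<^esub> f i \<in> carrier (S i)"
        using fi[OF i] x by simp
      ultimately show "f \<otimes>\<^bsub>P\<^esub> g \<otimes>\<^bsub>P\<^esub> inv\<^bsub>P\<^esub> f \<in> F" by (auto simp: F_def)
    qed
    interpret simp: simple_group "S i" by (rule S(1)[OF i])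
    have fS: "finite (carrier (S i))"
      using simp.order_gt_one by (metis Si.order_gt_0_iff_finite less_trans zero_less_one)
    have gF: "group (P\<lparr>carrier := F\<rparr>)"
      using sF by (rule P.subgroup_imp_group)
    have "sing i \<in> hom (S i) (P\<lparr>carrier := F\<rparr>)"
      using s.hom_mult by (auto simp: hom_def F_def)
    then interpret s': finite_surjective_hom "S i" "P\<lparr>carrier := F\<rparr>" "sing i"
      using gF fS Si.is_group
      by (intro finite_surjective_homI) (auto simp: F_def finite_group_def finite_group_axioms_def)
    have "carrier (P\<lparr>carrier := F\<rparr>) \<noteq> {\<one>\<^bsub>P\<lparr>carrier := F\<rparr>\<^esub>}"
    proof
      assume triv: "carrier (P\<lparr>carrier := F\<rparr>) = {\<one>\<^bsub>P\<lparr>carrier := F\<rparr>\<^esub>}"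
      have "x = \<one>\<^bsub>S i\<^esub>" if "x \<in> carrier (S i)" for x
      proof -
        have "sing i x = \<one>\<^bsub>P\<^esub>" using triv that by (auto simp: F_def)
        then have "sing i x i = \<one>\<^bsub>P\<^esub> i" by simp
        then show ?thesis using i by (simp add: sing_def oneP)
      qed
      then show False using simp.simple_not_triv Si.one_closed by blast
    qed
    then have "quasisimple_group (P\<lparr>carrier := F\<rparr>)"
      using s'.quasisimple_image simple_imp_quasisimple[OF S[OF i]] by blast
    then have "component P F"
      using P.normal_imp_subnormal[OF F] by (simp add: component_def)
    then show ?thesis
      using P.component_subset_layer x by (auto simp: F_def)
  qed
  have sL: "subgroup (layer P) P" by (rule normal_imp_subgroup[OF P.layer_normal])
  have "f \<in> layer P" if f: "f \<in> carrier P" for f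
  proof -
    have fj: "f j \<in> carrier (S j)" if "j < n" for j using f that by (auto simp: carP)
    \<comment> \<open>The first \<open>k\<close> coordinates of \<open>f\<close>, trivial elsewhere:
      each increment multiplies by an element of one more component, and \<open>part n\<close> is
      \<open>f\<close>.\<close>
    define part where "part k = (\<lambda>j\<in>{..<n}. if j < k then f j else \<one>\<^bsub>S j\<^esub>)" for k
    have "k \<le> n \<Longrightarrow> part k \<in> layer P" for k
    proof (induction k)
      case 0
      have "part 0 = \<one>\<^bsub>P\<^esub>" by (simp add: part_def oneP)
      then show ?case
        using subgroup.one_closed[OF sL] by simp
    next
      case (Suc k)
      have "part (Suc k) = part k \<otimes>\<^bsub>P\<^esub> sing k (f k)"
        unfolding part_def multP sing_def
      proof (rule restrict_ext)
        fix j assume "j \<in> {..<n}"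
        then have j: "j < n" by simp
        interpret Sj: group "S j" by (rule grp[OF j])
        consider "j < k" | "j = k" | "k < j" by linarith
        then show "(if j < Suc k then f j else \<one>\<^bsub>S j\<^esub>) =
          (\<lambda>j\<in>{..<n}. if j < k then f j else \<one>\<^bsub>S j\<^esub>) j \<otimes>\<^bsub>S j\<^esub>
          (\<lambda>j\<in>{..<n}. if j = k then f k else \<one>\<^bsub>S j\<^esub>) j"
          using j fj[OF j] Sj.l_one Sj.r_one Sj.one_closed by cases auto
      qed
      then show ?case
        using Suc sing_layer[of k "f k"] fj[of k] subgroup.m_closed[OF sL] by simp
    qed
    from this[of n] have "part n \<in> layer P" by simp
    moreover have "part n = f"
      using f by (auto simp: part_def carP PiE_def extensional_def restrict_def)
    ultimately show ?thesis by simp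
  qed
  then show ?thesis by (auto simp: P_def)
qed

lemma (in finite_surjective_hom) layer_image: "h ` layer G \<subseteq> layer H"
proof -
  interpret H: finite_group H by (rule codomain_finite_group)
  have sL: "subgroup (layer H) H" by (rule normal_imp_subgroup[OF H.layer_normal])
  have "layer G \<subseteq> {x \<in> carrier G. h x \<in> layer H}"
  proof (rule layer_subset[OF vimage_subgroup[OF sL]])
    fix K assume K: "component G K"
    then have "h ` K \<subseteq> layer H"
      using component_image[OF K] H.component_subset_layer[of "h ` K"] subgroup.one_closed[OF sL]
      by (elim disjE) simp_all
    then show "K \<subseteq> {x \<in> carrier G. h x \<in> layer H}"
      using subgroup.subset[OF component_subgroup[OF K]] by blast
  qed
  then show ?thesis by blast
qed

text \<open>Images of layers lie in layers, so the isomorphism transfers the result on product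
  groups. It is what places the odd factors of an arbitrary length series inside the generalized
  Fitting subgroup.\<close>

lemma (in finite_group) product_of_simple_layer:
  assumes "product_of_nonabelian_simple_groups G"
  shows "carrier G \<subseteq> layer G"
proof -
  obtain n and S :: "nat \<Rightarrow> 'a monoid" where
    S: "\<And>i. i < n \<Longrightarrow> simple_group (S i)" "\<And>i. i < n \<Longrightarrow> \<not> comm_group (S i)"
    and iso: "G \<cong> product_group {..<n} S"
    using assms by (auto simp: product_of_nonabelian_simple_groups_def)
  let ?P = "product_group {..<n} S"
  have "group ?P"
    by (rule product_group) (use S(1) in \<open>auto simp: simple_group_def\<close>)
  moreover have fin: "finite (carrier ?P)"
    using iso_finite[OF iso] finite_carrier by blast
  ultimately interpret P: finite_group ?P
    by (simp add: finite_group_def finite_group_axioms_def)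
  obtain \<psi> where "\<psi> \<in> iso ?P G"
    using iso iso_set_sym by (auto simp: is_iso_def)
  then have "\<psi> \<in> hom ?P G" "\<psi> ` carrier ?P = carrier G"
    by (auto simp: iso_iff)
  then interpret \<psi>: finite_surjective_hom ?P G \<psi>
    by (intro finite_surjective_homI P.finite_group_axioms is_group)
  show ?thesis
    using product_group_layer[OF S fin] \<psi>.layer_image \<psi>.surj by blast
qed

section \<open>Internal direct products, and F* of a group with trivial Fitting subgroup\<close>

primrec seq_prod :: "('a, 'b) monoid_scheme \<Rightarrow> (nat \<Rightarrow> 'a) \<Rightarrow> nat \<Rightarrow> 'a" where
  "seq_prod G f 0 = \<one>\<^bsub>G\<^esub>"
| "seq_prod G f (Suc n) = seq_prod G f n \<otimes>\<^bsub>G\<^esub> f n"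

text \<open>Centrelessness takes the place of conditions on intersections. If a product of one
  element from each of \<open>K 0\<close> to \<open>K m\<close> is trivial, its last factor is
  inverse to an element commuting with \<open>K m\<close>, so it is central in \<open>K m\<close>
  and hence trivial; this is \<open>seq_prod_one\<close>.\<close>

locale commuting_subgroups = group +
  fixes n :: nat and K :: "nat \<Rightarrow> 'a set"
  assumes subgroups: "i < n \<Longrightarrow> subgroup (K i) G"
    and commute: "\<lbrakk>i < n; j < n; i \<noteq> j; x \<in> K i; y \<in> K j\<rbrakk> \<Longrightarrow> x \<otimes> y = y \<otimes> x"
    and centerless: "\<lbrakk>i < n; z \<in> K i; \<And>x. x \<in> K i \<Longrightarrow> z \<otimes> x = x \<otimes> z\<rbrakk> \<Longrightarrow> z = \<one>"
begin

lemma seq_prod_closed: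
  assumes "\<And>i. i < m \<Longrightarrow> f i \<in> K i" "m \<le> n"
  shows "seq_prod G f m \<in> carrier G"
  using assms
proof (induction m)
  case (Suc m)
  then have "f m \<in> carrier G"
    using subgroup.mem_carrier[OF subgroups[of m]] by simp
  then show ?case using Suc by simp
qed simp

lemma seq_prod_commute:
  assumes "\<And>i. i < m \<Longrightarrow> f i \<in> K i" "m \<le> j" "j < n" "x \<in> K j"
  shows "seq_prod G f m \<otimes> x = x \<otimes> seq_prod G f m"
  using assms
proof (induction m)
  case 0
  then have "x \<in> carrier G"
    using subgroup.mem_carrier[OF subgroups[of j]] by simp
  then show ?case by simp
next
  case (Suc m)
  have c: "x \<in> carrier G" "f m \<in> carrier G" "seq_prod G f m \<in> carrier G"
    using Suc.prems subgroup.mem_carrier[OF subgroups[of j]] subgroup.mem_carrier[OF subgroups[of m]]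
      seq_prod_closed[of m f] by auto
  have "seq_prod G f (Suc m) \<otimes> x = seq_prod G f m \<otimes> (f m \<otimes> x)"
    using c by (simp add: m_assoc)
  also have "f m \<otimes> x = x \<otimes> f m"
    using commute[of m j] Suc.prems by auto
  also have "seq_prod G f m \<otimes> (x \<otimes> f m) = (seq_prod G f m \<otimes> x) \<otimes> f m"
    using c by (simp add: m_assoc)
  also have "seq_prod G f m \<otimes> x = x \<otimes> seq_prod G f m"
    using Suc by auto
  finally show ?case using c by (simp add: m_assoc)
qed

lemma seq_prod_mult:
  assumes "\<And>i. i < m \<Longrightarrow> f i \<in> K i" "\<And>i. i < m \<Longrightarrow> g i \<in> K i"
    "\<And>i. i < m \<Longrightarrow> e i = f i \<otimes> g i" "m \<le> n"
  shows "seq_prod G e m = seq_prod G f m \<otimes> seq_prod G g m"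
  using assms
proof (induction m)
  case (Suc m)
  have c: "f m \<in> carrier G" "g m \<in> carrier G" "seq_prod G f m \<in> carrier G" "seq_prod G g m \<in> carrier G"
    using Suc.prems subgroup.mem_carrier[OF subgroups[of m]]
      seq_prod_closed[of m f] seq_prod_closed[of m g] by auto
  have "seq_prod G e (Suc m) = seq_prod G f m \<otimes> (seq_prod G g m \<otimes> f m) \<otimes> g m"
    using Suc c by (simp add: m_assoc)
  also have "seq_prod G g m \<otimes> f m = f m \<otimes> seq_prod G g m"
    using seq_prod_commute[of m g m "f m"] Suc.prems by auto
  finally show ?case using c by (simp add: m_assoc)
qed simp

lemma seq_prod_one:
  assumes "\<And>i. i < m \<Longrightarrow> f i \<in> K i" "m \<le> n" "seq_prod G f m = \<one>" "i < m"
  shows "f i = \<one>"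
  using assms
proof (induction m)
  case (Suc m)
  have c: "f m \<in> carrier G" "seq_prod G f m \<in> carrier G"
    using Suc.prems subgroup.mem_carrier[OF subgroups[of m]] seq_prod_closed[of m f] by auto
  then have eq: "f m = inv (seq_prod G f m)"
    using Suc.prems(3) by (metis inv_equality inv_inv seq_prod.simps(2))
  have "f m = \<one>"
  proof (rule centerless)
    show "m < n" "f m \<in> K m" using Suc.prems by auto
    fix x assume x: "x \<in> K m"
    then have xc: "x \<in> carrier G"
      using Suc.prems subgroup.mem_carrier[OF subgroups[of m]] by simp
    have "seq_prod G f m \<otimes> x = x \<otimes> seq_prod G f m"
      using seq_prod_commute[of m f m x] Suc.prems x by auto
    then have "inv (seq_prod G f m) \<otimes> (seq_prod G f m \<otimes> x) \<otimes> inv (seq_prod G f m) =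
      inv (seq_prod G f m) \<otimes> (x \<otimes> seq_prod G f m) \<otimes> inv (seq_prod G f m)"
      by simp
    then show "f m \<otimes> x = x \<otimes> f m"
      using c xc by (simp add: eq m_assoc)
  qed
  moreover have "seq_prod G f m = \<one>"
    using Suc.prems(3) c \<open>f m = \<one>\<close> by simp
  ultimately show ?case
    using Suc.IH Suc.prems by (metis less_Suc_eq Suc_leD)
qed simp

lemma seq_prod_single:
  assumes "i < n" "x \<in> K i" "m \<le> n"
  shows "seq_prod G (\<lambda>j\<in>{..<n}. if j = i then x else \<one>) m = (if i < m then x else \<one>)"
proof -
  have x: "x \<in> carrier G"
    using subgroup.mem_carrier[OF subgroups[OF assms(1)] assms(2)] .
  show ?thesis
    using assms(3) by (induction m) (use x in auto)
qed

lemma generate_iso_product_group: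
  "G\<lparr>carrier := generate G (\<Union>i<n. K i)\<rparr> \<cong> product_group {..<n} (\<lambda>i. G\<lparr>carrier := K i\<rparr>)"
proof -
  let ?P = "product_group {..<n} (\<lambda>i. G\<lparr>carrier := K i\<rparr>)"
  let ?f = "\<lambda>f. seq_prod G f n"
  have gP: "group ?P"
    by (rule product_group) (use subgroups subgroup_imp_group in auto)
  have mem: "f i \<in> K i" if "f \<in> carrier ?P" "i < n" for f i
    using that by (auto simp: PiE_iff)
  have "?f \<in> hom ?P G"
  proof (rule homI)
    fix f g assume fg: "f \<in> carrier ?P" "g \<in> carrier ?P"
    then show "?f (f \<otimes>\<^bsub>?P\<^esub> g) = ?f f \<otimes> ?f g"
      using mem by (intro seq_prod_mult) auto
  qed (use seq_prod_closed mem in blast)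
  then interpret f: group_hom ?P G ?f
    using gP by (intro group_hom.intro group_hom_axioms.intro) (auto simp: is_group)
  have KG: "(\<Union>i<n. K i) \<subseteq> carrier G"
    using subgroup.subset[OF subgroups] by blast
  have im: "?f ` carrier ?P = generate G (\<Union>i<n. K i)"
  proof
    have sg: "subgroup (generate G (\<Union>i<n. K i)) G"
      by (rule generate_is_subgroup[OF KG])
    have "m \<le> n \<Longrightarrow> seq_prod G f m \<in> generate G (\<Union>i<n. K i)" if f: "f \<in> carrier ?P" for f m
    proof (induction m)
      case (Suc m)
      have "f m \<in> generate G (\<Union>i<n. K i)"
        using mem[OF f, of m] Suc.prems by (intro generate.incl) auto
      then show ?case
        using Suc subgroup.m_closed[OF sg] by simp
    qed (use subgroup.one_closed[OF sg] in simp)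
    then show "?f ` carrier ?P \<subseteq> generate G (\<Union>i<n. K i)" by blast
    have "K i \<subseteq> ?f ` carrier ?P" if i: "i < n" for i
    proof
      fix x assume x: "x \<in> K i"
      let ?s = "\<lambda>j\<in>{..<n}. if j = i then x else \<one>"
      have s: "?s \<in> carrier ?P"
        using x subgroup.one_closed[OF subgroups] by auto
      have "x = ?f ?s"
        using seq_prod_single[OF i x, of n] i by simp
      from image_eqI[of x ?f, OF this s] show "x \<in> ?f ` carrier ?P" .
    qed
    then show "generate G (\<Union>i<n. K i) \<subseteq> ?f ` carrier ?P"
      by (intro generate_subgroup_incl f.img_is_subgroup) blast
  qed
  have "inj_on ?f (carrier ?P)"
    unfolding f.inj_on_one_iff
  proof (intro allI impI)
    fix f assume f: "f \<in> carrier ?P" "?f f = \<one>"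
    then have "f i = \<one>" if "i < n" for i
      using seq_prod_one[of n f i] mem that by auto
    then show "f = \<one>\<^bsub>?P\<^esub>"
      using f by (auto simp: PiE_iff extensional_def fun_eq_iff)
  qed
  moreover have "?f \<in> hom ?P (G\<lparr>carrier := generate G (\<Union>i<n. K i)\<rparr>)"
    using f.homh im by (auto simp: hom_def)
  ultimately have "?f \<in> iso ?P (G\<lparr>carrier := generate G (\<Union>i<n. K i)\<rparr>)"
    using im by (simp add: iso_iff)
  then show ?thesis
    using gP group.iso_sym is_isoI by blast
qed

end

text \<open>Subnormal nilpotent subgroups of \<open>G\<close> are trivial, in particular abelian
  normal subgroups of \<open>K\<close>; and proper normal subgroups of \<open>K\<close> are central,
  hence abelian. The third claim supplies \<open>centerless\<close> for
  \<open>commuting_subgroups\<close>.\<close>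

lemma (in finite_group) component_simple:
  assumes F: "fitting_subgroup G = {\<one>}" and K: "component G K"
  shows "simple_group (G\<lparr>carrier := K\<rparr>)" and "\<not> comm_group (G\<lparr>carrier := K\<rparr>)"
    and "\<lbrakk>z \<in> K; \<And>x. x \<in> K \<Longrightarrow> z \<otimes> x = x \<otimes> z\<rbrakk> \<Longrightarrow> z = \<one>"
proof -
  have sK: "subgroup K G" using K by (rule component_subgroup)
  interpret K: finite_group "G\<lparr>carrier := K\<rparr>"
    by (rule finite_group_restrict[OF finite_group_axioms sK])
  have sn: "subnormal G K" using K by (simp add: component_def)
  have nontriv: "K \<noteq> {\<one>}" using K by (rule component_nontrivial)
  have perfect: "derived (G\<lparr>carrier := K\<rparr>) K = K" using K by (rule component_perfect)
  have abelian: "N = {\<one>}"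
    if N: "N \<lhd> G\<lparr>carrier := K\<rparr>" "\<And>n m. n \<in> N \<Longrightarrow> m \<in> N \<Longrightarrow> n \<otimes> m = m \<otimes> n" for N
  proof -
    have sN: "subgroup N G" using N normal_restrict_iff[OF sK] by blast
    interpret N: finite_group "G\<lparr>carrier := N\<rparr>"
      by (rule finite_group_restrict[OF finite_group_axioms sN])
    have "n \<otimes> m \<otimes> inv n \<otimes> inv m = \<one>" if "n \<in> N" "m \<in> N" for n m
      using that N(2) commutator_one_iff[of n m] subgroup.mem_carrier[OF sN] by blast
    then have "nilpotent_group (G\<lparr>carrier := N\<rparr>)"
      using subgroup.one_closed[OF normal_imp_subgroup[OF N.group_center_normal]]
      by (intro N.nilpotent_of_central_commutators) (simp add: m_inv_consistent[OF sN])
    then have "N \<subseteq> fitting_subgroup G"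
      by (intro subnormal_nilpotent_subset_fitting subnormal.step[OF sn N(1)])
    then show ?thesis using F subgroup.one_closed[OF sN] by blast
  qed
  show nab: "\<not> comm_group (G\<lparr>carrier := K\<rparr>)"
  proof
    assume "comm_group (G\<lparr>carrier := K\<rparr>)"
    then interpret C: comm_group "G\<lparr>carrier := K\<rparr>" .
    have "n \<otimes> m = m \<otimes> n" if "n \<in> K" "m \<in> K" for n m
      using C.m_comm[of n m] that by simp
    then have "K = {\<one>}"
      using abelian[of K] K.carrier_normal by simp
    then show False using nontriv by simp
  qed
  have central: "N = K \<or> N = {\<one>}" if N: "N \<lhd> G\<lparr>carrier := K\<rparr>" for N
  proof (cases "N = K")
    case False
    have "N \<subseteq> K" using N normal_restrict_iff[OF sK] by blast
    then have "n \<otimes> m = m \<otimes> n" if "n \<in> N" "m \<in> N" for n m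
      using component_normal_subgroup[OF K N False, of n m] that by blast
    then show ?thesis using abelian[OF N] by blast
  qed simp
  show "simple_group (G\<lparr>carrier := K\<rparr>)"
  proof (intro simple_group.intro simple_group_axioms.intro)
    show "group (G\<lparr>carrier := K\<rparr>)" by (rule K.is_group)
    have "card K \<noteq> 1"
    proof
      assume "card K = 1"
      then obtain x where "K = {x}" by (rule card_1_singletonE)
      then show False using nontriv subgroup.one_closed[OF sK] by blast
    qed
    then show "1 < order (G\<lparr>carrier := K\<rparr>)"
      using card_subgroup_pos[OF sK] by (simp add: order_def)
    show "H = carrier (G\<lparr>carrier := K\<rparr>) \<or> H = {\<one>\<^bsub>G\<lparr>carrier := K\<rparr>\<^esub>}" if "H \<lhd> G\<lparr>carrier := K\<rparr>" for H
      using central[OF that] by simp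
  qed
  assume z: "z \<in> K" "\<And>x. x \<in> K \<Longrightarrow> z \<otimes> x = x \<otimes> z"
  let ?Z = "group_center (G\<lparr>carrier := K\<rparr>)"
  have "?Z = {\<one>}"
  proof (rule abelian[OF K.group_center_normal])
    fix n m assume "n \<in> ?Z" "m \<in> ?Z"
    then have "n \<otimes>\<^bsub>G\<lparr>carrier := K\<rparr>\<^esub> m = m \<otimes>\<^bsub>G\<lparr>carrier := K\<rparr>\<^esub> n"
      unfolding group_center_def by blast
    then show "n \<otimes> m = m \<otimes> n" by simp
  qed
  moreover have "z \<in> ?Z" unfolding group_center_def using z by simp
  ultimately show "z = \<one>" by blast
qed

text \<open>With trivial Fitting subgroup only the layer remains, and its components are simple and
  commute pairwise. \<open>G\<close> is a plain \<open>monoid\<close> because the definition of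
  these products takes its factors from that type; quotient groups have it.\<close>

lemma Fs_product_of_simple:
  fixes G :: "'a monoid"
  assumes "finite_group G" and F: "fitting_subgroup G = {\<one>\<^bsub>G\<^esub>}" and nontriv: "carrier G \<noteq> {\<one>\<^bsub>G\<^esub>}"
  shows "product_of_nonabelian_simple_groups (G\<lparr>carrier := generalized_fitting_subgroup G\<rparr>)"
proof -
  interpret finite_group G by fact
  have sL: "subgroup (layer G) G" by (rule normal_imp_subgroup[OF layer_normal])
  have layer: "generalized_fitting_subgroup G = layer G"
    unfolding generalized_fitting_subgroup_def F
    using subset_set_mult_right[OF triv_subgroup subgroup.subset[OF sL]]
      set_mult_least[OF sL, of "{\<one>\<^bsub>G\<^esub>}" "layer G"] subgroup.one_closed[OF sL] by blast
  let ?C = "{K. component G K}"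
  have "?C \<subseteq> Pow (carrier G)"
    using subgroup.subset[OF component_subgroup] by blast
  then have "finite ?C"
    using finite_carrier finite_subset by blast
  then obtain e where e: "bij_betw e {0..<card ?C} ?C"
    using ex_bij_betw_nat_finite by blast
  define n where "n = card ?C"
  have e_mem: "component G (e i)" if "i < n" for i
    using e that by (auto simp: bij_betw_def n_def)
  have e_inj: "e i \<noteq> e j" if "i < n" "j < n" "i \<noteq> j" for i j
    using e that by (auto simp: bij_betw_def inj_on_def n_def)
  have e_im: "(\<Union>i<n. e i) = \<Union>?C"
    using e by (auto simp: bij_betw_def n_def atLeast0LessThan)
  \<comment> \<open>The product has to be non-empty. Without components F* would be trivial, and so
    would the group.\<close>
  have "n \<noteq> 0"
  proof
    assume "n = 0"
    then have "\<Union>?C = {}" using e_im by blast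
    then have "layer G = {\<one>\<^bsub>G\<^esub>}" by (simp only: layer_def generate_empty)
    then have "Fs = {\<one>\<^bsub>G\<^esub>}"
      using layer subgroup.one_closed[OF Fs_subgroup] by blast
    then show False using Fs_nontrivial nontriv by blast
  qed
  interpret commuting_subgroups G n e
  proof (rule commuting_subgroups.intro[OF is_group commuting_subgroups_axioms.intro])
    fix i assume i: "i < n"
    show "subgroup (e i) G" by (rule component_subgroup[OF e_mem[OF i]])
    show "z = \<one>\<^bsub>G\<^esub>" if "z \<in> e i" "\<And>x. x \<in> e i \<Longrightarrow> z \<otimes>\<^bsub>G\<^esub> x = x \<otimes>\<^bsub>G\<^esub> z" for z
      using component_simple(3)[OF F e_mem[OF i]] that by blast
    fix j x y assume j: "j < n" "i \<noteq> j" and xy: "x \<in> e i" "y \<in> e j"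
    have "e i \<subseteq> e j \<or> (\<forall>k\<in>e i. \<forall>u\<in>e j. k \<otimes>\<^bsub>G\<^esub> u = u \<otimes>\<^bsub>G\<^esub> k)"
      using component_subnormal_cases[OF e_mem[OF i]] e_mem[OF j(1)] by (simp add: component_def)
    moreover have "e j \<subseteq> e i \<or> (\<forall>k\<in>e j. \<forall>u\<in>e i. k \<otimes>\<^bsub>G\<^esub> u = u \<otimes>\<^bsub>G\<^esub> k)"
      using component_subnormal_cases[OF e_mem[OF j(1)]] e_mem[OF i] by (simp add: component_def)
    \<comment> \<open>Distinct components cannot contain each other mutually, so one of the two
      alternatives above yields commutation.\<close>
    moreover have "\<not> (e i \<subseteq> e j \<and> e j \<subseteq> e i)" using e_inj[OF i j] by blast
    ultimately show "x \<otimes>\<^bsub>G\<^esub> y = y \<otimes>\<^bsub>G\<^esub> x" using xy by metis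
  qed
  have "G\<lparr>carrier := layer G\<rparr> \<cong> product_group {..<n} (\<lambda>i. G\<lparr>carrier := e i\<rparr>)"
    using generate_iso_product_group by (simp add: e_im layer_def)
  then show ?thesis
    unfolding layer product_of_nonabelian_simple_groups_def
    using component_simple(1,2)[OF F e_mem] \<open>n \<noteq> 0\<close>
    by (intro exI[of _ n] exI[of _ "\<lambda>i. G\<lparr>carrier := e i\<rparr>"]) simp
qed

subsection \<open>Series defined by iterated radicals\<close>

text \<open>The composite of M -> G -> G/L is trivial on \<open>K\<close> and onto because
  \<open>L\<close> and \<open>M\<close> generate \<open>G\<close>. The case where \<open>M\<close>
  is all of \<open>G\<close> is used too, to compare two quotients of \<open>G\<close>.\<close>

lemma (in finite_group) quotient_map:
  assumes sM: "subgroup M G" and K: "K \<lhd> G\<lparr>carrier := M\<rparr>" and L: "L \<lhd> G" and KL: "K \<subseteq> L"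
    and cover: "L <#> M = carrier G"
  obtains \<theta> where "finite_surjective_hom (G\<lparr>carrier := M\<rparr> Mod K) (G Mod L) \<theta>"
    "\<And>x. x \<in> M \<Longrightarrow> \<theta> (K #> x) = L #> x"
proof -
  interpret L: normal L G by fact
  interpret M: finite_group "G\<lparr>carrier := M\<rparr>"
    by (rule finite_group_restrict[OF finite_group_axioms sM])
  interpret K: normal K "G\<lparr>carrier := M\<rparr>" by (rule K)
  interpret qL: finite_surjective_hom G "G Mod L" "\<lambda>x. L #> x"
    by (rule coset_map_hom[OF L])
  interpret qM: group_hom "G\<lparr>carrier := M\<rparr>" "G Mod L" "\<lambda>x. L #> x"
    by (rule qL.induced_group_hom'[OF sM])
  have MG: "M \<subseteq> carrier G" using subgroup.subset[OF sM] .
  have "K \<subseteq> kernel (G\<lparr>carrier := M\<rparr>) (G Mod L) (\<lambda>x. L #> x)"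
    using KL K.subset L.rcos_const[OF is_group] by (auto simp: kernel_def)
  then obtain \<theta> where \<theta>: "\<theta> \<in> hom (G\<lparr>carrier := M\<rparr> Mod K) (G Mod L)"
    "\<And>x. x \<in> carrier (G\<lparr>carrier := M\<rparr>) \<Longrightarrow> \<theta> (K #>\<^bsub>G\<lparr>carrier := M\<rparr>\<^esub> x) = L #> x"
    using qM.FactGroup_universal_kernel[OF K] by blast
  have "\<theta> ` carrier (G\<lparr>carrier := M\<rparr> Mod K) = carrier (G Mod L)"
  proof
    show "\<theta> ` carrier (G\<lparr>carrier := M\<rparr> Mod K) \<subseteq> carrier (G Mod L)"
      using \<theta>(1) by (rule hom_carrier)
    show "carrier (G Mod L) \<subseteq> \<theta> ` carrier (G\<lparr>carrier := M\<rparr> Mod K)"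
    proof
      fix y assume "y \<in> carrier (G Mod L)"
      then obtain g where g: "g \<in> carrier G" "y = L #> g" by (auto simp: carrier_FactGroup)
      then have "g \<in> L <#> M" using cover by simp
      then obtain l m where lm: "l \<in> L" "m \<in> M" "g = l \<otimes> m"
        by (auto simp: set_mult_def)
      then have "y = (L #> l) #> m"
        using g MG L.subset by (subst coset_mult_assoc) auto
      then have "y = \<theta> (K #> m)"
        using lm \<theta>(2)[of m] L.rcos_const[OF is_group] by simp
      then show "y \<in> \<theta> ` carrier (G\<lparr>carrier := M\<rparr> Mod K)"
        using lm by (auto simp: carrier_FactGroup)
    qed
  qed
  then have "finite_surjective_hom (G\<lparr>carrier := M\<rparr> Mod K) (G Mod L) \<theta>"
    using \<theta>(1) K.factorgroup_is_group L.factorgroup_is_group K.finite_Mod[OF M.finite_carrier]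
    by (intro finite_surjective_homI) (auto simp: finite_group_def finite_group_axioms_def)
  then show ?thesis using that \<theta>(2) by simp
qed

text \<open>The radical is only ever applied to quotients, hence its type over sets. Its index lets
  it vary from step to step: constant for the height, alternating for the length.\<close>

primrec radical_series ::
    "(nat \<Rightarrow> 'a set monoid \<Rightarrow> 'a set set) \<Rightarrow> ('a, 'b) monoid_scheme \<Rightarrow> nat \<Rightarrow> 'a set" where
  "radical_series \<gamma> G 0 = {\<one>\<^bsub>G\<^esub>}"
| "radical_series \<gamma> G (Suc i) =
     {x \<in> carrier G. radical_series \<gamma> G i #>\<^bsub>G\<^esub> x \<in> \<gamma> i (G Mod radical_series \<gamma> G i)}"

declare radical_series.simps(2) [simp del]

lemmas radical_series_Suc = radical_series.simps(2)

text \<open>Both series fit these axioms. In the alternating one the same radical recurs after two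
  steps, whence the shift in \<open>\<gamma>_image\<close>; and a trivial p-soluble radical alone
  does not force a trivial group, whence two consecutive radicals in
  \<open>\<gamma>_trivial\<close>.\<close>

locale radicals =
  fixes \<gamma> :: "nat \<Rightarrow> 'a set monoid \<Rightarrow> 'a set set"
  assumes \<gamma>_normal: "finite_group Q \<Longrightarrow> \<gamma> i Q \<lhd> Q"
    and \<gamma>_image: "finite_surjective_hom Q Q' h \<Longrightarrow> h ` \<gamma> i Q \<subseteq> \<gamma> (Suc (Suc i)) Q'"
    and \<gamma>_trivial: "\<lbrakk>finite_group Q; \<gamma> i Q = {\<one>\<^bsub>Q\<^esub>}; \<gamma> (Suc i) Q = {\<one>\<^bsub>Q\<^esub>}\<rbrakk>
      \<Longrightarrow> carrier Q = {\<one>\<^bsub>Q\<^esub>}"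

locale finite_group_radicals = finite_group G + radicals \<gamma>
  for G :: "('a, 'b) monoid_scheme" (structure) and \<gamma> :: "nat \<Rightarrow> 'a set monoid \<Rightarrow> 'a set set"
begin

abbreviation W where "W \<equiv> radical_series \<gamma> G"

lemma finite_group_Mod: "K \<lhd> G \<Longrightarrow> finite_group (G Mod K)"
  using finite_surjective_hom.codomain_finite_group[OF coset_map_hom] .

lemma series_normal: "W i \<lhd> G"
proof (induction i)
  case (Suc i)
  interpret q: finite_surjective_hom G "G Mod W i" "\<lambda>x. W i #> x"
    by (rule coset_map_hom[OF Suc])
  show ?case
    using q.vimage_normal[OF \<gamma>_normal[OF finite_group_Mod[OF Suc]], of i]
    by (simp add: radical_series_Suc)
qed (simp add: one_is_normal)

lemma series_subgroup: "subgroup (W i) G"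
  by (rule normal_imp_subgroup[OF series_normal])

lemma coset_in_radical_iff:
  "x \<in> carrier G \<Longrightarrow> W i #> x \<in> \<gamma> i (G Mod W i) \<longleftrightarrow> x \<in> W (Suc i)"
  by (simp add: radical_series_Suc)

lemma radical_subset_carrier: "\<gamma> i (G Mod W i) \<subseteq> carrier (G Mod W i)"
  by (rule subgroup.subset[OF normal_imp_subgroup[OF \<gamma>_normal[OF finite_group_Mod[OF series_normal]]]])

lemma radical_eq_image: "\<gamma> i (G Mod W i) = (\<lambda>x. W i #> x) ` W (Suc i)"
  using radical_subset_carrier[of i] by (auto simp: carrier_FactGroup radical_series_Suc)

lemma series_Suc_mono: "W i \<subseteq> W (Suc i)"
proof
  interpret N: normal "W i" G by (rule series_normal)
  fix x assume x: "x \<in> W i"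
  then have "W i #> x = \<one>\<^bsub>G Mod W i\<^esub>"
    using N.rcos_const[OF is_group] by simp
  moreover have "\<one>\<^bsub>G Mod W i\<^esub> \<in> \<gamma> i (G Mod W i)"
    by (rule subgroup.one_closed[OF normal_imp_subgroup[OF \<gamma>_normal[OF finite_group_Mod[OF series_normal]]]])
  ultimately show "x \<in> W (Suc i)"
    using x by (simp add: radical_series_Suc)
qed

lemma series_mono: "i \<le> j \<Longrightarrow> W i \<subseteq> W j"
  by (rule lift_Suc_mono_le[of W]) (rule series_Suc_mono)

text \<open>A single p-soluble step may be idle, so one repetition would prove nothing; two in a row
  make both radicals of the quotient by \<open>W i\<close> trivial.\<close>

lemma series_stable:
  assumes "W (Suc (Suc i)) = W i"
  shows "W i = carrier G"
proof -
  interpret N: normal "W i" G by (rule series_normal)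
  have eq: "W (Suc i) = W i"
    using assms series_Suc_mono[of i] series_Suc_mono[of "Suc i"] by blast
  have triv: "(\<lambda>x. W i #> x) ` W i = {\<one>\<^bsub>G Mod W i\<^esub>}"
  proof -
    have "(\<lambda>x. W i #> x) ` W i = (\<lambda>x. W i) ` W i"
      by (intro image_cong refl N.rcos_const is_group)
    then show ?thesis by (simp add: image_constant[OF N.one_closed])
  qed
  have a: "\<gamma> i (G Mod W i) = {\<one>\<^bsub>G Mod W i\<^esub>}"
    using radical_eq_image[of i] triv eq by simp
  have b: "\<gamma> (Suc i) (G Mod W i) = {\<one>\<^bsub>G Mod W i\<^esub>}"
    using radical_eq_image[of "Suc i"] triv eq assms by metis
  have "carrier (G Mod W i) = {\<one>\<^bsub>G Mod W i\<^esub>}"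
    by (rule \<gamma>_trivial[OF finite_group_Mod[OF series_normal] a b])
  then show ?thesis
    using N.fact_group_trivial_iff[OF finite_carrier] by blast
qed

lemma series_reaches_carrier: "\<exists>m. W m = carrier G"
proof (rule ccontr)
  assume never: "\<nexists>m. W m = carrier G"
  have "W i \<subset> W (Suc (Suc i))" for i
    using series_stable[of i] never series_mono[of i "Suc (Suc i)"] by auto
  then have step: "card (W i) < card (W (Suc (Suc i)))" for i
    by (rule psubset_card_mono[OF finite_subgroup[OF series_subgroup]])
  \<comment> \<open>Every pair of steps raises the order by at least one.\<close>
  have "k \<le> card (W (2 * k))" for k
  proof (induction k)
    case (Suc k)
    then show ?case using step[of "2 * k"] by simp
  qed simp
  from this[of "Suc (card (carrier G))"]
  have "card (carrier G) < card (W (2 * Suc (card (carrier G))))" by simp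
  moreover have "card (W i) \<le> card (carrier G)" for i
    by (rule card_mono[OF finite_carrier subgroup.subset[OF series_subgroup]])
  ultimately show False using leD by blast
qed

text \<open>
  \<open>\<theta>\<close> is the natural map \<open>M/M\<^sub>c \<rightarrow> G/W\<^sub>c\<^sub>+\<^sub>2\<close>, surjective because \<open>M W\<^sub>c\<^sub>+\<^sub>2 = G\<close>.
\<close>
lemma series_shift_step:
  assumes sM: "subgroup M G" and cover: "W (Suc (Suc c)) <#> M = carrier G"
    and le: "radical_series \<gamma> (G\<lparr>carrier := M\<rparr>) c \<subseteq> W (Suc (Suc c))"
  shows "radical_series \<gamma> (G\<lparr>carrier := M\<rparr>) (Suc c) \<subseteq> W (Suc (Suc (Suc c)))"
proof
  interpret M: finite_group_radicals "G\<lparr>carrier := M\<rparr>" \<gamma>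
    using finite_group_restrict[OF finite_group_axioms sM] radicals_axioms
    by (rule finite_group_radicals.intro)
  obtain \<theta> where \<theta>: "finite_surjective_hom (G\<lparr>carrier := M\<rparr> Mod M.W c) (G Mod W (Suc (Suc c))) \<theta>"
    and \<theta>_coset: "\<And>x. x \<in> M \<Longrightarrow> \<theta> (M.W c #> x) = W (Suc (Suc c)) #> x"
    using quotient_map[OF sM M.series_normal series_normal le cover] by blast
  fix x assume "x \<in> M.W (Suc c)"
  then have x: "x \<in> M" "M.W c #> x \<in> \<gamma> c (G\<lparr>carrier := M\<rparr> Mod M.W c)"
    by (auto simp: radical_series_Suc)
  then have "W (Suc (Suc c)) #> x \<in> \<gamma> (Suc (Suc c)) (G Mod W (Suc (Suc c)))"
    using \<gamma>_image[OF \<theta>, of c] \<theta>_coset[OF x(1)] by force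
  moreover have "x \<in> carrier G" using x subgroup.subset[OF sM] by blast
  ultimately show "x \<in> W (Suc (Suc (Suc c)))"
    using coset_in_radical_iff by blast
qed

text \<open>The particular radicals enter only through \<open>step\<close>, so this serves the
  height and the length alike. The ranges of agreement and of covering fit together because c >= k -
  1 gives c + 2 >= k + 1.\<close>

theorem series_maximal_subgroup:
  assumes max: "maximal_subgroup M G"
    and step: "\<And>i. \<lbrakk>radical_series \<gamma> (G\<lparr>carrier := M\<rparr>) i = W i; W (Suc (Suc i)) \<subseteq> M\<rbrakk>
      \<Longrightarrow> radical_series \<gamma> (G\<lparr>carrier := M\<rparr>) (Suc i) = W (Suc i)"
    and m: "radical_series \<gamma> (G\<lparr>carrier := M\<rparr>) m = M"
  shows "W (Suc (Suc m)) = carrier G"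
proof -
  have sM: "subgroup M G" and Mne: "M \<noteq> carrier G"
    and maxM: "\<And>H. subgroup H G \<Longrightarrow> M \<subseteq> H \<Longrightarrow> H = M \<or> H = carrier G"
    using max by (auto simp: maximal_subgroup_def)
  have MG: "M \<subseteq> carrier G" using subgroup.subset[OF sM] .
  interpret M: finite_group_radicals "G\<lparr>carrier := M\<rparr>" \<gamma>
    using finite_group_restrict[OF finite_group_axioms sM] radicals_axioms
    by (rule finite_group_radicals.intro)
  obtain t where t: "W t = carrier G" using series_reaches_carrier ..
  have "\<exists>k. W k \<subseteq> M \<and> \<not> W (Suc k) \<subseteq> M"
  proof (rule ccontr)
    assume "\<nexists>k. W k \<subseteq> M \<and> \<not> W (Suc k) \<subseteq> M"
    then have "W k \<subseteq> M" for k
      by (induction k) (use subgroup.one_closed[OF sM] in auto)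
    then show False using t Mne MG by blast
  qed
  then obtain k where k: "W k \<subseteq> M" "\<not> W (Suc k) \<subseteq> M" by blast
  \<comment> \<open>For k = 0 truncated subtraction yields the index 0, where both series are
    trivial.\<close>
  have agree: "i \<le> k - 1 \<Longrightarrow> M.W i = W i" for i
  proof (induction i)
    case (Suc i)
    then have "W (Suc (Suc i)) \<subseteq> W k" by (intro series_mono) auto
    then show ?case using Suc k step by auto
  qed simp
  have cover: "W j <#> M = carrier G" if "Suc k \<le> j" for j
  proof -
    have "subgroup (W j <#> M) G" by (rule mult_norm_subgroup[OF series_normal sM])
    moreover have "M \<subseteq> W j <#> M" by (rule subset_set_mult_right[OF series_subgroup MG])
    moreover have "W (Suc k) \<subseteq> W j <#> M"
      using subset_set_mult_left[OF sM subgroup.subset[OF series_subgroup[of j]]] series_mono[OF that]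
      by blast
    ultimately show ?thesis using maxM k(2) by blast
  qed
  have lag: "M.W c \<subseteq> W (Suc (Suc c))" if "k - 1 \<le> c" for c
    using that
  proof (induction c rule: dec_induct)
    case base
    then show ?case using agree[of "k - 1"] series_mono[of "k - 1" "Suc (Suc (k - 1))"] by auto
  next
    case (step c)
    then show ?case by (intro series_shift_step sM cover) auto
  qed
  show ?thesis
  proof (cases "k - 1 \<le> m")
    case True
    then have "M \<subseteq> W (Suc (Suc m))" using lag m by metis
    moreover have "W (Suc (Suc m)) <#> M = carrier G" using True by (intro cover) simp
    ultimately show ?thesis
      using set_mult_least[OF series_subgroup, of "W (Suc (Suc m))" "Suc (Suc m)" M]
        subgroup.subset[OF series_subgroup] by blast
  next
    \<comment> \<open>Here the series of \<open>M\<close> ends inside the range of agreement: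
      \<open>W m\<close> is \<open>M\<close>, and \<open>W\<close> stays within \<open>M\<close> up
      to index \<open>k\<close>, so it is stationary from \<open>m\<close> to m + 2 and
      \<open>series_stable\<close> applies.\<close>
    case False
    then have "W m = M" using agree m by simp
    moreover have "W (Suc (Suc m)) \<subseteq> W k" using False by (intro series_mono) simp
    ultimately have "W (Suc (Suc m)) = W m"
      using k(1) series_mono[of m "Suc (Suc m)"] by auto
    then show ?thesis using series_stable by metis
  qed
qed

text \<open>
  The commutator hypothesis gives \<open>[M\<^sub>i\<^sub>+\<^sub>1, W\<^sub>i\<^sub>+\<^sub>2] \<subseteq> W\<^sub>i\<^sub>+\<^sub>1\<close>, and \<open>W\<^sub>i\<^sub>+\<^sub>2/W\<^sub>i\<^sub>+\<^sub>1\<close> contains its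
  centralizer in \<open>G/W\<^sub>i\<^sub>+\<^sub>1\<close>.
\<close>
lemma series_step:
  assumes sM: "subgroup M G" and eq: "radical_series \<gamma> (G\<lparr>carrier := M\<rparr>) i = W i"
    and N: "W (Suc (Suc i)) \<subseteq> M"
    and Fs: "\<And>Q. finite_group Q \<Longrightarrow> \<gamma> (Suc i) Q = generalized_fitting_subgroup Q"
    and comm: "\<And>Q H N. \<lbrakk>finite_group Q; subgroup H Q; N \<lhd> Q; N \<subseteq> H\<rbrakk>
      \<Longrightarrow> \<gamma> i (Q\<lparr>carrier := H\<rparr>) \<subseteq> section_centralizer Q N (\<gamma> i Q)"
    and down: "\<And>Q H N. \<lbrakk>finite_group Q; subgroup H Q; N \<lhd> Q; N \<subseteq> H; \<gamma> i (Q\<lparr>carrier := H\<rparr>) \<subseteq> N\<rbrakk>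
      \<Longrightarrow> \<gamma> i (Q\<lparr>carrier := H\<rparr>) \<subseteq> \<gamma> i Q"
    and up: "\<And>Q H. \<lbrakk>finite_group Q; subgroup H Q; \<gamma> i Q \<subseteq> H\<rbrakk> \<Longrightarrow> \<gamma> i Q \<subseteq> \<gamma> i (Q\<lparr>carrier := H\<rparr>)"
  shows "radical_series \<gamma> (G\<lparr>carrier := M\<rparr>) (Suc i) = W (Suc i)"
proof -
  interpret M: finite_group_radicals "G\<lparr>carrier := M\<rparr>" \<gamma>
    using finite_group_restrict[OF finite_group_axioms sM] radicals_axioms
    by (rule finite_group_radicals.intro)
  define R S N T where "R = W i" and "S = W (Suc i)" and "N = W (Suc (Suc i))" and "T = M.W (Suc i)"
  have nR: "R \<lhd> G" and nS: "S \<lhd> G" and nN: "N \<lhd> G"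
    unfolding R_def S_def N_def by (rule series_normal)+
  have RS: "R \<subseteq> S" and SN: "S \<subseteq> N"
    unfolding R_def S_def N_def by (rule series_Suc_mono)+
  have NM: "N \<subseteq> M" using assms(3) by (simp add: N_def)
  have MG: "M \<subseteq> carrier G" using subgroup.subset[OF sM] .
  let ?Q = "G Mod R" and ?\<pi> = "\<lambda>x. R #> x" and ?P = "G Mod S" and ?\<rho> = "\<lambda>x. S #> x"
  interpret \<pi>: finite_surjective_hom G ?Q ?\<pi> by (rule coset_map_hom[OF nR])
  interpret \<rho>: finite_surjective_hom G ?P ?\<rho> by (rule coset_map_hom[OF nS])
  interpret Q: finite_group ?Q by (rule \<pi>.codomain_finite_group)
  interpret P: finite_group ?P by (rule \<rho>.codomain_finite_group)
  interpret S: normal S G by (rule nS)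
  let ?M = "?\<pi> ` M" and ?N = "?\<pi> ` N"
  have QM: "G\<lparr>carrier := M\<rparr> Mod R = ?Q\<lparr>carrier := ?M\<rparr>" by (rule restrict_Mod_eq)
  have sM': "subgroup ?M ?Q" by (rule \<pi>.subgroup_img_is_subgroup[OF sM])
  have nN': "?N \<lhd> ?Q" by (rule \<pi>.image_normal[OF nN])
  have NM': "?N \<subseteq> ?M" using NM by blast
  have S_iff: "?\<pi> x \<in> \<gamma> i ?Q \<longleftrightarrow> x \<in> S" if "x \<in> carrier G" for x
    unfolding R_def S_def by (rule coset_in_radical_iff[OF that])
  have S_im: "\<gamma> i ?Q = ?\<pi> ` S"
    using radical_eq_image[of i] by (simp only: R_def S_def)
  have N_iff: "?\<rho> x \<in> generalized_fitting_subgroup ?P \<longleftrightarrow> x \<in> N" if "x \<in> carrier G" for x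
    using coset_in_radical_iff[OF that, of "Suc i"] Fs[OF P.finite_group_axioms]
    by (simp only: S_def N_def)
  have N_im: "generalized_fitting_subgroup ?P = ?\<rho> ` N"
    using radical_eq_image[of "Suc i"] Fs[OF P.finite_group_axioms] by (simp only: S_def N_def)
  have T_im: "\<gamma> i (?Q\<lparr>carrier := ?M\<rparr>) = ?\<pi> ` T"
    using M.radical_eq_image[of i] by (simp add: eq QM flip: R_def T_def)
  have TM: "T \<subseteq> M" unfolding T_def using subgroup.subset[OF M.series_subgroup[of "Suc i"]] by simp
  have T_comm: "x \<otimes> n \<otimes> inv x \<otimes> inv n \<in> S" if x: "x \<in> T" and n: "n \<in> N" for x n
  proof -
    have c: "x \<in> carrier G" "n \<in> carrier G" using x n TM NM MG by auto
    have "?\<pi> x \<in> section_centralizer ?Q ?N (\<gamma> i ?Q)"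
      using comm[OF Q.finite_group_axioms sM' nN' NM'] x T_im by blast
    then have mem: "?\<pi> x \<otimes>\<^bsub>?Q\<^esub> ?\<pi> n \<otimes>\<^bsub>?Q\<^esub> inv\<^bsub>?Q\<^esub> ?\<pi> x \<otimes>\<^bsub>?Q\<^esub> inv\<^bsub>?Q\<^esub> ?\<pi> n \<in> \<gamma> i ?Q"
      using n unfolding section_centralizer_def by blast
    have image: "?\<pi> x \<otimes>\<^bsub>?Q\<^esub> ?\<pi> n \<otimes>\<^bsub>?Q\<^esub> inv\<^bsub>?Q\<^esub> ?\<pi> x \<otimes>\<^bsub>?Q\<^esub> inv\<^bsub>?Q\<^esub> ?\<pi> n = ?\<pi> (x \<otimes> n \<otimes> inv x \<otimes> inv n)"
      using c \<pi>.hom_mult \<pi>.hom_inv by (simp only: m_closed inv_closed)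
    have "?\<pi> (x \<otimes> n \<otimes> inv x \<otimes> inv n) \<in> \<gamma> i ?Q"
      using mem by (simp only: image)
    moreover have "x \<otimes> n \<otimes> inv x \<otimes> inv n \<in> carrier G" using c by simp
    ultimately show ?thesis using S_iff by blast
  qed
  have TN: "T \<subseteq> N"
  proof
    fix x assume x: "x \<in> T"
    then have xG: "x \<in> carrier G" using TM MG by blast
    have "?\<rho> x \<in> section_centralizer ?P (generalized_fitting_subgroup ?P) {\<one>\<^bsub>?P\<^esub>}"
      unfolding section_centralizer_def
    proof (intro CollectI conjI ballI)
      show "?\<rho> x \<in> carrier ?P" using xG by (rule \<rho>.hom_closed)
      fix y assume "y \<in> generalized_fitting_subgroup ?P"
      then obtain n where n: "n \<in> N" "y = ?\<rho> n" using N_im by blast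
      have nG: "n \<in> carrier G" using n NM MG by blast
      have "?\<rho> x \<otimes>\<^bsub>?P\<^esub> ?\<rho> n \<otimes>\<^bsub>?P\<^esub> inv\<^bsub>?P\<^esub> ?\<rho> x \<otimes>\<^bsub>?P\<^esub> inv\<^bsub>?P\<^esub> ?\<rho> n = ?\<rho> (x \<otimes> n \<otimes> inv x \<otimes> inv n)"
        using xG nG \<rho>.hom_mult \<rho>.hom_inv by (simp only: m_closed inv_closed)
      also have "\<dots> = \<one>\<^bsub>?P\<^esub>"
        using S.rcos_const[OF is_group T_comm[OF x n(1)]] by simp
      finally show "?\<rho> x \<otimes>\<^bsub>?P\<^esub> y \<otimes>\<^bsub>?P\<^esub> inv\<^bsub>?P\<^esub> ?\<rho> x \<otimes>\<^bsub>?P\<^esub> inv\<^bsub>?P\<^esub> y \<in> {\<one>\<^bsub>?P\<^esub>}"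
        by (simp only: n(2) singleton_iff)
    qed
    from subsetD[OF P.centralizer_Fs_subset this] show "x \<in> N"
      by (rule N_iff[OF xG, THEN iffD1])
  qed
  \<comment> \<open>\<open>down\<close> needs the radical of M/R to lie in a normal subgroup of G/R;
    the inclusion \<open>TN\<close> provides the image of \<open>N\<close>.\<close>
  have TQ: "?\<pi> ` T \<subseteq> \<gamma> i ?Q"
    using down[OF Q.finite_group_axioms sM' nN' NM'] T_im TN by blast
  have "T \<subseteq> S"
  proof
    fix x assume x: "x \<in> T"
    then have xG: "x \<in> carrier G" using TM MG by blast
    from subsetD[OF TQ imageI[OF x]] show "x \<in> S"
      by (rule iffD1[OF S_iff[OF xG]])
  qed
  moreover have "S \<subseteq> T"
  proof
    fix x assume x: "x \<in> S"
    have "\<gamma> i ?Q \<subseteq> ?M" unfolding S_im using SN NM by blast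
    then have "\<gamma> i ?Q \<subseteq> \<gamma> i (?Q\<lparr>carrier := ?M\<rparr>)" by (rule up[OF Q.finite_group_axioms sM'])
    then have "?\<pi> x \<in> \<gamma> i (G\<lparr>carrier := M\<rparr> Mod R)" using x S_im QM by auto
    then show "x \<in> T"
      using x SN NM by (auto simp: T_def radical_series_Suc eq R_def)
  qed
  ultimately have "T = S" by (rule subset_antisym)
  then show ?thesis by (simp only: S_def T_def)
qed

end

subsection \<open>The generalized Fitting height\<close>

lemma radicals_Fs: "radicals (\<lambda>_. generalized_fitting_subgroup)"
proof (rule radicals.intro)
  show "generalized_fitting_subgroup Q \<lhd> Q" if "finite_group Q" for Q :: "'a set monoid"
    using that by (rule finite_group.Fs_normal)
  show "h ` generalized_fitting_subgroup Q \<subseteq> generalized_fitting_subgroup Q'"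
    if "finite_surjective_hom Q Q' h" for Q Q' :: "'a set monoid" and h
    using that by (rule finite_surjective_hom.Fs_image)
  show "carrier Q = {\<one>\<^bsub>Q\<^esub>}" if "finite_group Q" "generalized_fitting_subgroup Q = {\<one>\<^bsub>Q\<^esub>}"
    for Q :: "'a set monoid"
    using that by (rule finite_group.Fs_nontrivial)
qed

lemma generalized_fitting_series_eq:
  "generalized_fitting_series G i = radical_series (\<lambda>_. generalized_fitting_subgroup) G i"
  by (induction i) (simp_all add: radical_series_Suc)

theorem (in finite_group) generalized_fitting_height_maximal_subgroup:
  assumes max: "maximal_subgroup M G"
  shows "generalized_fitting_height G \<le> generalized_fitting_height (G\<lparr>carrier := M\<rparr>) + 2"
proof -
  let ?\<gamma> = "\<lambda>_ :: nat. generalized_fitting_subgroup :: 'a set monoid \<Rightarrow> 'a set set"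
  have sM: "subgroup M G" using max by (simp add: maximal_subgroup_def)
  interpret finite_group_radicals G ?\<gamma>
    using finite_group_axioms radicals_Fs by (rule finite_group_radicals.intro)
  interpret M: finite_group_radicals "G\<lparr>carrier := M\<rparr>" ?\<gamma>
    using finite_group_restrict[OF finite_group_axioms sM] radicals_Fs
    by (rule finite_group_radicals.intro)
  let ?m = "generalized_fitting_height (G\<lparr>carrier := M\<rparr>)"
  have "\<exists>m. generalized_fitting_series (G\<lparr>carrier := M\<rparr>) m = carrier (G\<lparr>carrier := M\<rparr>)"
    using M.series_reaches_carrier by (simp add: generalized_fitting_series_eq)
  then have "generalized_fitting_series (G\<lparr>carrier := M\<rparr>) ?m = carrier (G\<lparr>carrier := M\<rparr>)"
    unfolding generalized_fitting_height_def by (rule LeastI_ex)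
  then have m: "M.W ?m = M" by (simp add: generalized_fitting_series_eq)
  have "W (Suc (Suc ?m)) = carrier G"
  proof (rule series_maximal_subgroup[OF max _ m])
    fix i assume i: "M.W i = W i" "W (Suc (Suc i)) \<subseteq> M"
    show "M.W (Suc i) = W (Suc i)"
      by (rule series_step[OF sM i refl finite_group.Fs_commutator_subset
            finite_group.Fs_restrict_subset finite_group.Fs_subset_restrict])
  qed
  then have "generalized_fitting_series G (?m + 2) = carrier G"
    by (simp only: generalized_fitting_series_eq add_2_eq_Suc')
  then show ?thesis
    unfolding generalized_fitting_height_def[of G] by (rule Least_le)
qed

subsection \<open>The non-p-soluble length\<close>

text \<open>The parity is that of \<open>p_length_series\<close>: steps with even index are
  p-soluble, so \<open>W (2 * h + 1)\<close> is reached by a p-soluble step.\<close>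

definition p_radicals :: "nat \<Rightarrow> nat \<Rightarrow> ('a, 'b) monoid_scheme \<Rightarrow> 'a set" where
  "p_radicals p i Q = (if even i then p_radical p Q else generalized_fitting_subgroup Q)"

lemma radicals_p_radicals:
  assumes p: "Factorial_Ring.prime p"
  shows "radicals (p_radicals p)"
proof (rule radicals.intro)
  show "p_radicals p i Q \<lhd> Q" if "finite_group Q" for i and Q :: "'a set monoid"
    using finite_group.p_radical_normal[OF that p] finite_group.Fs_normal[OF that]
    by (simp add: p_radicals_def)
  show "h ` p_radicals p i Q \<subseteq> p_radicals p (Suc (Suc i)) Q'"
    if "finite_surjective_hom Q Q' h" for i and Q Q' :: "'a set monoid" and h
    using finite_surjective_hom.p_radical_image[OF that p] finite_surjective_hom.Fs_image[OF that]
    by (simp add: p_radicals_def)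
  show "carrier Q = {\<one>\<^bsub>Q\<^esub>}"
    if "finite_group Q" "p_radicals p i Q = {\<one>\<^bsub>Q\<^esub>}" "p_radicals p (Suc i) Q = {\<one>\<^bsub>Q\<^esub>}"
    for i and Q :: "'a set monoid"
    using that finite_group.Fs_nontrivial[OF that(1)] by (auto simp: p_radicals_def split: if_splits)
qed

section \<open>The length read off from the alternating series\<close>

locale finite_group_p_radicals = finite_group G for G :: "('a, 'b) monoid_scheme" (structure) +
  fixes p :: nat
  assumes p: "Factorial_Ring.prime p"

sublocale finite_group_p_radicals \<subseteq> finite_group_radicals G "p_radicals p"
  using finite_group_axioms radicals_p_radicals[OF p] by (rule finite_group_radicals.intro)

context finite_group_p_radicals
begin

text \<open>For even \<open>j\<close> the natural map from G/W(j) to G/W(j+1) has the p-soluble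
  radical as its kernel, and factoring out this radical leaves a trivial one.\<close>

lemma p_radical_quotient_series:
  assumes "even j"
  shows "p_radical p (G Mod W (Suc j)) = {\<one>\<^bsub>G Mod W (Suc j)\<^esub>}"
proof -
  have cover: "W (Suc j) <#> carrier G = carrier G"
    by (rule set_mult_carrier[OF series_subgroup])
  have "W j \<lhd> G\<lparr>carrier := carrier G\<rparr>" using series_normal by simp
  then obtain \<theta> where \<theta>': "finite_surjective_hom (G\<lparr>carrier := carrier G\<rparr> Mod W j) (G Mod W (Suc j)) \<theta>"
    and \<theta>_coset: "\<And>x. x \<in> carrier G \<Longrightarrow> \<theta> (W j #> x) = W (Suc j) #> x"
    using quotient_map[OF subgroup_self _ series_normal series_Suc_mono cover] by blast
  then interpret \<theta>: finite_surjective_hom "G Mod W j" "G Mod W (Suc j)" \<theta> by simp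
  interpret N: normal "W (Suc j)" G by (rule series_normal)
  have "kernel (G Mod W j) (G Mod W (Suc j)) \<theta> = p_radicals p j (G Mod W j)"
  proof
    show "kernel (G Mod W j) (G Mod W (Suc j)) \<theta> \<subseteq> p_radicals p j (G Mod W j)"
    proof
      fix y assume "y \<in> kernel (G Mod W j) (G Mod W (Suc j)) \<theta>"
      then obtain x where x: "x \<in> carrier G" "y = W j #> x" "\<theta> y = W (Suc j)"
        by (auto simp: kernel_def carrier_FactGroup)
      then have "x \<in> W (Suc j)"
        using \<theta>_coset N.coset_eq_one_iff by metis
      then show "y \<in> p_radicals p j (G Mod W j)"
        using x coset_in_radical_iff[of x j] by simp
    qed
    show "p_radicals p j (G Mod W j) \<subseteq> kernel (G Mod W j) (G Mod W (Suc j)) \<theta>"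
    proof
      fix y assume "y \<in> p_radicals p j (G Mod W j)"
      then obtain x where x: "x \<in> W (Suc j)" "y = W j #> x"
        using radical_eq_image[of j] by blast
      then have "\<theta> y = W (Suc j)"
        using \<theta>_coset N.subset N.rcos_const[OF is_group] by auto
      then show "y \<in> kernel (G Mod W j) (G Mod W (Suc j)) \<theta>"
        using x N.subset by (auto simp: kernel_def carrier_FactGroup)
    qed
  qed
  then show ?thesis
    using \<theta>.p_radical_quotient_trivial[OF p] assms by (simp add: p_radicals_def)
qed

text \<open>\<open>W\<close> ascends fastest. Modulo \<open>N i\<close>, the next factor lies in the
  radical for the parity of \<open>i\<close>: an even one as a normal p-soluble subgroup, an odd one
  because it is generated by components, which are components of the quotient. The map from G/N(i)
  to G/W(i) preserves this.\<close>

lemma p_length_series_subset: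
  assumes N: "p_length_series p G h N"
  shows "i \<le> 2 * h + 1 \<Longrightarrow> N i \<subseteq> W i"
proof (induction i)
  case 0
  then show ?case using N by (simp add: p_length_series_def)
next
  case (Suc i)
  then have nK: "N i \<lhd> G" and nL: "N (Suc i) \<lhd> G"
    and even: "even i \<Longrightarrow> p_soluble p (G\<lparr>carrier := N (Suc i)\<rparr> Mod N i)"
    and odd: "odd i \<Longrightarrow> product_of_nonabelian_simple_groups (G\<lparr>carrier := N (Suc i)\<rparr> Mod N i)"
    using N by (auto simp: p_length_series_def)
  have le: "N i \<subseteq> W i" using Suc by simp
  have cover: "W i <#> carrier G = carrier G"
    by (rule set_mult_carrier[OF series_subgroup])
  have "N i \<lhd> G\<lparr>carrier := carrier G\<rparr>" using nK by simp
  then obtain \<theta> where \<theta>': "finite_surjective_hom (G\<lparr>carrier := carrier G\<rparr> Mod N i) (G Mod W i) \<theta>"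
    and \<theta>_coset: "\<And>x. x \<in> carrier G \<Longrightarrow> \<theta> (N i #> x) = W i #> x"
    using quotient_map[OF subgroup_self _ series_normal le cover] by blast
  then have \<theta>: "finite_surjective_hom (G Mod N i) (G Mod W i) \<theta>" by simp
  interpret q: finite_surjective_hom G "G Mod N i" "\<lambda>x. N i #> x" by (rule coset_map_hom[OF nK])
  interpret Q: finite_group "G Mod N i" by (rule q.codomain_finite_group)
  let ?L = "(\<lambda>x. N i #> x) ` N (Suc i)"
  have QL: "G\<lparr>carrier := N (Suc i)\<rparr> Mod N i = (G Mod N i)\<lparr>carrier := ?L\<rparr>"
    by (rule restrict_Mod_eq)
  have L: "?L \<lhd> G Mod N i" by (rule q.image_normal[OF nL])
  have sL: "subgroup ?L (G Mod N i)" using L by (rule normal_imp_subgroup)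
  have snL: "subnormal (G Mod N i) ?L" using L by (rule q.H.normal_imp_subnormal)
  have "?L \<subseteq> p_radicals p i (G Mod N i)"
  proof (cases "even i")
    case True
    have "?L \<subseteq> p_radical p (G Mod N i)"
      using even[OF True] by (intro Q.subnormal_p_soluble_subset_p_radical[OF p snL]) (simp only: QL)
    then show ?thesis using True by (simp add: p_radicals_def)
  next
    case False
    interpret L: finite_group "(G Mod N i)\<lparr>carrier := ?L\<rparr>"
      by (rule finite_group_restrict[OF Q.finite_group_axioms sL])
    have "product_of_nonabelian_simple_groups ((G Mod N i)\<lparr>carrier := ?L\<rparr>)"
      using odd[OF False] by (simp only: QL)
    then have "?L \<subseteq> layer ((G Mod N i)\<lparr>carrier := ?L\<rparr>)"
      using L.product_of_simple_layer by simp
    moreover have "layer ((G Mod N i)\<lparr>carrier := ?L\<rparr>) \<subseteq> Q.Fs \<inter> ?L"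
    proof (rule L.layer_subset)
      show "subgroup (Q.Fs \<inter> ?L) ((G Mod N i)\<lparr>carrier := ?L\<rparr>)"
        using q.H.subgroups_Inter_pair[OF Q.Fs_subgroup sL]
        by (simp add: q.H.subgroup_restrict_iff[OF sL])
      fix K assume K: "component ((G Mod N i)\<lparr>carrier := ?L\<rparr>) K"
      have "K \<subseteq> ?L"
        using subgroup.subset[OF L.component_subgroup[OF K]] by simp
      then show "K \<subseteq> Q.Fs \<inter> ?L"
        using Q.component_subset_Fs[OF Q.component_of_subnormal[OF snL K]] by blast
    qed
    ultimately show ?thesis using False by (auto simp: p_radicals_def)
  qed
  \<comment> \<open>\<open>\<gamma>_image\<close> speaks of the index i + 2, but
    \<open>p_radicals\<close> depends on parity only.\<close>
  moreover have "\<theta> ` p_radicals p i (G Mod N i) \<subseteq> p_radicals p i (G Mod W i)"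
    using \<gamma>_image[OF \<theta>, of i] by (simp add: p_radicals_def)
  ultimately have image: "\<theta> (N i #> x) \<in> p_radicals p i (G Mod W i)" if "x \<in> N (Suc i)" for x
    using that by blast
  show ?case
  proof
    fix x assume x: "x \<in> N (Suc i)"
    then have xG: "x \<in> carrier G"
      using subgroup.subset[OF normal_imp_subgroup[OF nL]] by blast
    have "W i #> x \<in> p_radicals p i (G Mod W i)"
      using image[OF x] by (simp only: \<theta>_coset[OF xG])
    then show "x \<in> W (Suc i)" by (rule iffD1[OF coset_in_radical_iff[OF xG]])
  qed
qed

text \<open>For odd \<open>i\<close> the p-soluble radical of G/W(i) is trivial, hence so is its
  Fitting subgroup, and F* is a product of simple groups. Minimality of \<open>h\<close> keeps this
  product non-empty: \<open>W\<close> does not equal \<open>G\<close> at an odd index below 2h +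
  1.\<close>

lemma p_length_series_W:
  assumes h: "W (2 * h + 1) = carrier G" and least: "\<And>j. j < h \<Longrightarrow> W (2 * j + 1) \<noteq> carrier G"
  shows "p_length_series p G h W"
  unfolding p_length_series_def
proof (intro conjI allI impI series_normal series_Suc_mono h)
  fix i assume i: "i \<le> 2 * h"
  interpret Q: finite_group "G Mod W i" by (rule finite_group_Mod[OF series_normal])
  have eq: "G\<lparr>carrier := W (Suc i)\<rparr> Mod W i = (G Mod W i)\<lparr>carrier := p_radicals p i (G Mod W i)\<rparr>"
    using restrict_Mod_eq[where G = G and M = "W (Suc i)" and R = "W i"] radical_eq_image[of i] by simp
  show "p_soluble p (G\<lparr>carrier := W (Suc i)\<rparr> Mod W i)" if "even i"
    unfolding eq using that Q.p_radical_p_soluble[OF p] by (simp add: p_radicals_def)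
  assume "odd i"
  then obtain j where j: "i = Suc (2 * j)" by (auto elim: oddE)
  have "p_radical p (G Mod W i) = {\<one>\<^bsub>G Mod W i\<^esub>}"
    unfolding j by (rule p_radical_quotient_series) simp
  then have F: "fitting_subgroup (G Mod W i) = {\<one>\<^bsub>G Mod W i\<^esub>}"
    using Q.fitting_subset_p_radical[OF p] subgroup.one_closed[OF normal_imp_subgroup[OF Q.fitting_normal]]
    by blast
  have "W i \<noteq> carrier G" using least[of j] i j by simp
  then have "carrier (G Mod W i) \<noteq> {\<one>\<^bsub>G Mod W i\<^esub>}"
    using normal.fact_group_trivial_iff[OF series_normal finite_carrier] by blast
  from Fs_product_of_simple[OF Q.finite_group_axioms F this]
  show "product_of_nonabelian_simple_groups (G\<lparr>carrier := W (Suc i)\<rparr> Mod W i)"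
    unfolding eq using \<open>odd i\<close> by (simp add: p_radicals_def)
qed simp

lemma non_p_soluble_length_le:
  assumes "W (2 * h + 1) = carrier G"
  shows "non_p_soluble_length p G \<le> h"
proof -
  define h0 where "h0 = (LEAST h. W (2 * h + 1) = carrier G)"
  have "W (2 * h0 + 1) = carrier G"
    unfolding h0_def using assms by (rule LeastI)
  moreover have "W (2 * j + 1) \<noteq> carrier G" if "j < h0" for j
    using not_less_Least that unfolding h0_def by blast
  ultimately have "p_length_series p G h0 W" by (rule p_length_series_W)
  then have "non_p_soluble_length p G \<le> h0"
    unfolding non_p_soluble_length_def by (intro Least_le) blast
  also have "h0 \<le> h"
    unfolding h0_def using assms by (rule Least_le)
  finally show ?thesis .
qed

text \<open>\<open>W\<close> itself, cut at the least possible index, shows that admissible series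
  exist. A shortest one lies termwise below \<open>W\<close>, so \<open>W\<close> has reached
  \<open>G\<close> when it does.\<close>

lemma series_non_p_soluble_length: "W (2 * non_p_soluble_length p G + 1) = carrier G"
proof -
  obtain m where m: "W m = carrier G" using series_reaches_carrier ..
  have "W (2 * m + 1) = carrier G"
    using series_mono[of m "2 * m + 1"] m subgroup.subset[OF series_subgroup] by auto
  then have ex: "\<exists>h. W (2 * h + 1) = carrier G" ..
  define h0 where "h0 = (LEAST h. W (2 * h + 1) = carrier G)"
  have "W (2 * h0 + 1) = carrier G"
    unfolding h0_def using ex by (rule LeastI_ex)
  moreover have "W (2 * j + 1) \<noteq> carrier G" if "j < h0" for j
    using not_less_Least that unfolding h0_def by blast
  ultimately have "p_length_series p G h0 W" by (rule p_length_series_W)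
  then have "\<exists>h N. p_length_series p G h N" by blast
  then have "\<exists>N. p_length_series p G (non_p_soluble_length p G) N"
    unfolding non_p_soluble_length_def by (rule LeastI_ex)
  then obtain N where N: "p_length_series p G (non_p_soluble_length p G) N" ..
  then have "N (2 * non_p_soluble_length p G + 1) = carrier G"
    by (simp add: p_length_series_def)
  then show ?thesis
    using p_length_series_subset[OF N, of "2 * non_p_soluble_length p G + 1"]
      subgroup.subset[OF series_subgroup] by blast
qed

text \<open>For even \<open>i\<close> the following radical is F*, which contains its centralizer,
  and \<open>series_step\<close> applies. For odd \<open>i\<close> the following radical is
  p-soluble and that argument fails; but the step before \<open>i\<close> was p-soluble, so M/W(i)
  has trivial p-soluble radical and \<open>Fs_restrict_eq\<close> gives equality of the generalized
  Fitting subgroups.\<close>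

lemma p_radicals_series_step:
  assumes sM: "subgroup M G" and eq: "radical_series (p_radicals p) (G\<lparr>carrier := M\<rparr>) i = W i"
    and N: "W (Suc (Suc i)) \<subseteq> M"
  shows "radical_series (p_radicals p) (G\<lparr>carrier := M\<rparr>) (Suc i) = W (Suc i)"
proof (cases "even i")
  case True
  show ?thesis
  proof (rule series_step[OF sM eq N])
    show "p_radicals p (Suc i) Q = generalized_fitting_subgroup Q" for Q :: "'a set monoid"
      using True by (simp add: p_radicals_def)
    fix Q :: "'a set monoid" and H assume Q: "finite_group Q" "subgroup H Q"
    show "p_radicals p i Q \<subseteq> p_radicals p i (Q\<lparr>carrier := H\<rparr>)" if "p_radicals p i Q \<subseteq> H"
      using that finite_group.p_radical_subset_restrict[OF Q(1) p Q(2)] True by (simp add: p_radicals_def)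
    fix N assume N: "N \<lhd> Q" "N \<subseteq> H"
    show "p_radicals p i (Q\<lparr>carrier := H\<rparr>) \<subseteq> section_centralizer Q N (p_radicals p i Q)"
      using finite_group.p_radical_commutator_subset(2)[OF Q(1) p Q(2) N] True by (simp add: p_radicals_def)
    show "p_radicals p i (Q\<lparr>carrier := H\<rparr>) \<subseteq> p_radicals p i Q" if "p_radicals p i (Q\<lparr>carrier := H\<rparr>) \<subseteq> N"
      using finite_group.p_radical_commutator_subset(1)[OF Q(1) p Q(2) N] that True
      by (auto simp: p_radicals_def)
  qed
next
  case False
  interpret M: finite_group_p_radicals "G\<lparr>carrier := M\<rparr>" p
    using finite_group_restrict[OF finite_group_axioms sM] p
    by (simp add: finite_group_p_radicals_def finite_group_p_radicals_axioms_def)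
  obtain j where j: "i = Suc j" "even j"
    using False by (cases i) auto
  define R where "R = W i"
  have R: "R \<lhd> G" unfolding R_def by (rule series_normal)
  interpret q: finite_surjective_hom G "G Mod R" "\<lambda>x. R #> x" by (rule coset_map_hom[OF R])
  interpret Q: finite_group "G Mod R" by (rule q.codomain_finite_group)
  let ?M = "(\<lambda>x. R #> x) ` M"
  have QM: "G\<lparr>carrier := M\<rparr> Mod R = (G Mod R)\<lparr>carrier := ?M\<rparr>" by (rule restrict_Mod_eq)
  have sM': "subgroup ?M (G Mod R)" by (rule q.subgroup_img_is_subgroup[OF sM])
  have SM: "W (Suc i) \<subseteq> M" using N series_Suc_mono[of "Suc i"] by blast
  have "Q.Fs = (\<lambda>x. R #> x) ` W (Suc i)"
    using radical_eq_image[of i] False by (simp only: R_def p_radicals_def if_False)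
  then have FM: "Q.Fs \<subseteq> ?M" using SM by blast
  have MW: "M.W i = R" using eq by (simp add: R_def)
  have "p_radical p (G\<lparr>carrier := M\<rparr> Mod M.W i) = {\<one>\<^bsub>G\<lparr>carrier := M\<rparr> Mod M.W i\<^esub>}"
    unfolding j(1) by (rule M.p_radical_quotient_series[OF j(2)])
  then have "p_radical p ((G Mod R)\<lparr>carrier := ?M\<rparr>) = {\<one>\<^bsub>G Mod R\<^esub>}"
    unfolding MW QM by simp
  then have "generalized_fitting_subgroup ((G Mod R)\<lparr>carrier := ?M\<rparr>) = Q.Fs"
    by (rule Q.Fs_restrict_eq[OF p sM' FM])
  then have same: "p_radicals p i (G\<lparr>carrier := M\<rparr> Mod R) = p_radicals p i (G Mod R)"
    using False by (simp add: p_radicals_def QM)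
  have "M.W (Suc i) = {x \<in> M. R #> x \<in> p_radicals p i (G Mod R)}"
    by (simp add: MW same radical_series_Suc)
  moreover have "W (Suc i) = {x \<in> carrier G. R #> x \<in> p_radicals p i (G Mod R)}"
    by (simp add: R_def radical_series_Suc)
  ultimately show ?thesis
    using SM subgroup.subset[OF sM] by blast
qed

theorem non_p_soluble_length_maximal_subgroup:
  assumes max: "maximal_subgroup M G"
  shows "non_p_soluble_length p G \<le> non_p_soluble_length p (G\<lparr>carrier := M\<rparr>) + 1"
proof -
  have sM: "subgroup M G" using max by (simp add: maximal_subgroup_def)
  interpret M: finite_group_p_radicals "G\<lparr>carrier := M\<rparr>" p
    using finite_group_restrict[OF finite_group_axioms sM] p
    by (simp add: finite_group_p_radicals_def finite_group_p_radicals_axioms_def)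
  let ?h = "non_p_soluble_length p (G\<lparr>carrier := M\<rparr>)"
  have m: "M.W (2 * ?h + 1) = M" using M.series_non_p_soluble_length by simp
  \<comment> \<open>Two further terms of \<open>W\<close> amount to one unit of length.\<close>
  have "W (Suc (Suc (2 * ?h + 1))) = carrier G"
    by (rule series_maximal_subgroup[OF max _ m]) (rule p_radicals_series_step[OF sM])
  moreover have "Suc (Suc (2 * ?h + 1)) = 2 * (?h + 1) + 1" by simp
  ultimately show ?thesis
    using non_p_soluble_length_le by metis
qed

end

theorem theorem1:
  fixes G :: "('a, 'b) monoid_scheme" and M :: "'a set" and p :: nat
  assumes "group G" and "finite (carrier G)"
    and "maximal_subgroup M G"
    and "Factorial_Ring.prime p"
  shows "int (generalized_fitting_height G)
             - int (generalized_fitting_height (G\<lparr>carrier := M\<rparr>)) \<le> 2 \<and>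
         int (nonsoluble_length G) - int (nonsoluble_length (G\<lparr>carrier := M\<rparr>)) \<le> 1 \<and>
         int (non_p_soluble_length p G) - int (non_p_soluble_length p (G\<lparr>carrier := M\<rparr>)) \<le> 1"
proof -
  interpret finite_group G
    using assms(1,2) by (simp add: finite_group_def finite_group_axioms_def)
  \<comment> \<open>\<open>q\<close> is kept arbitrary in order to serve for 2, which is the
    nonsoluble length, as well as for \<open>p\<close>.\<close>
  have "non_p_soluble_length q G \<le> non_p_soluble_length q (G\<lparr>carrier := M\<rparr>) + 1"
    if "Factorial_Ring.prime q" for q
    using finite_group_axioms that assms(3)
    by (intro finite_group_p_radicals.non_p_soluble_length_maximal_subgroup)
      (simp_all add: finite_group_p_radicals_def finite_group_p_radicals_axioms_def)
  from this[OF two_is_prime_nat] this[OF assms(4)]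
    generalized_fitting_height_maximal_subgroup[OF assms(3)]
  show ?thesis
    unfolding nonsoluble_length_def by linarith
qed

end
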